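(* Let $\phi:[0,1)\to(0,1)$ be decreasing, and let $M:[0,1)\to[1,\infty)$ be an increasing function satisfying, for some constant $c>1$, $M(1-t/2)\le c\,M(1-t)$ for all $0<t\le 1$. Let $\Omega=B\setminus E$, $E=\bigcup_{k=1}^\infty\overline{B}(x_k,r_k)$, be a champagne subregion of the unit disc $B\subset\mathbb{R}^2$, where $r_k=(1-|x_k|)\phi(|x_k|)$ for all $k$. For $a\in(0,1)$ and $x\in B$ let $$N_a(x)=\#\left[B(x,a(1-|x|))\cap\{x_k:k\in\mathbb{N}\}\right].$$ (a) If $E$ is unavoidable and there are constants $a\in(0,1)$ and $b>0$ such that $N_a(x)\le bM(|x|)$ for all $x\in B$, then $$\int_0^1\frac{M(t)}{(1-t)\log(1/\phi(t))}\,dt=\infty.\qquad( * )$$ (b) Conversely, if $( * )$ holds together with $$\inf_{j\neq k}\frac{|x_k-x_j|\left\{\log\frac{1}{\phi(|x_k|)}\right\}^{1/2}}{1-|x_k|}>0,$$ and if there are constants $a\in(0,1)$ and $b>0$ such that $N_a(x)\ge bM(|x|)$ for all $x\in B$, then $E$ is unavoidable.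
   Context: $B(x,r)$ denotes the open disc in $\mathbb{R}^2$ of centre $x$ and radius $r>0$, and $B=B(0,1)$. Let $(\overline{B}(x_k,r_k))_{k\ge 1}$ be a sequence of pairwise disjoint closed discs, with $x_k\in B$ and $r_k>0$, such that $|x_k|\to 1$ and $\sup_k r_k/(1-|x_k|)<1$. Put $E=\bigcup_{k=1}^\infty\overline{B}(x_k,r_k)$. The set $\Omega=B\setminus E$ is called a champagne subregion of the unit disc; it is assumed throughout that $0\in\Omega$. The set $E$ is called unavoidable if it carries full harmonic measure with respect to $\Omega$, that is, the harmonic measure of $\partial B$ relative to $\Omega$ is zero. *)

theory Defs
  imports "HOL-Analysis.Analysis"
begin

text \<open>The plane is identified with the complex numbers; \<open>\<bar>x\<bar>\<close> is \<^term>\<open>norm x\<close>.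

  Harmonic measure is defined by the Perron-Wiener-Brelot method, with
  extended-real-valued hyperharmonic functions.\<close>

text \<open>Mean value of \<open>u\<close> over the circle of centre \<open>z\<close> and radius \<open>\<rho>\<close>, as the integral of the
  positive part minus that of the negative part (\<^const>\<open>e2ennreal\<close> sends negative values to 0).
  Where it is used, \<open>u\<close> is bounded below on the circle, so the subtracted term is finite.\<close>

definition circle_mean :: "(complex \<Rightarrow> ereal) \<Rightarrow> complex \<Rightarrow> real \<Rightarrow> ereal" where
  "circle_mean u z \<rho> =
     (enn2ereal (\<integral>\<^sup>+t\<in>{0..2*pi}. e2ennreal (u (z + rcis \<rho> t)) \<partial>lborel)
      - enn2ereal (\<integral>\<^sup>+t\<in>{0..2*pi}. e2ennreal (- u (z + rcis \<rho> t)) \<partial>lborel)) / ereal (2*pi)"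

definition lower_semicontinuous_on :: "complex set \<Rightarrow> (complex \<Rightarrow> ereal) \<Rightarrow> bool" where
  "lower_semicontinuous_on D u \<longleftrightarrow> (\<forall>z\<in>D. u z \<le> Liminf (at z within D) u)"

definition hyperharmonic_on :: "complex set \<Rightarrow> (complex \<Rightarrow> ereal) \<Rightarrow> bool" where
  "hyperharmonic_on D u \<longleftrightarrow>
     (\<forall>z\<in>D. u z \<noteq> -\<infinity>) \<and> lower_semicontinuous_on D u \<and>
     (\<forall>z \<rho>. 0 < \<rho> \<longrightarrow> cball z \<rho> \<subseteq> D \<longrightarrow> circle_mean u z \<rho> \<le> u z)"

definition upper_class :: "complex set \<Rightarrow> (complex \<Rightarrow> ereal) \<Rightarrow> (complex \<Rightarrow> ereal) set" where
  "upper_class D f =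
     {u. hyperharmonic_on D u \<and> (\<exists>m::real. \<forall>z\<in>D. ereal m \<le> u z) \<and>
         (\<forall>y\<in>frontier D. f y \<le> Liminf (at y within D) u)}"

definition upper_PWB :: "complex set \<Rightarrow> (complex \<Rightarrow> ereal) \<Rightarrow> complex \<Rightarrow> ereal" where
  "upper_PWB D f z = (INF u \<in> upper_class D f. u z)"

text \<open>For a bounded open set \<open>D\<close> and a Borel set \<open>A\<close>, the indicator function of \<open>A\<close> is resolutive,
  so its upper PWB solution is its PWB solution, i.e. the harmonic measure of
  \<open>A \<inter> frontier D\<close> relative to \<open>D\<close> at the point \<open>z\<close>.\<close>

definition harmonic_measure :: "complex set \<Rightarrow> complex \<Rightarrow> complex set \<Rightarrow> ereal" where
  "harmonic_measure D z A = upper_PWB D (indicator A) z"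

definition discs_union :: "(nat \<Rightarrow> complex) \<Rightarrow> (nat \<Rightarrow> real) \<Rightarrow> complex set" where
  "discs_union x r = (\<Union>k. cball (x k) (r k))"

definition champagne :: "(nat \<Rightarrow> complex) \<Rightarrow> (nat \<Rightarrow> real) \<Rightarrow> bool" where
  "champagne x r \<longleftrightarrow>
     (\<forall>k. x k \<in> ball 0 1) \<and> (\<forall>k. 0 < r k) \<and>
     disjoint_family (\<lambda>k. cball (x k) (r k)) \<and>
     (\<lambda>k. norm (x k)) \<longlonglongrightarrow> 1 \<and>
     (SUP k. ereal (r k / (1 - norm (x k)))) < 1 \<and>
     0 \<in> ball 0 1 - discs_union x r"

definition unavoidable :: "complex set \<Rightarrow> bool" where
  "unavoidable E \<longleftrightarrow>
     (\<forall>z \<in> ball 0 1 - E. harmonic_measure (ball 0 1 - E) z (sphere 0 1) = 0)"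

text \<open>In a champagne subregion the centres are distinct and accumulate only on the unit circle, so
  for \<open>0 < a < 1\<close> and \<open>norm z < 1\<close> the set counted here is finite.\<close>

definition centre_count :: "(nat \<Rightarrow> complex) \<Rightarrow> real \<Rightarrow> complex \<Rightarrow> nat" where
  "centre_count x a z = card (ball z (a * (1 - norm z)) \<inter> range x)"

end

theory Submission
  imports Defs "HOL-Complex_Analysis.Complex_Analysis"
begin

text \<open>Write \<open>L k = ln (1 / \<phi> \<bar>x k\<bar>)\<close>. The Green function of the unit disc with pole \<open>x k\<close> is at least
  \<open>L k\<close> on the \<open>k\<close>-th disc.

  (a) By the minimum principle the harmonic measure of the unit circle at \<open>z\<close> is at least \<open>1 - W z\<close>,
  where \<open>W\<close> is the Green potential of the masses \<open>1 / L k\<close>. If the integral is finite, counting the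
  centres in the annuli \<open>1 - q\<^sup>n \<le> \<bar>x\<bar> < 1 - q\<^sup>n\<^sup>+\<^sup>1\<close> gives \<open>\<Sum> (1 - \<bar>x k\<bar>) / L k < \<infinity>\<close>, so the mean of
  \<open>W\<close> over \<open>\<bar>z\<bar> = \<rho>\<close> tends to \<open>0\<close> as \<open>\<rho> \<rightarrow> 1\<close>, and \<open>W z < 1\<close> somewhere.

  (b) By the separation condition, masses \<open>1 / L k\<close> at the centres in one such annulus have a Green
  potential bounded on \<open>\<Omega>\<close> by a constant \<open>C\<close> not depending on the annulus: spreading each mass over a
  disc of radius comparable to \<open>(1 - \<bar>x k\<bar>) / sqrt (L k)\<close> gives disjoint discs and a density
  comparable to \<open>(1 - \<bar>x\<bar>)\<^sup>-\<^sup>2\<close>. The lower bound on the number of centres bounds the potential from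
  below on the inner circle. Hence the probability of crossing the annulus without hitting \<open>E\<close> is at
  most \<open>exp (- p n)\<close> with \<open>\<Sum> p n = \<infinity>\<close>; pasting the corresponding functions over successive annuli
  produces members of the upper class that are arbitrarily small at a given point.\<close>

section \<open>Means over circles\<close>

text \<open>The upper class demands the super-mean inequality on every circle inside the region,
  whereas functions obtained by gluing and taking minima visibly satisfy it only on small circles,
  of a size depending on the centre. So the work is done with local conditions, and the passage to
  all circles is made once, for continuous functions. Each estimate is the minimum principle applied
  to an explicit function; no Dirichlet problem is solved. The infinitude of discs is handled by
  staying inside smaller concentric discs, which only finitely many of them meet.

  The square root in the separation condition is dictated by density: mass \<open>1 / L\<close> on a
  disc of radius \<open>\<rho>\<close> has density of order \<open>1 / (L * \<rho>^2)\<close>, and a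
  collar of width d carries density of order d^-2 at bounded potential. The doubling of
  \<open>M\<close> pays for comparing the two ends of an annulus: \<open>M\<close> and
  \<open>ln (1 / \<phi>)\<close> both increase but enter as a quotient, so bounds for the integral
  take them at opposite ends.\<close>

lemma mean_value_holomorphic:
  assumes f: "f holomorphic_on cball z \<rho>" and \<rho>: "0 < \<rho>"
  shows "((\<lambda>t. f (z + rcis \<rho> t)) has_integral 2 * of_real pi * f z) {0..2*pi}"
proof -
  have "((\<lambda>u. f u / (u - z)) has_contour_integral (2 * of_real pi * \<i> * f z))
      (part_circlepath z \<rho> 0 (2*pi))"
    using Cauchy_integral_circlepath_simple[OF f, of z] \<rho> by (simp add: circlepath_def)
  then have "((\<lambda>t. f (z + \<rho> * cis t) / (z + \<rho> * cis t - z) * \<rho> * \<i> * cis t)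
      has_integral (2 * of_real pi * \<i> * f z)) {0..2*pi}"
    by (subst (asm) has_contour_integral_part_circlepath_iff) auto
  then have "((\<lambda>t. f (z + rcis \<rho> t) * \<i>) has_integral (2 * of_real pi * \<i> * f z)) {0..2*pi}"
    using \<rho> by (simp add: rcis_def)
  from has_integral_mult_left[OF this, of "- \<i>"] show ?thesis
    by (simp add: algebra_simps flip: power2_eq_square)
qed

lemma mean_value_Re:
  assumes "f holomorphic_on cball z \<rho>" "0 < \<rho>"
  shows "((\<lambda>t. Re (f (z + rcis \<rho> t))) has_integral 2 * pi * Re (f z)) {0..2*pi}"
proof -
  have "((\<lambda>t. Re (f (z + rcis \<rho> t))) has_integral Re (2 * of_real pi * f z)) {0..2*pi}"
    using has_integral_linear[OF mean_value_holomorphic[OF assms] bounded_linear_Re]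
    by (simp add: o_def)
  then show ?thesis by simp
qed

text \<open>The inequality keeps any zero of \<open>a + b * w\<close> outside the closed disc.
  Dividing by the value \<open>c\<close> at the centre puts the image of the disc within distance
  less than 1 of the point 1, hence into the right half-plane, where the principal \<open>Ln\<close>
  is holomorphic.\<close>

lemma mean_value_ln_affine:
  fixes a b z :: complex
  assumes \<rho>: "0 < \<rho>" and less: "norm b * \<rho> < norm (a + b * z)"
  shows "((\<lambda>t. ln (norm (a + b * (z + rcis \<rho> t)))) has_integral 2 * pi * ln (norm (a + b * z))) {0..2*pi}"
proof -
  define c where "c = a + b * z"
  have c: "c \<noteq> 0" 
    using le_less_trans[OF mult_nonneg_nonneg[of "norm b" \<rho>] less] \<rho> by (auto simp: c_def)
  define g where "g = (\<lambda>w. (a + b * w) / c)"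
  have g_eq: "g w = 1 + b * (w - z) / c" for w
    using c by (simp add: g_def c_def field_simps)
  have pos: "0 < Re (g w)" if "w \<in> cball z \<rho>" for w
  proof -
    have "norm (b * (w - z) / c) = norm b * norm (w - z) / norm c"
      by (simp add: norm_mult norm_divide)
    also have "\<dots> \<le> norm b * \<rho> / norm c"
      using that by (intro divide_right_mono mult_left_mono) (auto simp: dist_norm norm_minus_commute)
    also have "\<dots> < 1" using less c by (simp add: c_def)
    finally have "\<bar>Re (b * (w - z) / c)\<bar> < 1"
      using abs_Re_le_cmod[of "b * (w - z) / c"] by linarith
    then show ?thesis by (simp add: g_eq)
  qed
  have "(\<lambda>w. Ln (g w)) holomorphic_on cball z \<rho>"
    unfolding g_def using c pos
    by (intro holomorphic_intros) (auto simp: complex_nonpos_Reals_iff g_def, fastforce)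
  note mv = mean_value_Re[OF this \<rho>]
  have ln_g: "Re (Ln (g w)) = ln (norm (a + b * w)) - ln (norm c)" if "w \<in> cball z \<rho>" for w
  proof -
    have "g w \<noteq> 0" using pos[OF that] by auto
    then show ?thesis using c by (simp add: g_def norm_divide ln_div)
  qed
  have mem: "z + rcis \<rho> t \<in> cball z \<rho>" for t using \<rho> by (simp add: dist_norm)
  have "((\<lambda>t. ln (norm (a + b * (z + rcis \<rho> t))) - ln (norm c)) has_integral
      2 * pi * (ln (norm (a + b * z)) - ln (norm c))) {0..2*pi}"
    using mv ln_g[OF mem] ln_g[of z] \<rho> by simp
  from has_integral_add[OF this has_integral_const_real[of "ln (norm c)" 0 "2*pi"]]
  show ?thesis by (simp add: algebra_simps c_def)
qed

lemma continuous_on_circle: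
  assumes "continuous_on S h" "sphere z \<rho> \<subseteq> S" "0 < \<rho>"
  shows "continuous_on T (\<lambda>t. h (z + rcis \<rho> t))"
proof -
  have "continuous_on T (\<lambda>t. z + rcis \<rho> t)"
    unfolding rcis_def cis_conv_exp by (intro continuous_intros)
  moreover have "(\<lambda>t. z + rcis \<rho> t) ` T \<subseteq> S"
    using assms by (auto simp: dist_norm)
  ultimately show ?thesis
    using continuous_on_compose2[OF assms(1)] by blast
qed

lemma ereal_add_eq_imp_diff_eq:
  fixes P S :: ereal
  assumes "P + ereal k = S + ereal n"
  shows "P - ereal n = S - ereal k"
  using assms by (cases P; cases S) auto

text \<open>Adding \<open>c\<close> makes \<open>F\<close> nonnegative, so the two parts merge into
  one nonnegative integral. The identity F^+ + c = (F + c) + F^- is integrated before anything is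
  subtracted, since only the negative part is known to have a finite integral.\<close>

lemma positive_minus_negative_part:
  fixes F :: "real \<Rightarrow> ereal"
  assumes F[measurable]: "F \<in> borel_measurable borel" and ge: "\<And>t. ereal (-c) \<le> F t" and c: "0 \<le> c"
  shows "enn2ereal (\<integral>\<^sup>+t\<in>{0..2*pi}. e2ennreal (F t) \<partial>lborel)
      - enn2ereal (\<integral>\<^sup>+t\<in>{0..2*pi}. e2ennreal (- F t) \<partial>lborel)
      = enn2ereal (\<integral>\<^sup>+t\<in>{0..2*pi}. e2ennreal (F t + ereal c) \<partial>lborel) - ereal (2 * pi * c)"
proof -
  let ?P = "\<integral>\<^sup>+t\<in>{0..2*pi}. e2ennreal (F t) \<partial>lborel"
  let ?N = "\<integral>\<^sup>+t\<in>{0..2*pi}. e2ennreal (- F t) \<partial>lborel"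
  let ?S = "\<integral>\<^sup>+t\<in>{0..2*pi}. e2ennreal (F t + ereal c) \<partial>lborel"
  have const: "(\<integral>\<^sup>+t\<in>{0..2*pi}. ennreal c \<partial>lborel) = ennreal (2 * pi * c)"
    using c by (subst nn_integral_cmult_indicator) (auto simp: ennreal_mult'' mult.commute)
  have "?N \<le> (\<integral>\<^sup>+t\<in>{0..2*pi}. ennreal c \<partial>lborel)"
  proof (intro nn_integral_mono mult_right_mono)
    fix t show "e2ennreal (- F t) \<le> ennreal c"
      using ge[of t] e2ennreal_mono[of "- F t" "ereal c"]
      by (cases "F t") auto
  qed auto
  with const have N: "?N < top" by (metis ennreal_less_top le_less_trans)
  have "?P + ennreal (2 * pi * c) = ?S + ?N"
  proof -
    have pw: "e2ennreal (F t) + ennreal c = e2ennreal (F t + ereal c) + e2ennreal (- F t)" for t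
    proof (cases "F t")
      case (real y)
      then show ?thesis using ge[of t] c
        by (cases "0 \<le> y") (auto simp: ennreal_plus[symmetric] ennreal_neg simp del: ennreal_plus)
    qed (use ge[of t] in \<open>auto simp: e2ennreal_neg\<close>)
    have "?P + ennreal (2 * pi * c) = (\<integral>\<^sup>+t\<in>{0..2*pi}. (e2ennreal (F t) + ennreal c) \<partial>lborel)"
      unfolding const[symmetric] distrib_right by (subst nn_integral_add) auto
    also have "\<dots> = ?S + ?N"
      unfolding pw distrib_right by (subst nn_integral_add) auto
    finally show ?thesis .
  qed
  then have "enn2ereal ?P + ereal (2 * pi * c) = enn2ereal ?S + enn2ereal ?N"
  proof -
    have "enn2ereal ?P + enn2ereal (ennreal (2 * pi * c)) = enn2ereal ?S + enn2ereal ?N"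
      if "?P + ennreal (2 * pi * c) = ?S + ?N"
      by (simp only: plus_ennreal.rep_eq[symmetric] that)
    then show ?thesis
      using c \<open>?P + ennreal (2 * pi * c) = ?S + ?N\<close> by (simp only: enn2ereal_ennreal mult_nonneg_nonneg pi_ge_zero zero_le_numeral)
  qed
  moreover obtain nn where "enn2ereal ?N = ereal nn"
    using N by (cases "?N" rule: ennreal_cases) auto
  ultimately show ?thesis
    using ereal_add_eq_imp_diff_eq by metis
qed

lemma circle_mean_eq:
  assumes "(\<lambda>t. u (z + rcis \<rho> t)) \<in> borel_measurable borel"
    and "\<And>t. ereal (-c) \<le> u (z + rcis \<rho> t)" and "0 \<le> c"
  shows "circle_mean u z \<rho> =
    enn2ereal (\<integral>\<^sup>+t\<in>{0..2*pi}. e2ennreal (u (z + rcis \<rho> t) + ereal c) \<partial>lborel) / ereal (2*pi) - ereal c"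
proof -
  have "(S - ereal (2 * pi * c)) / ereal (2*pi) = S / ereal (2*pi) - ereal c" for S
    by (cases S) (auto simp: field_simps)
  then show ?thesis
    unfolding circle_mean_def positive_minus_negative_part[OF assms] .
qed

text \<open>Both summands are shifted, by \<open>c\<close> and by \<open>K\<close>, so as to be
  nonnegative; there the integral is additive even if \<open>u\<close> takes the value \<infinity>,
  and the shifts are removed afterwards.\<close>

lemma circle_mean_add_real:
  assumes meas[measurable]: "(\<lambda>t. u (z + rcis \<rho> t)) \<in> borel_measurable borel"
    and ge: "\<And>t. ereal m \<le> u (z + rcis \<rho> t)" and \<rho>: "0 < \<rho>"
    and h: "continuous_on (sphere z \<rho>) h"
    and H: "((\<lambda>t. h (z + rcis \<rho> t)) has_integral 2 * pi * H) {0..2*pi}"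
  shows "circle_mean (\<lambda>w. u w + ereal (h w)) z \<rho> = circle_mean u z \<rho> + ereal H"
proof -
  define c where "c = max 0 (-m)"
  have c: "0 \<le> c" "ereal (-c) \<le> u (z + rcis \<rho> t)" for t
    using ge[of t] by (auto simp: c_def max_def intro: order_trans[rotated])
  have cont: "continuous_on UNIV (\<lambda>t. h (z + rcis \<rho> t))"
    by (rule continuous_on_circle[OF h]) (use \<rho> in auto)
  then have [measurable]: "(\<lambda>t. h (z + rcis \<rho> t)) \<in> borel_measurable borel"
    by (rule borel_measurable_continuous_onI)
  have "bounded (h ` sphere z \<rho>)"
    by (intro compact_imp_bounded compact_continuous_image h) auto
  then obtain K where K: "0 < K" "\<And>w. w \<in> sphere z \<rho> \<Longrightarrow> \<bar>h w\<bar> \<le> K"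
    by (auto simp: bounded_pos)
  have hK: "0 \<le> h (z + rcis \<rho> t) + K" for t
    using K(2)[of "z + rcis \<rho> t"] \<rho> by (auto simp: dist_norm)
  have int: "(\<integral>\<^sup>+t\<in>{0..2*pi}. ennreal (h (z + rcis \<rho> t) + K) \<partial>lborel) = ennreal (2 * pi * (H + K))"
  proof (rule nn_integral_has_integral_lebesgue')
    show "((\<lambda>t. h (z + rcis \<rho> t) + K) has_integral 2 * pi * (H + K)) {0..2*pi}"
      using has_integral_add[OF H has_integral_const_real[of K 0 "2*pi"]]
      by (simp add: algebra_simps)
  qed (use hK in auto)
  have "((\<lambda>t. h (z + rcis \<rho> t) + K) has_integral (2 * pi) * (H + K)) {0..2*pi}"
    using has_integral_add[OF H has_integral_const_real[of K 0 "2*pi"]] by (simp add: algebra_simps)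
  from has_integral_nonneg[OF this] hK have "0 \<le> (2 * pi) * (H + K)" by blast
  then have HK: "0 \<le> H + K" by (metis pi_gt_zero mult_pos_pos zero_le_mult_iff not_le zero_less_numeral less_asym)
  let ?S = "\<integral>\<^sup>+t\<in>{0..2*pi}. e2ennreal (u (z + rcis \<rho> t) + ereal c) \<partial>lborel"
  have pw: "e2ennreal ((u (z + rcis \<rho> t) + ereal (h (z + rcis \<rho> t))) + ereal (c + K))
      = e2ennreal (u (z + rcis \<rho> t) + ereal c) + ennreal (h (z + rcis \<rho> t) + K)" for t
  proof (cases "u (z + rcis \<rho> t)")
    case (real y)
    then show ?thesis using c(2)[of t] hK[of t]
      by (simp add: ennreal_plus[symmetric] add_ac del: ennreal_plus)
  qed (use c(2)[of t] in auto)
  have "(\<integral>\<^sup>+t\<in>{0..2*pi}. e2ennreal ((u (z + rcis \<rho> t) + ereal (h (z + rcis \<rho> t))) + ereal (c + K)) \<partial>lborel)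
      = ?S + ennreal (2 * pi * (H + K))"
    unfolding pw distrib_right int[symmetric] by (subst nn_integral_add) auto
  then have sum: "enn2ereal (\<integral>\<^sup>+t\<in>{0..2*pi}. e2ennreal ((u (z + rcis \<rho> t) + ereal (h (z + rcis \<rho> t))) + ereal (c + K)) \<partial>lborel)
      = enn2ereal ?S + ereal (2 * pi * (H + K))"
    using HK by (simp add: plus_ennreal.rep_eq)
  have "circle_mean (\<lambda>w. u w + ereal (h w)) z \<rho>
      = (enn2ereal ?S + ereal (2 * pi * (H + K))) / ereal (2*pi) - ereal (c + K)"
  proof (subst circle_mean_eq[where c = "c + K"])
    fix t
    have "ereal (-c) + ereal (-K) \<le> u (z + rcis \<rho> t) + ereal (h (z + rcis \<rho> t))"
      using c(2)[of t] hK[of t] by (intro add_mono) auto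
    then show "ereal (- (c + K)) \<le> u (z + rcis \<rho> t) + ereal (h (z + rcis \<rho> t))" by simp
  qed (use sum c(1) K in auto)
  also have "\<dots> = circle_mean u z \<rho> + ereal H"
  proof -
    have "(S + ereal (2 * pi * (H + K))) / ereal (2*pi) - ereal (c + K)
        = S / ereal (2*pi) - ereal c + ereal H" for S
      by (cases S) (auto simp: field_simps)
    then show ?thesis unfolding circle_mean_eq[OF meas c(2) c(1)] .
  qed
  finally show ?thesis .
qed

lemma circle_mean_real:
  assumes "0 < \<rho>" "continuous_on (sphere z \<rho>) h"
    "((\<lambda>t. h (z + rcis \<rho> t)) has_integral 2 * pi * H) {0..2*pi}"
  shows "circle_mean (\<lambda>w. ereal (h w)) z \<rho> = ereal H"
proof -
  have "circle_mean (\<lambda>w. 0 + ereal (h w)) z \<rho> = circle_mean (\<lambda>w. 0) z \<rho> + ereal H"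
    by (rule circle_mean_add_real[where m = 0]) (use assms in auto)
  then show ?thesis by (simp add: circle_mean_def zero_ereal_def[symmetric] e2ennreal_neg)
qed

section \<open>Lower semicontinuous functions and their restrictions to circles\<close>

lemma lower_semicontinuous_onD:
  assumes "lower_semicontinuous_on D u" "z \<in> D" "y < u z"
  shows "eventually (\<lambda>w. y < u w) (at z within D)"
  using assms by (auto simp: lower_semicontinuous_on_def le_Liminf_iff)

lemma lower_semicontinuous_on_subset:
  assumes "lower_semicontinuous_on D u" "D' \<subseteq> D"
  shows "lower_semicontinuous_on D' u"
  using assms filter_leD[OF at_le[OF assms(2)]]
  unfolding lower_semicontinuous_on_def le_Liminf_iff by blast

lemma lower_semicontinuous_on_add_real:
  assumes u: "lower_semicontinuous_on D u" and h: "continuous_on D h"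
  shows "lower_semicontinuous_on D (\<lambda>w. u w + ereal (h w))"
  unfolding lower_semicontinuous_on_def le_Liminf_iff
proof (intro ballI allI impI)
  fix z y assume z: "z \<in> D" and y: "y < u z + ereal (h z)"
  then have "y - ereal (h z) < u z"
    by (cases y; cases "u z") auto
  then obtain p where p: "y - ereal (h z) < p" "p < u z" using dense by blast
  obtain p' where p': "p = ereal p'" using p by (cases p) auto
  obtain e where e: "0 < e" "y < ereal (p' + h z - e)"
  proof (cases y)
    case (real y')
    with p p' have "y' < p' + h z" by (simp add: field_simps)
    then show ?thesis using real by (intro that[of "(p' + h z - y') / 2"]) (auto simp: field_simps)
  next
    case PInf
    then show ?thesis using p by simp
  next
    case MInf
    then show ?thesis by (intro that[of 1]) auto
  qed
  have "eventually (\<lambda>w. p < u w) (at z within D)"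
    by (rule lower_semicontinuous_onD[OF u z p(2)])
  moreover have "eventually (\<lambda>w. h z - e < h w) (at z within D)"
    using h z e(1) by (intro order_tendstoD(1)[of h "h z"]) (auto simp: continuous_on_def)
  ultimately show "eventually (\<lambda>w. y < u w + ereal (h w)) (at z within D)"
  proof eventually_elim
    case (elim w)
    have "y < ereal (p' + h z - e)" by fact
    also have "\<dots> \<le> ereal p' + ereal (h w)" using elim by simp
    also have "\<dots> \<le> u w + ereal (h w)" using elim p' by (intro add_right_mono) auto
    finally show ?case .
  qed
qed

lemma lower_semicontinuous_on_real:
  assumes "continuous_on D h"
  shows "lower_semicontinuous_on D (\<lambda>w. ereal (h w))"
proof -
  have "lower_semicontinuous_on D (\<lambda>w. 0)"
    by (auto simp: lower_semicontinuous_on_def le_Liminf_iff)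
  from lower_semicontinuous_on_add_real[OF this assms] show ?thesis by simp
qed

lemma measurable_circle:
  assumes u: "lower_semicontinuous_on D u" and D: "open D" "sphere z \<rho> \<subseteq> D" "0 < \<rho>"
  shows "(\<lambda>t. u (z + rcis \<rho> t)) \<in> borel_measurable borel"
proof (rule borel_measurableI_greater)
  fix y
  have "open {w \<in> D. y < u w}"
  proof (subst open_subopen, safe)
    fix w assume w: "w \<in> D" "y < u w"
    have "eventually (\<lambda>v. y < u v) (at w)"
      using lower_semicontinuous_onD[OF u w] at_within_open[OF w(1) D(1)] by simp
    moreover have "eventually (\<lambda>v. v \<in> D) (at w)"
      using D(1) w(1) by (simp add: eventually_at_in_open')
    ultimately have "eventually (\<lambda>v. v \<in> {w \<in> D. y < u w}) (nhds w)"
      using w by (auto simp: eventually_at_filter elim: eventually_elim2)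
    then show "\<exists>T. open T \<and> w \<in> T \<and> T \<subseteq> {w \<in> D. y < u w}"
      unfolding eventually_nhds by blast
  qed
  moreover have "continuous_on UNIV (\<lambda>t. z + rcis \<rho> t)"
    unfolding rcis_def cis_conv_exp by (intro continuous_intros)
  ultimately have "open ((\<lambda>t. z + rcis \<rho> t) -` {w \<in> D. y < u w})"
    using continuous_on_open_vimage[of UNIV "\<lambda>t. z + rcis \<rho> t"] by auto
  moreover have "(\<lambda>t. z + rcis \<rho> t) -` {w \<in> D. y < u w} = {t. y < u (z + rcis \<rho> t)}"
    using D by (auto simp: dist_norm)
  ultimately show "{t \<in> space borel. y < u (z + rcis \<rho> t)} \<in> sets borel" by auto
qed

section \<open>The minimum principle\<close>

text \<open>The small-circle form of the super-mean property; the admissible radii may depend on the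
  point. The minimum principle is proved from this form, which can be checked for sums and for glued
  functions.\<close>

definition locally_supermean_on :: "complex set \<Rightarrow> (complex \<Rightarrow> ereal) \<Rightarrow> bool" where
  "locally_supermean_on D u \<longleftrightarrow> (\<forall>z\<in>D. eventually (\<lambda>\<rho>. circle_mean u z \<rho> \<le> u z) (at_right 0))"

definition supermean_at :: "(complex \<Rightarrow> real) \<Rightarrow> complex \<Rightarrow> bool" where
  "supermean_at h z \<longleftrightarrow>
     eventually (\<lambda>\<rho>. integral {0..2*pi} (\<lambda>t. h (z + rcis \<rho> t)) \<le> 2 * pi * h z) (at_right 0)"

lemma eventually_cball_subset:
  assumes "open D" "z \<in> D"
  shows "eventually (\<lambda>\<rho>. 0 < \<rho> \<and> cball z \<rho> \<subseteq> D) (at_right 0)"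
proof -
  obtain e where e: "0 < e" "cball z e \<subseteq> D" using assms open_contains_cball by blast
  have "eventually (\<lambda>\<rho>. \<rho> \<in> {0<..<e}) (at_right (0::real))"
    using e(1) by (rule eventually_at_right_real)
  then show ?thesis
  proof eventually_elim
    case (elim \<rho>)
    then have "cball z \<rho> \<subseteq> cball z e" by (intro subset_cball) auto
    then show ?case using e elim by auto
  qed
qed

text \<open>If the infimum is negative, lower semicontinuity and the boundary condition make the
  sublevel sets below 0 compact, so it is attained. About the minimum point farthest to the right, a
  small circle has mean at most the minimum, so \<open>u\<close> equals the minimum almost
  everywhere on it; but \<open>u\<close> is larger near the rightmost point of that circle. The
  rightmost choice takes the place of a connectedness argument.\<close>

lemma minimum_principle:
  assumes D: "open D" "bounded D"
    and u: "\<And>z. z \<in> D \<Longrightarrow> u z \<noteq> -\<infinity>" "lower_semicontinuous_on D u" "locally_supermean_on D u"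
    and bd: "\<And>y. y \<in> frontier D \<Longrightarrow> 0 \<le> Liminf (at y within D) u"
    and z: "z \<in> D"
  shows "0 \<le> u z"
proof (rule ccontr)
  assume "\<not> 0 \<le> u z"
  then have neg: "u z < 0" by simp
  define K where "K = (\<lambda>\<alpha>. {w \<in> D. u w \<le> \<alpha>})"
  have compact_K: "compact (K \<alpha>)" if \<alpha>: "\<alpha> < 0" for \<alpha>
  proof -
    have "y \<in> K \<alpha>" if y: "y \<in> closure (K \<alpha>)" for y
    proof (rule ccontr)
      assume nK: "y \<notin> K \<alpha>"
      have "eventually (\<lambda>w. \<alpha> < u w) (at y within D)"
      proof (cases "y \<in> D")
        case True
        then show ?thesis using nK by (intro lower_semicontinuous_onD[OF u(2)]) (auto simp: K_def)
      next
        case False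
        have "closure (K \<alpha>) \<subseteq> closure D" by (intro closure_mono) (auto simp: K_def)
        then have "y \<in> frontier D" using y False D by (auto simp: frontier_def interior_open)
        from bd[OF this] show ?thesis using \<alpha> by (auto simp: le_Liminf_iff)
      qed
      then obtain S where S: "open S" "y \<in> S" "\<And>w. w \<in> S \<Longrightarrow> w \<noteq> y \<Longrightarrow> w \<in> D \<Longrightarrow> \<alpha> < u w"
        unfolding eventually_at_topological by blast
      then have "S \<inter> K \<alpha> = {}" using nK by (force simp: K_def)
      then show False using S y open_Int_closure_eq_empty[of S "K \<alpha>"] by blast
    qed
    then have "closed (K \<alpha>)" using closure_subset closed_closure by (metis subsetI subset_antisym)
    moreover have "bounded (K \<alpha>)" by (rule bounded_subset[OF D(2)]) (auto simp: K_def)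
    ultimately show ?thesis by (simp add: compact_eq_bounded_closed)
  qed
  define m where "m = (INF w\<in>D. u w)"
  have m_le: "m \<le> u w" if "w \<in> D" for w unfolding m_def using that by (rule INF_lower)
  have m_neg: "m < 0" using m_le[OF z] neg by simp
  \<comment> \<open>The infimum could still be -\<infinity>, so the levels are taken strictly above
    it. A common point has value at most \<open>m\<close>, which then rules out
    -\<infinity>.\<close>
  have "\<Inter> (K ` {\<alpha>. m < \<alpha> \<and> \<alpha> < 0}) \<noteq> {}"
  proof (rule compact_chain)
    show "{} \<notin> K ` {\<alpha>. m < \<alpha> \<and> \<alpha> < 0}"
    proof
      assume "{} \<in> K ` {\<alpha>. m < \<alpha> \<and> \<alpha> < 0}"
      then obtain \<alpha> where "m < \<alpha>" "K \<alpha> = {}" by auto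
      then show False unfolding m_def INF_less_iff K_def by force
    qed
  next
    fix S T assume "S \<in> K ` {\<alpha>. m < \<alpha> \<and> \<alpha> < 0} \<and> T \<in> K ` {\<alpha>. m < \<alpha> \<and> \<alpha> < 0}"
    then obtain \<alpha> \<beta> where "S = K \<alpha>" "T = K \<beta>" by auto
    then show "S \<subseteq> T \<or> T \<subseteq> S" by (cases \<alpha> \<beta> rule: le_cases) (auto simp: K_def)
  qed (auto intro: compact_K)
  then obtain w0 where w0: "\<And>\<alpha>. m < \<alpha> \<Longrightarrow> \<alpha> < 0 \<Longrightarrow> w0 \<in> K \<alpha>" by auto
  obtain \<beta> where "m < \<beta>" "\<beta> < 0" using dense m_neg by blast
  then have "w0 \<in> D" using w0 by (auto simp: K_def)
  have "u w0 \<le> m"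
    by (rule dense_ge_bounded[OF m_neg]) (use w0 in \<open>auto simp: K_def\<close>)
  then have ne: "K m \<noteq> {}" using \<open>w0 \<in> D\<close> by (auto simp: K_def)
  have "m \<noteq> -\<infinity>" using \<open>u w0 \<le> m\<close> u(1)[OF \<open>w0 \<in> D\<close>] by auto
  then obtain m' where m': "m = ereal m'" using m_neg by (cases m) auto
  obtain z0 where z0: "z0 \<in> K m" "\<And>y. y \<in> K m \<Longrightarrow> Re y \<le> Re z0"
    using continuous_attains_sup[OF compact_K[OF m_neg] ne, of Re] continuous_on_Re[OF continuous_on_id] by blast
  have z0D: "z0 \<in> D" and uz0: "u z0 = m" using z0(1) m_le by (auto simp: K_def intro: antisym)
  have "eventually (\<lambda>\<rho>. (0 < \<rho> \<and> cball z0 \<rho> \<subseteq> D) \<and> circle_mean u z0 \<rho> \<le> u z0) (at_right 0)"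
    using eventually_conj[OF eventually_cball_subset[OF D(1) z0D]] u(3) z0D
    unfolding locally_supermean_on_def by blast
  then obtain \<rho> where \<rho>: "0 < \<rho>" "cball z0 \<rho> \<subseteq> D" "circle_mean u z0 \<rho> \<le> u z0"
    using eventually_happens'[OF trivial_limit_at_right_real] by blast
  have circ: "z0 + rcis \<rho> t \<in> D" for t using \<rho> by (auto simp: dist_norm)
  have meas[measurable]: "(\<lambda>t. u (z0 + rcis \<rho> t)) \<in> borel_measurable borel"
    by (rule measurable_circle[OF u(2) D(1)]) (use \<rho> in auto)
  let ?I = "\<integral>\<^sup>+t\<in>{0..2*pi}. e2ennreal (u (z0 + rcis \<rho> t) + ereal (- m')) \<partial>lborel"
  have "circle_mean u z0 \<rho> = enn2ereal ?I / ereal (2*pi) - ereal (- m')"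
    by (rule circle_mean_eq) (use m_le[OF circ] m_neg m' in auto)
  then have "enn2ereal ?I / ereal (2*pi) - ereal (- m') \<le> ereal m'" using \<rho>(3) uz0 m' by metis
  moreover have "S = 0" if "S / ereal (2*pi) - ereal (- m') \<le> ereal m'" "0 \<le> S" for S
    using that pi_gt_zero by (cases S) (auto simp: divide_le_0_iff simp del: pi_gt_zero)
  ultimately have "enn2ereal ?I = 0" using enn2ereal_nonneg by blast
  then have "?I = 0" by (metis e2ennreal_enn2ereal e2ennreal_neg order_refl)
  then have AE: "AE t in lborel. e2ennreal (u (z0 + rcis \<rho> t) + ereal (- m')) * indicator {0..2*pi} t = 0"
    by (subst (asm) nn_integral_0_iff_AE) auto
  have "Re (z0 + \<rho>) > Re z0" using \<rho> by simp
  then have "z0 + \<rho> \<notin> K m" using z0(2) by force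
  moreover have z1D: "z0 + \<rho> \<in> D" using circ[of 0] by (simp add: rcis_def)
  ultimately have gt: "m < u (z0 + \<rho>)" by (auto simp: K_def)
  obtain S where S: "open S" "z0 + \<rho> \<in> S" "\<And>w. w \<in> S \<Longrightarrow> w \<noteq> z0 + \<rho> \<Longrightarrow> w \<in> D \<Longrightarrow> m < u w"
    using lower_semicontinuous_onD[OF u(2) z1D gt] unfolding eventually_at_topological by blast
  \<comment> \<open>Only angles just above 0 are used, so that the arc where \<open>u\<close>
    exceeds \<open>m\<close> stays inside the parameter interval.\<close>
  have "((\<lambda>t. z0 + rcis \<rho> t) \<longlongrightarrow> z0 + rcis \<rho> 0) (at_right 0)"
    unfolding rcis_def cis_conv_exp by (intro tendsto_intros)
  then have "eventually (\<lambda>t. z0 + rcis \<rho> t \<in> S) (at_right 0)"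
    using S by (intro topological_tendstoD) (auto simp: rcis_def)
  then obtain b where b: "0 < b" "\<And>t. 0 < t \<Longrightarrow> t < b \<Longrightarrow> z0 + rcis \<rho> t \<in> S"
    by (auto simp: eventually_at_right_field)
  define b' where "b' = min b (2*pi)"
  have "AE t in lborel. indicator {0<..<b'} t = (0::ennreal)"
    using AE
  proof eventually_elim
    case (elim t)
    show ?case
    proof (cases "0 < t \<and> t < b'")
      case True
      then have "m < u (z0 + rcis \<rho> t)"
        using gt S(3)[OF b(2)[of t] _ circ] by (cases "z0 + rcis \<rho> t = z0 + \<rho>") (auto simp: b'_def)
      then have "e2ennreal (u (z0 + rcis \<rho> t) + ereal (- m')) \<noteq> 0"
        using m' by (cases "u (z0 + rcis \<rho> t)") auto
      then show ?thesis using elim True by (auto simp: b'_def)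
    qed auto
  qed
  then have "(\<integral>\<^sup>+t. indicator {0<..<b'} t \<partial>lborel) = 0"
    by (subst nn_integral_0_iff_AE) auto
  moreover have "0 < b'" using b(1) by (simp add: b'_def)
  ultimately show False by auto
qed

lemma integrable_on_circle:
  assumes "continuous_on D h" "cball z \<rho> \<subseteq> D" "0 < \<rho>"
  shows "(\<lambda>t. h (z + rcis \<rho> t :: complex) :: real) integrable_on {0..2*pi}"
proof (rule integrable_continuous_interval)
  show "continuous_on {0..2*pi} (\<lambda>t. h (z + rcis \<rho> t))"
    by (rule continuous_on_circle[OF assms(1)]) (use assms in \<open>auto simp: subset_iff\<close>)
qed

lemma circle_mean_real_le:
  assumes h: "continuous_on D h" "cball z \<rho> \<subseteq> D" "0 < \<rho>"
    and le: "integral {0..2*pi} (\<lambda>t. h (z + rcis \<rho> t)) \<le> 2 * pi * h z"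
  shows "circle_mean (\<lambda>w. ereal (h w)) z \<rho> \<le> ereal (h z)"
proof -
  let ?H = "integral {0..2*pi} (\<lambda>t. h (z + rcis \<rho> t)) / (2*pi)"
  have "((\<lambda>t. h (z + rcis \<rho> t)) has_integral 2 * pi * ?H) {0..2*pi}"
    using integrable_on_circle[OF h] by (simp add: has_integral_iff)
  moreover have "continuous_on (sphere z \<rho>) h"
    using h(1) by (rule continuous_on_subset) (use h(2) sphere_cball in blast)
  ultimately have "circle_mean (\<lambda>w. ereal (h w)) z \<rho> = ereal ?H"
    by (intro circle_mean_real h)
  also have "?H \<le> h z" using le by (simp add: field_simps)
  finally show ?thesis by simp
qed

lemma locally_supermean_on_real:
  assumes "open D" "continuous_on D h" "\<And>z. z \<in> D \<Longrightarrow> supermean_at h z"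
  shows "locally_supermean_on D (\<lambda>w. ereal (h w))"
  unfolding locally_supermean_on_def
proof
  fix z assume z: "z \<in> D"
  show "eventually (\<lambda>\<rho>. circle_mean (\<lambda>w. ereal (h w)) z \<rho> \<le> ereal (h z)) (at_right 0)"
    using eventually_cball_subset[OF assms(1) z] assms(3)[OF z, unfolded supermean_at_def]
    by eventually_elim (use circle_mean_real_le[OF assms(2)] in auto)
qed

lemma minimum_principle_real:
  assumes D: "open D" "bounded D" and h: "continuous_on (closure D) h"
    and sm: "\<And>z. z \<in> D \<Longrightarrow> supermean_at h z"
    and bd: "\<And>y. y \<in> frontier D \<Longrightarrow> 0 \<le> h y" and z: "z \<in> D"
  shows "0 \<le> h z"
proof -
  have hD: "continuous_on D h" using h closure_subset by (rule continuous_on_subset)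
  have "0 \<le> ereal (h z)"
  proof (rule minimum_principle[OF D _ _ _ _ z])
    show "lower_semicontinuous_on D (\<lambda>w. ereal (h w))"
      by (rule lower_semicontinuous_on_real[OF hD])
    show "locally_supermean_on D (\<lambda>w. ereal (h w))"
      by (rule locally_supermean_on_real[OF D(1) hD sm])
    fix y assume y: "y \<in> frontier D"
    then have "(h \<longlongrightarrow> h y) (at y within closure D)"
      using h by (auto simp: continuous_on_def frontier_def)
    then have "(h \<longlongrightarrow> h y) (at y within D)"
      by (rule tendsto_within_subset[OF _ closure_subset])
    then have lim: "((\<lambda>w. ereal (h w)) \<longlongrightarrow> ereal (h y)) (at y within D)" by simp
    show "0 \<le> Liminf (at y within D) (\<lambda>w. ereal (h w))"
      unfolding le_Liminf_iff
    proof (intro allI impI)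
      fix c :: ereal assume "c < 0"
      then have "c < ereal (h y)" using bd[OF y] by (metis ereal_less_eq(5) order_less_le_trans)
      then show "eventually (\<lambda>w. c < ereal (h w)) (at y within D)"
        by (rule order_tendstoD(1)[OF lim])
    qed
  qed auto
  then show ?thesis by simp
qed

section \<open>Local and global super-mean-value property\<close>

text \<open>Being closed under sums and products, the class contains the restrictions of all real
  polynomials in two variables, and each member comes with an explicit harmonic extension Re p to
  the disc.\<close>

definition Re_poly_on_circle :: "(complex \<Rightarrow> real) \<Rightarrow> bool" where
  "Re_poly_on_circle f \<longleftrightarrow> (\<exists>p. \<forall>z. norm z = 1 \<longrightarrow> f z = Re (poly p z))"

lemma Re_poly_on_circle_add:
  assumes "Re_poly_on_circle f" "Re_poly_on_circle g"
  shows "Re_poly_on_circle (\<lambda>z. f z + g z)"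
proof -
  obtain p q where "\<And>z. norm z = 1 \<Longrightarrow> f z = Re (poly p z)" "\<And>z. norm z = 1 \<Longrightarrow> g z = Re (poly q z)"
    using assms by (auto simp: Re_poly_on_circle_def)
  then show ?thesis unfolding Re_poly_on_circle_def by (intro exI[of _ "p + q"]) simp
qed

lemma Re_poly_on_circle_sum:
  assumes "\<And>i. i \<in> I \<Longrightarrow> Re_poly_on_circle (f i)"
  shows "Re_poly_on_circle (\<lambda>z. \<Sum>i\<in>I. f i z)"
  using assms
proof (induction I rule: infinite_finite_induct)
  case (insert i I)
  then show ?case by (auto intro: Re_poly_on_circle_add)
qed (auto simp: Re_poly_on_circle_def intro!: exI[of _ 0])

text \<open>On the unit circle \<open>cnj z\<close> is the inverse of \<open>z\<close>, so the
  product reduces to a multiple of a power of \<open>z\<close> or of \<open>cnj z\<close>; in the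
  latter case conjugation leaves the real part unchanged.\<close>

lemma Re_poly_on_circle_monomials:
  "Re_poly_on_circle (\<lambda>z. Re (c * z ^ i * cnj (d * z ^ j)))"
proof (cases "j \<le> i")
  case True
  have "Re (c * z ^ i * cnj (d * z ^ j)) = Re (poly (monom (c * cnj d) (i - j)) z)" if "norm z = 1" for z
  proof -
    have zz: "z * cnj z = 1" using that complex_norm_square[of z] by simp
    have "z ^ i * cnj z ^ j = z ^ (i - j) * (z * cnj z) ^ j"
      using True by (simp add: power_mult_distrib power_add[symmetric] mult.assoc[symmetric])
    then show ?thesis using zz by (simp add: poly_monom algebra_simps)
  qed
  then show ?thesis unfolding Re_poly_on_circle_def by blast
next
  case False
  have "Re (c * z ^ i * cnj (d * z ^ j)) = Re (poly (monom (cnj c * d) (j - i)) z)" if "norm z = 1" for z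
  proof -
    have zz: "z * cnj z = 1" using that complex_norm_square[of z] by simp
    have "cnj z ^ i * z ^ j = (z * cnj z) ^ i * z ^ (j - i)"
      using False by (simp add: power_mult_distrib power_add[symmetric] mult.assoc mult.left_commute)
    then have "cnj (c * z ^ i * cnj (d * z ^ j)) = poly (monom (cnj c * d) (j - i)) z"
      using zz by (simp add: poly_monom algebra_simps)
    then show ?thesis by (metis complex_cnj(1) complex.sel(1) complex_surj)
  qed
  then show ?thesis unfolding Re_poly_on_circle_def by blast
qed

text \<open>2 Re p Re q = Re (p q) + Re (p cnj q), and the last term is a sum of the monomials
  treated above.\<close>

lemma Re_poly_on_circle_mult:
  assumes "Re_poly_on_circle f" "Re_poly_on_circle g"
  shows "Re_poly_on_circle (\<lambda>z. f z * g z)"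
proof -
  obtain p q where p: "\<And>z. norm z = 1 \<Longrightarrow> f z = Re (poly p z)" and q: "\<And>z. norm z = 1 \<Longrightarrow> g z = Re (poly q z)"
    using assms by (auto simp: Re_poly_on_circle_def)
  have "Re_poly_on_circle (\<lambda>z. \<Sum>i\<le>degree p. \<Sum>j\<le>degree q. Re (coeff p i * z ^ i * cnj (coeff q j * z ^ j)))"
    by (intro Re_poly_on_circle_sum Re_poly_on_circle_monomials)
  moreover have "(\<Sum>i\<le>degree p. \<Sum>j\<le>degree q. Re (coeff p i * z ^ i * cnj (coeff q j * z ^ j)))
      = Re (poly p z * cnj (poly q z))" for z
    by (simp add: poly_altdef sum_product cnj_sum Re_sum)
  ultimately obtain r where r: "\<And>z. norm z = 1 \<Longrightarrow> Re (poly p z * cnj (poly q z)) = Re (poly r z)"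
    by (auto simp: Re_poly_on_circle_def)
  have "f z * g z = Re (poly (smult (1/2) (p * q + r)) z)" if "norm z = 1" for z
  proof -
    have "2 * (f z * g z) = Re (poly p z * poly q z) + Re (poly p z * cnj (poly q z))"
      using p[OF that] q[OF that] by simp
    then show ?thesis using r[OF that] by simp
  qed
  then show ?thesis unfolding Re_poly_on_circle_def by blast
qed

lemma real_polynomial_function_imp_Re_poly_on_circle:
  assumes "real_polynomial_function f"
  shows "Re_poly_on_circle f"
  using assms
proof (induction rule: real_polynomial_function.induct)
  case (linear f)
  interpret bounded_linear f by fact
  have "f z = Re (poly [:0, Complex (f 1) (- f \<i>):] z)" for z
  proof -
    have "f z = f (Re z *\<^sub>R 1 + Im z *\<^sub>R \<i>)" by (rule arg_cong[of _ _ f]) (simp add: complex_eq_iff)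
    also have "\<dots> = Re z * f 1 + Im z * f \<i>" by (simp only: add scaleR real_scaleR_def)
    finally show ?thesis by simp
  qed
  then show ?case unfolding Re_poly_on_circle_def by blast
next
  case (const c)
  show ?case unfolding Re_poly_on_circle_def by (intro exI[of _ "[:of_real c:]"]) simp
qed (auto intro: Re_poly_on_circle_add Re_poly_on_circle_mult)

lemma supermean_at_add:
  assumes D: "open D" "z \<in> D" and cont: "continuous_on D f" "continuous_on D g"
    and sm: "supermean_at f z" "supermean_at g z"
  shows "supermean_at (\<lambda>w. f w + g w) z"
  unfolding supermean_at_def
  using eventually_cball_subset[OF D] sm[unfolded supermean_at_def]
proof eventually_elim
  case (elim \<rho>)
  then have "integral {0..2*pi} (\<lambda>t. f (z + rcis \<rho> t) + g (z + rcis \<rho> t))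
      = integral {0..2*pi} (\<lambda>t. f (z + rcis \<rho> t)) + integral {0..2*pi} (\<lambda>t. g (z + rcis \<rho> t))"
    by (intro Henstock_Kurzweil_Integration.integral_add integrable_on_circle[OF cont(1)] integrable_on_circle[OF cont(2)]) auto
  then show ?case using elim by (simp add: distrib_left)
qed

lemma supermean_at_const: "supermean_at (\<lambda>_. c) z"
  by (simp add: supermean_at_def)

lemma supermean_at_Re_holomorphic:
  assumes "open D" "z \<in> D" "f holomorphic_on D"
  shows "supermean_at (\<lambda>w. Re (f w)) z"
  unfolding supermean_at_def using eventually_cball_subset[OF assms(1,2)]
proof eventually_elim
  case (elim \<rho>)
  then have "((\<lambda>t. Re (f (z + rcis \<rho> t))) has_integral 2 * pi * Re (f z)) {0..2*pi}"
    using assms(3) by (intro mean_value_Re) (auto intro: holomorphic_on_subset)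
  then show ?case by (simp add: integral_unique)
qed

text \<open>A real part of a polynomial that is close to \<open>h\<close> on the circle serves as an approximate
  harmonic minorant inside; this replaces the Poisson integral.\<close>

lemma supermean_on_disc:
  assumes D: "open D" "continuous_on D h" "\<And>z. z \<in> D \<Longrightarrow> supermean_at h z"
    and disc: "cball z \<rho> \<subseteq> D" "0 < \<rho>"
  shows "integral {0..2*pi} (\<lambda>t. h (z + rcis \<rho> t)) \<le> 2 * pi * h z"
proof (rule field_le_epsilon)
  fix e :: real assume "0 < e"
  \<comment> \<open>The error \<epsilon> is paid twice, once on the circle and once at the centre,
    each time multiplied by 2 pi.\<close>
  define \<epsilon> where "\<epsilon> = e / (4*pi)"
  have \<epsilon>: "0 < \<epsilon>" using \<open>0 < e\<close> by (simp add: \<epsilon>_def)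
  have "(\<lambda>w. z + of_real \<rho> * w) ` sphere 0 1 \<subseteq> D"
    using disc by (auto simp: dist_norm norm_mult)
  then have cont: "continuous_on (sphere 0 1) (\<lambda>w. h (z + of_real \<rho> * w))"
    by (intro continuous_on_compose2[OF D(2)] continuous_intros)
  obtain g where g: "real_polynomial_function g"
    "\<And>w. w \<in> sphere 0 1 \<Longrightarrow> \<bar>h (z + of_real \<rho> * w) - g w\<bar> < \<epsilon>"
  proof (rule Stone_Weierstrass_real_polynomial_function[OF compact_sphere cont \<epsilon>])
    fix g assume "real_polynomial_function g"
      "\<And>w. w \<in> sphere 0 1 \<Longrightarrow> \<bar>h (z + of_real \<rho> * w) - g w\<bar> < \<epsilon>"
    then show thesis by (rule that)
  qed
  obtain p where p: "\<And>w. norm w = 1 \<Longrightarrow> g w = Re (poly p w)"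
    using real_polynomial_function_imp_Re_poly_on_circle[OF g(1)] by (auto simp: Re_poly_on_circle_def)
  define P where "P = (\<lambda>w. poly p ((w - z) / of_real \<rho>))"
  have P_holo: "P holomorphic_on S" for S
    unfolding P_def using disc by (intro holomorphic_intros) auto
  have close: "\<bar>h w - Re (P w)\<bar> < \<epsilon>" if "w \<in> sphere z \<rho>" for w
  proof -
    have "norm ((w - z) / of_real \<rho>) = 1"
      using that disc by (simp add: norm_divide dist_norm norm_minus_commute)
    then show ?thesis using g(2)[of "(w - z) / of_real \<rho>"] p disc by (simp add: P_def)
  qed
  define k where "k = (\<lambda>w. h w + (Re (- P w) + \<epsilon>))"
  have contP: "continuous_on S (\<lambda>w. Re (- P w) + \<epsilon>)" for S
    by (intro continuous_intros holomorphic_on_imp_continuous_on[OF P_holo])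
  have "0 \<le> k z"
  proof (rule minimum_principle_real[of "ball z \<rho>"])
    show "continuous_on (closure (ball z \<rho>)) k"
      unfolding k_def using disc D(2) by (intro continuous_on_add contP) (auto intro: continuous_on_subset)
    show "supermean_at k w" if "w \<in> ball z \<rho>" for w
      unfolding k_def
    proof (rule supermean_at_add[of "ball z \<rho>"])
      show "continuous_on (ball z \<rho>) h" by (rule continuous_on_subset[OF D(2)]) (use disc in auto)
      show "supermean_at h w" using that disc by (intro D(3)) auto
      show "supermean_at (\<lambda>w. Re (- P w) + \<epsilon>) w"
      proof (rule supermean_at_add[of UNIV])
        show "supermean_at (\<lambda>w. Re (- P w)) w"
          by (rule supermean_at_Re_holomorphic[of UNIV]) (auto intro!: holomorphic_intros P_holo)
        show "continuous_on UNIV (\<lambda>w. Re (- P w))"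
          by (intro continuous_intros holomorphic_on_imp_continuous_on[OF P_holo])
      qed (auto intro: supermean_at_const)
    qed (use that contP in auto)
    show "0 \<le> k y" if "y \<in> frontier (ball z \<rho>)" for y
      using close[of y] that disc by (simp add: k_def)
  qed (use disc in auto)
  then have Pz: "Re (P z) \<le> h z + \<epsilon>" by (simp add: k_def)
  have int: "((\<lambda>t. Re (P (z + rcis \<rho> t)) + \<epsilon>) has_integral 2 * pi * Re (P z) + \<epsilon> * (2 * pi)) {0..2*pi}"
    using has_integral_add[OF mean_value_Re[OF P_holo disc(2)] has_integral_const_real[of \<epsilon> 0 "2*pi"]]
    by (simp add: mult.commute)
  have "integral {0..2*pi} (\<lambda>t. h (z + rcis \<rho> t)) \<le> integral {0..2*pi} (\<lambda>t. Re (P (z + rcis \<rho> t)) + \<epsilon>)"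
  proof (rule integral_le)
    show "(\<lambda>t. h (z + rcis \<rho> t)) integrable_on {0..2*pi}" by (rule integrable_on_circle[OF D(2) disc])
    show "h (z + rcis \<rho> t) \<le> Re (P (z + rcis \<rho> t)) + \<epsilon>" for t
      using close[of "z + rcis \<rho> t"] disc by (simp add: dist_norm abs_less_iff)
  qed (use int in auto)
  also have "\<dots> = 2 * pi * Re (P z) + \<epsilon> * (2 * pi)" using int by (rule integral_unique)
  also have "\<dots> \<le> 2 * pi * (h z + \<epsilon>) + \<epsilon> * (2 * pi)" using Pz by simp
  also have "\<dots> = 2 * pi * h z + e" by (simp add: \<epsilon>_def field_simps)
  finally show "integral {0..2*pi} (\<lambda>t. h (z + rcis \<rho> t)) \<le> 2 * pi * h z + e" .
qed

text \<open>Through \<open>supermean_on_disc\<close> the local property becomes the inequality on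
  every circle; this is how locally verified barriers enter the upper class.\<close>

lemma hyperharmonic_on_real:
  assumes "open D" "continuous_on D h" "\<And>z. z \<in> D \<Longrightarrow> supermean_at h z"
  shows "hyperharmonic_on D (\<lambda>w. ereal (h w))"
  unfolding hyperharmonic_on_def
proof (intro conjI ballI allI impI)
  show "lower_semicontinuous_on D (\<lambda>w. ereal (h w))"
    by (rule lower_semicontinuous_on_real[OF assms(2)])
  fix z \<rho> assume "0 < \<rho>" "cball z \<rho> \<subseteq> D"
  then show "circle_mean (\<lambda>w. ereal (h w)) z \<rho> \<le> ereal (h z)"
    by (intro circle_mean_real_le[OF assms(2)] supermean_on_disc[OF assms])
qed auto

section \<open>The Green function of a disc\<close>

text \<open>Local harmonicity as an equality of means. Unlike \<open>supermean_at\<close> it passes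
  to differences and negative multiples, which the Green functions and the cut function of the
  descent require.\<close>

definition mean_value_at :: "(complex \<Rightarrow> real) \<Rightarrow> complex \<Rightarrow> bool" where
  "mean_value_at h z \<longleftrightarrow>
     eventually (\<lambda>\<rho>. ((\<lambda>t. h (z + rcis \<rho> t)) has_integral 2 * pi * h z) {0..2*pi}) (at_right 0)"

lemma mean_value_at_add:
  assumes "mean_value_at f z" "mean_value_at g z"
  shows "mean_value_at (\<lambda>w. f w + g w) z"
  using assms unfolding mean_value_at_def
proof eventually_elim
  case (elim \<rho>)
  from has_integral_add[OF elim] show ?case by (simp add: distrib_left)
qed

lemma mean_value_at_cmult:
  assumes "mean_value_at f z"
  shows "mean_value_at (\<lambda>w. c * f w) z"
  using assms unfolding mean_value_at_def
proof eventually_elim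
  case (elim \<rho>)
  from has_integral_mult_right[OF elim, of c] show ?case by (simp add: mult_ac)
qed

lemma mean_value_at_const: "mean_value_at (\<lambda>_. c) z"
  unfolding mean_value_at_def
  using has_integral_const_real[of c 0 "2*pi"] by (simp add: mult.commute)

lemma mean_value_at_diff:
  "mean_value_at f z \<Longrightarrow> mean_value_at g z \<Longrightarrow> mean_value_at (\<lambda>w. f w - g w) z"
  using mean_value_at_add[of f z "\<lambda>w. (-1) * g w"] mean_value_at_cmult[of g z "-1"] by simp

lemma mean_value_at_sum:
  assumes "\<And>i. i \<in> I \<Longrightarrow> mean_value_at (f i) z"
  shows "mean_value_at (\<lambda>w. \<Sum>i\<in>I. f i w) z"
  using assms
  by (induction I rule: infinite_finite_induct) (auto intro: mean_value_at_add mean_value_at_const)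

lemma mean_value_at_imp_supermean_at: "mean_value_at h z \<Longrightarrow> supermean_at h z"
  unfolding mean_value_at_def supermean_at_def
  by (elim eventually_mono) (simp add: integral_unique)

lemma mean_value_at_ln_affine:
  assumes "a + b * z \<noteq> 0"
  shows "mean_value_at (\<lambda>w. ln (norm (a + b * w))) z"
proof -
  \<comment> \<open>Below this radius the circle does not reach the zero of the affine function; the
    1 in the denominator covers \<open>b = 0\<close>.\<close>
  define e where "e = norm (a + b * z) / (norm b + 1)"
  have e: "0 < e" using assms by (simp add: e_def add_nonneg_pos)
  have "eventually (\<lambda>\<rho>. \<rho> \<in> {0<..<e}) (at_right (0::real))"
    using e by (rule eventually_at_right_real)
  then show ?thesis unfolding mean_value_at_def
  proof eventually_elim
    case (elim \<rho>)
    have "norm b * \<rho> \<le> (norm b + 1) * \<rho>" using elim by simp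
    also have "\<dots> < (norm b + 1) * e" using elim by (intro mult_strict_left_mono) (auto simp: add_nonneg_pos)
    also have "\<dots> = norm (a + b * z)" by (simp add: e_def add_nonneg_eq_0_iff)
    finally show ?case using elim by (intro mean_value_ln_affine) auto
  qed
qed

text \<open>The Green function with pole \<open>w\<close> of the disc of radius \<open>R\<close>
  about 0. It is real-valued, so its value at the pole is not \<infinity>, and facts about it carry
  \<open>z \<noteq> w\<close>.\<close>

definition green :: "real \<Rightarrow> complex \<Rightarrow> complex \<Rightarrow> real" where
  "green R w z = ln (norm (of_real (R\<^sup>2) - cnj w * z)) - ln R - ln (norm (z - w))"

lemma green_identity:
  fixes z w :: complex and R :: real
  shows "(norm (of_real (R\<^sup>2) - cnj w * z))\<^sup>2 =
    R\<^sup>2 * (norm (z - w))\<^sup>2 + (R\<^sup>2 - (norm z)\<^sup>2) * (R\<^sup>2 - (norm w)\<^sup>2)"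
  unfolding cmod_power2 by simp algebra

lemma green_numerator_nonzero:
  assumes "norm w < R" "norm z \<le> R"
  shows "of_real (R\<^sup>2) - cnj w * z \<noteq> 0"
proof
  assume "of_real (R\<^sup>2) - cnj w * z = 0"
  then have "norm (of_real (R\<^sup>2) :: complex) = norm (cnj w * z)" by simp
  then have "R\<^sup>2 = norm w * norm z"
    by (simp only: norm_of_real norm_mult complex_mod_cnj abs_power2)
  moreover have "norm w * norm z \<le> norm w * R" using assms by (intro mult_left_mono) auto
  moreover have "norm w * R < R\<^sup>2"
    using assms le_less_trans[OF norm_ge_zero assms(1)] unfolding power2_eq_square
    by (intro mult_strict_right_mono) auto
  ultimately show False by simp
qed

text \<open>By \<open>green_identity\<close> the squared quotient under the logarithm is 1 plus a
  term that is positive inside the disc and zero for |z| = R; sign, boundary value and lower bounds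
  are read off from this form.\<close>

lemma green_eq:
  assumes w: "norm w < R" and z: "norm z \<le> R" "z \<noteq> w"
  shows "green R w z = ln (1 + (R\<^sup>2 - (norm z)\<^sup>2) * (R\<^sup>2 - (norm w)\<^sup>2) / (R\<^sup>2 * (norm (z - w))\<^sup>2)) / 2"
proof -
  have R: "0 < R" using w norm_ge_zero le_less_trans by blast
  have nz: "0 < norm (of_real (R\<^sup>2) - cnj w * z)" using green_numerator_nonzero[OF w z(1)] by simp
  have "2 * green R w z = ln ((norm (of_real (R\<^sup>2) - cnj w * z))\<^sup>2 / (R\<^sup>2 * (norm (z - w))\<^sup>2))"
    using R z(2) green_numerator_nonzero[OF w z(1)]
    by (simp add: green_def ln_div ln_mult ln_realpow)
  also have "(norm (of_real (R\<^sup>2) - cnj w * z))\<^sup>2 / (R\<^sup>2 * (norm (z - w))\<^sup>2) =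
      1 + (R\<^sup>2 - (norm z)\<^sup>2) * (R\<^sup>2 - (norm w)\<^sup>2) / (R\<^sup>2 * (norm (z - w))\<^sup>2)"
    unfolding green_identity using R z(2) by (simp add: add_divide_distrib)
  finally show ?thesis by simp
qed

lemma green_nonneg:
  assumes "norm w < R" "norm z \<le> R" "z \<noteq> w"
  shows "0 \<le> green R w z"
proof -
  have "0 \<le> R\<^sup>2 - (norm z)\<^sup>2" "0 \<le> R\<^sup>2 - (norm w)\<^sup>2"
    using assms power_mono[of "norm z" R 2] power_mono[of "norm w" R 2] by auto
  then show ?thesis unfolding green_eq[OF assms] by (simp add: mult_nonneg_nonneg)
qed

lemma isCont_green:
  assumes "norm w < R" "norm z \<le> R" "z \<noteq> w"
  shows "isCont (green R w) z"
  unfolding green_def using green_numerator_nonzero[OF assms(1,2)] assms(3)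
  by (intro continuous_intros) auto

lemma mean_value_at_green:
  assumes "norm w < R" "norm z < R" "z \<noteq> w"
  shows "mean_value_at (green R w) z"
proof -
  have "mean_value_at (\<lambda>z. ln (norm (of_real (R\<^sup>2) + (- cnj w) * z))) z"
    using green_numerator_nonzero[of w R z] assms by (intro mean_value_at_ln_affine) auto
  moreover have "mean_value_at (\<lambda>z. ln (norm (- w + 1 * z))) z"
    using assms by (intro mean_value_at_ln_affine) auto
  ultimately have "mean_value_at (\<lambda>z. ln (norm (of_real (R\<^sup>2) + (- cnj w) * z)) - ln R - ln (norm (- w + 1 * z))) z"
    by (intro mean_value_at_diff mean_value_at_const)
  then show ?thesis unfolding green_def by simp
qed

text \<open>Writing 1 - cnj w z as (1 - |w|^2) - cnj w (z - w) bounds its modulus below by 1 - |w|,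
  while |z - w| is at most (1 - |w|) p; the quotient is therefore at least 1 / p.\<close>

lemma green_lower_bound_disc:
  assumes w: "norm w < 1" and p: "0 < p" "p < 1" and z: "z \<noteq> w" "norm (z - w) \<le> (1 - norm w) * p"
  shows "ln (1 / p) \<le> green 1 w z"
proof -
  have "1 - cnj w * z = of_real (1 - (norm w)\<^sup>2) - cnj w * (z - w)"
    using complex_norm_square[of w] by (simp add: algebra_simps)
  then have "norm (1 - cnj w * z) \<ge> \<bar>1 - (norm w)\<^sup>2\<bar> - norm w * norm (z - w)"
    by (metis complex_mod_cnj norm_mult norm_of_real norm_triangle_ineq2)
  moreover have "norm w * norm (z - w) \<le> norm w * (1 - norm w)"
  proof (intro mult_left_mono)
    have "(1 - norm w) * p \<le> (1 - norm w) * 1" using w p by (intro mult_left_mono) auto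
    then show "norm (z - w) \<le> 1 - norm w" using z by simp
  qed auto
  moreover have "1 - (norm w)\<^sup>2 = (1 - norm w) + norm w * (1 - norm w)"
    by (simp add: power2_eq_square algebra_simps)
  ultimately have "1 - norm w \<le> norm (1 - cnj w * z)" by linarith
  then have "ln (1 - norm w) \<le> ln (norm (1 - cnj w * z))"
    using w by (intro ln_mono) auto
  moreover have "ln (norm (z - w)) \<le> ln ((1 - norm w) * p)"
    using z by (intro ln_mono) auto
  moreover have "ln ((1 - norm w) * p) = ln (1 - norm w) + ln p" using w p by (simp add: ln_mult)
  ultimately show ?thesis using p by (simp add: green_def ln_div)
qed

text \<open>The numerator has no zero in the closed disc of radius \<rho> and contributes ln 1 = 0,
  so only the mean of ln |z - w| remains.\<close>

lemma integral_green_circle: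
  assumes w: "norm w < 1" "w \<noteq> 0" and \<rho>: "0 < \<rho>" "\<rho> < 1" "norm w \<noteq> \<rho>"
  shows "((\<lambda>t. green 1 w (rcis \<rho> t)) has_integral 2 * pi * ln (1 / max \<rho> (norm w))) {0..2*pi}"
proof -
  have less: "norm (- cnj w) * \<rho> < norm (1 + (- cnj w) * 0)"
    using w \<rho> mult_strict_mono[of "norm w" 1 \<rho> 1] by simp
  from mean_value_ln_affine[OF \<rho>(1) this]
  have num: "((\<lambda>t. ln (norm (1 - cnj w * rcis \<rho> t))) has_integral 0) {0..2*pi}" by simp
  have den: "((\<lambda>t. ln (norm (rcis \<rho> t - w))) has_integral 2 * pi * ln (max \<rho> (norm w))) {0..2*pi}"
  proof (cases "\<rho> < norm w")
    case True
    then show ?thesis using mean_value_ln_affine[OF \<rho>(1), of 1 "-w" 0] by (simp add: max_def)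
  next
    case False
    \<comment> \<open>For a pole inside the circle the zero is reflected outside: |\<rho> e - w| =
      |\<rho> - cnj w e| for e = \<open>cis t\<close>, and the right side is affine in e without
      zeros in the closed unit disc.\<close>
    have "norm (rcis \<rho> t - w) = norm (of_real \<rho> + (- cnj w) * (0 + rcis 1 t))" for t
    proof -
      have "rcis \<rho> t - w = cis t * cnj (of_real \<rho> + (- cnj w) * (0 + rcis 1 t))"
        by (simp add: rcis_def algebra_simps cis_cnj cis_mult)
      then have "norm (rcis \<rho> t - w) = norm (cnj (of_real \<rho> + (- cnj w) * (0 + rcis 1 t)))"
        by (metis norm_mult norm_cis mult_1)
      then show ?thesis by (simp only: complex_mod_cnj)
    qed
    then show ?thesis
      using mean_value_ln_affine[of 1 "- cnj w" "of_real \<rho>" 0] False \<rho> by (simp add: max_def)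
  qed
  from has_integral_diff[OF num den] show ?thesis
    using \<rho> w by (simp add: green_def ln_div max_def)
qed

section \<open>Champagne regions\<close>

lemma champagne_less:
  assumes "champagne x r"
  shows "norm (x k) < 1" "0 < r k" "r k < 1 - norm (x k)"
proof -
  show 1: "norm (x k) < 1" "0 < r k" using assms by (auto simp: champagne_def)
  have "ereal (r k / (1 - norm (x k))) \<le> (SUP k. ereal (r k / (1 - norm (x k))))"
    by (rule SUP_upper) simp
  also have "\<dots> < 1" using assms by (simp add: champagne_def)
  finally show "r k < 1 - norm (x k)" using 1 by (simp add: divide_less_eq)
qed

lemma champagne_centre_nonzero:
  assumes "champagne x r"
  shows "x k \<noteq> 0"
proof
  assume "x k = 0"
  then have "0 \<in> cball (x k) (r k)" using champagne_less(2)[OF assms, of k] by simp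
  then show False using assms by (auto simp: champagne_def discs_union_def)
qed

lemma champagne_inj:
  assumes "champagne x r"
  shows "inj x"
proof (rule injI)
  fix j k assume "x j = x k"
  then have "x j \<in> cball (x j) (r j) \<inter> cball (x k) (r k)"
    using champagne_less(2)[OF assms, of j] champagne_less(2)[OF assms, of k] by simp
  moreover have "cball (x j) (r j) \<inter> cball (x k) (r k) = {}" if "j \<noteq> k"
    using assms that unfolding champagne_def disjoint_family_on_def by blast
  ultimately show "j = k" by blast
qed

text \<open>As \<open>r k < 1 - norm (x k)\<close>, the k-th disc stays outside radius 2 |x k| - 1,
  which tends to 1; the threshold (1 + s) / 2 is where this radius passes s.\<close>

lemma champagne_discs_escape:
  assumes ch: "champagne x r" and s: "s < 1"
  obtains n where "\<And>k. k \<ge> n \<Longrightarrow> cball (x k) (r k) \<inter> cball 0 s = {}"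
proof -
  have "(\<lambda>k. norm (x k)) \<longlonglongrightarrow> 1" using ch by (simp add: champagne_def)
  then have "eventually (\<lambda>k. (1 + s) / 2 < norm (x k)) sequentially"
    using s by (intro order_tendstoD(1)[where y = 1]) auto
  then obtain n where n: "\<And>k. k \<ge> n \<Longrightarrow> (1 + s) / 2 < norm (x k)"
    by (auto simp: eventually_sequentially)
  have "cball (x k) (r k) \<inter> cball 0 s = {}" if k: "k \<ge> n" for k
  proof (rule ccontr)
    assume "cball (x k) (r k) \<inter> cball 0 s \<noteq> {}"
    then obtain z where "norm (x k - z) \<le> r k" "norm z \<le> s" by (auto simp: dist_norm)
    then have "norm (x k) \<le> r k + s" using norm_triangle_sub[of "x k" z] by linarith
    then show False using n[OF k] champagne_less(3)[OF ch, of k] by (simp add: field_simps)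
  qed
  then show thesis using that by blast
qed

lemma champagne_region_Int_ball:
  assumes ch: "champagne x r" and s: "s < 1"
  obtains n where "(ball 0 1 - discs_union x r) \<inter> ball 0 s = ball 0 s - (\<Union>k<n. cball (x k) (r k))"
proof -
  obtain n where n: "\<And>k. k \<ge> n \<Longrightarrow> cball (x k) (r k) \<inter> cball 0 s = {}"
    using champagne_discs_escape[OF assms] by blast
  have *: "(\<exists>k. w \<in> cball (x k) (r k)) \<longleftrightarrow> (\<exists>k<n. w \<in> cball (x k) (r k))" if "w \<in> ball 0 s" for w
  proof
    assume "\<exists>k. w \<in> cball (x k) (r k)"
    then obtain k where k: "w \<in> cball (x k) (r k)" by blast
    have "w \<in> cball 0 s" using that by simp
    then have "\<not> k \<ge> n" using n[of k] k by blast
    then show "\<exists>k<n. w \<in> cball (x k) (r k)" using k not_le by blast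
  qed blast
  have "ball 0 s \<subseteq> (ball 0 1 :: complex set)" using s by (intro subset_ball) simp
  then have "(ball 0 1 - discs_union x r) \<inter> ball 0 s = ball 0 s - (\<Union>k<n. cball (x k) (r k))"
    using * by (fastforce simp: discs_union_def simp del: mem_ball mem_cball)
  then show thesis by (rule that)
qed

text \<open>A union of infinitely many closed discs need not be closed; openness comes from local
  finiteness inside the unit disc.\<close>

lemma open_champagne_region:
  assumes ch: "champagne x r"
  shows "open (ball 0 1 - discs_union x r)"
proof (subst open_subopen, safe)
  fix z :: complex assume z: "z \<in> ball 0 1" "z \<notin> discs_union x r"
  define s where "s = (1 + norm z) / 2"
  have s: "norm z < s" "s < 1" using z by (auto simp: s_def)
  obtain n where n: "(ball 0 1 - discs_union x r) \<inter> ball 0 s = ball 0 s - (\<Union>k<n. cball (x k) (r k))"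
    using champagne_region_Int_ball[OF ch s(2)] by blast
  have "open (ball 0 s - (\<Union>k<n. cball (x k) (r k)))" by (intro open_Diff closed_UN) auto
  then show "\<exists>T. open T \<and> z \<in> T \<and> T \<subseteq> ball 0 1 - discs_union x r"
    using z s(1) unfolding n[symmetric]
    by (intro exI[of _ "(ball 0 1 - discs_union x r) \<inter> ball 0 s"]) auto
qed

text \<open>The points of the closed disc missed by the neighbourhoods form a compact set disjoint
  from the unit circle, so their moduli stay below some s < 1. A condition at each boundary point
  thus becomes one on a whole annulus.\<close>

lemma eventually_near_sphere:
  fixes P :: "complex \<Rightarrow> bool"
  assumes "\<And>y. y \<in> sphere 0 1 \<Longrightarrow> eventually P (at y within D)" "D \<subseteq> ball 0 1"
  obtains s where "s < 1" "\<And>w. w \<in> D \<Longrightarrow> s < norm w \<Longrightarrow> P w"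
proof -
  have "\<forall>y\<in>sphere 0 1. \<exists>T. open T \<and> y \<in> T \<and> (\<forall>w\<in>T. w \<noteq> y \<longrightarrow> w \<in> D \<longrightarrow> P w)"
    using assms(1) by (auto simp: eventually_at_topological)
  then obtain T where T: "\<And>y. y \<in> sphere 0 1 \<Longrightarrow> open (T y)" "\<And>y. y \<in> sphere 0 1 \<Longrightarrow> y \<in> T y"
    "\<And>y w. y \<in> sphere 0 1 \<Longrightarrow> w \<in> T y \<Longrightarrow> w \<noteq> y \<Longrightarrow> w \<in> D \<Longrightarrow> P w"
    by metis
  define U where "U = (\<Union>y\<in>sphere 0 1. T y)"
  have U: "open U" using T(1) by (auto simp: U_def)
  have PU: "P w" if wU: "w \<in> U" "w \<in> D" for w
  proof -
    obtain y where y: "y \<in> sphere 0 1" "w \<in> T y" using wU unfolding U_def by blast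
    then have "w \<noteq> y" using wU assms(2) by force
    then show ?thesis using T(3) y wU by blast
  qed
  define C where "C = cball 0 1 - U"
  have "compact C" unfolding C_def using U by (intro compact_diff) auto
  obtain s where s: "s < 1" "\<And>w. w \<in> C \<Longrightarrow> norm w \<le> s"
  proof (cases "C = {}")
    case True
    then show ?thesis by (intro that[of 0]) auto
  next
    case False
    obtain w0 where w0: "w0 \<in> C" "\<And>w. w \<in> C \<Longrightarrow> norm w \<le> norm w0"
      using continuous_attains_sup[OF \<open>compact C\<close> False, of norm]
        continuous_on_norm[OF continuous_on_id] by blast
    have "w0 \<notin> sphere 0 1" using w0(1) T(2) by (force simp: C_def U_def)
    then have "norm w0 < 1" using w0(1) by (auto simp: C_def)
    then show ?thesis using w0(2) that by blast
  qed
  show thesis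
  proof (rule that[OF s(1)])
    fix w assume w: "w \<in> D" "s < norm w"
    then have "w \<notin> C" using s(2) by force
    then have "w \<in> U" using w assms(2) by (force simp: C_def)
    then show "P w" using PU w by blast
  qed
qed

text \<open>The minimum principle shows that \<open>u\<close> plus a finite Green sum is at least 1
  - \<epsilon> on a smaller concentric part of the region: near the outer circle \<open>u\<close>
  alone exceeds 1 - \<epsilon>, and on the edge of each disc one Green term alone is at least 1.
  \<open>W\<close> bounds all partial sums because the number of discs involved depends on
  \<epsilon>.\<close>

lemma upper_class_ge_green_sum:
  assumes ch: "champagne x r" and L: "\<And>k. 0 < L k"
    and green: "\<And>k z. norm (z - x k) = r k \<Longrightarrow> L k \<le> green 1 (x k) z"
    and z: "z \<in> ball 0 1 - discs_union x r"
    and W: "\<And>n. (\<Sum>k<n. green 1 (x k) z / L k) \<le> W"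
    and u: "u \<in> upper_class (ball 0 1 - discs_union x r) (indicator (sphere 0 1))"
  shows "ereal (1 - W) \<le> u z"
proof (rule ereal_le_epsilon2)
  fix e :: real assume "0 < e"
  define \<epsilon> where "\<epsilon> = min e (1/2)"
  have \<epsilon>: "0 < \<epsilon>" "\<epsilon> < 1" "\<epsilon> \<le> e" using \<open>0 < e\<close> by (auto simp: \<epsilon>_def)
  define \<Omega> where "\<Omega> = ball 0 1 - discs_union x r"
  have \<Omega>: "open \<Omega>" "\<Omega> \<subseteq> ball 0 1" "z \<in> \<Omega>"
    using open_champagne_region[OF ch] z by (auto simp: \<Omega>_def)
  have hyp: "hyperharmonic_on \<Omega> u" using u by (simp add: upper_class_def \<Omega>_def)
  obtain m where m: "\<And>w. w \<in> \<Omega> \<Longrightarrow> ereal m \<le> u w"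
    using u unfolding upper_class_def \<Omega>_def by blast
  have bdu: "indicator (sphere 0 1) y \<le> Liminf (at y within \<Omega>) u" if "y \<in> frontier \<Omega>" for y
    using u that by (simp add: upper_class_def \<Omega>_def)
  have near: "eventually (\<lambda>w. ereal (1 - \<epsilon>) < u w) (at y within \<Omega>)" if y: "y \<in> sphere 0 1" for y
  proof (cases "y \<in> closure \<Omega>")
    case True
    then have "y \<in> frontier \<Omega>" using y \<Omega> by (auto simp: frontier_def interior_open)
    from bdu[OF this] show ?thesis using y \<epsilon> by (auto simp: le_Liminf_iff)
  next
    case False
    then have "eventually (\<lambda>w. w \<in> - closure \<Omega>) (at y)"
      by (intro eventually_at_in_open') auto
    then show ?thesis unfolding eventually_at_filter
      by (rule eventually_mono) (use closure_subset in auto)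
  qed
  obtain s where s: "s < 1" "\<And>w. w \<in> \<Omega> \<Longrightarrow> s < norm w \<Longrightarrow> ereal (1 - \<epsilon>) < u w"
    using eventually_near_sphere[OF near \<Omega>(2)] by blast
  \<comment> \<open>\<open>s1\<close> and \<open>s'\<close> are chosen so that \<open>z\<close> lies
    in \<open>D\<close> and every point of modulus \<open>s'\<close> has a neighbourhood in which
    the lower bound on \<open>u\<close> is available.\<close>
  define s1 where "s1 = max s (norm z)"
  have s1: "s1 < 1" using s \<Omega> by (auto simp: s1_def)
  define s' where "s' = (1 + s1) / 2"
  have s': "s1 < s'" "s' < 1" using s1 by (auto simp: s'_def)
  obtain n where n: "\<Omega> \<inter> ball 0 s' = ball 0 s' - (\<Union>k<n. cball (x k) (r k))"
    using champagne_region_Int_ball[OF ch s'(2)] by (auto simp: \<Omega>_def)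
  define D where "D = \<Omega> \<inter> ball 0 s'"
  have D: "open D" "bounded D" "D \<subseteq> \<Omega>" "z \<in> D"
    using \<Omega> s' bounded_subset[of "ball 0 s'" D] by (auto simp: D_def s1_def)
  have notx: "w \<noteq> x k" if "w \<in> \<Omega>" for w k
  proof
    assume "w = x k"
    then have "w \<in> discs_union x r"
      using champagne_less(2)[OF ch, of k] by (auto simp: discs_union_def intro!: exI[of _ k])
    then show False using that by (simp add: \<Omega>_def)
  qed
  define h where "h = (\<lambda>w. (\<Sum>k<n. 1 / L k * green 1 (x k) w) + - (1 - \<epsilon>))"
  have h_mv: "mean_value_at h w" if "w \<in> \<Omega>" for w
    unfolding h_def
    using that \<Omega> champagne_less(1)[OF ch] notx
    by (intro mean_value_at_add mean_value_at_sum mean_value_at_cmult mean_value_at_const mean_value_at_green) auto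
  have h_cont: "isCont h w" if "norm w \<le> 1" "\<And>k. k < n \<Longrightarrow> w \<noteq> x k" for w
    unfolding h_def using that champagne_less(1)[OF ch]
    by (intro continuous_add continuous_const continuous_sum continuous_mult isCont_green) auto
  have h_contD: "continuous_on D h"
    using D \<Omega> notx by (intro continuous_at_imp_continuous_on ballI h_cont) force+
  have h_ge: "- (1 - \<epsilon>) \<le> h w" if "norm w \<le> 1" "\<And>k. k < n \<Longrightarrow> w \<noteq> x k" for w
  proof -
    have "0 \<le> (\<Sum>k<n. 1 / L k * green 1 (x k) w)"
      using that L champagne_less(1)[OF ch]
      by (intro sum_nonneg mult_nonneg_nonneg green_nonneg) (auto simp: less_imp_le)
    then show ?thesis by (simp add: h_def)
  qed
  define v where "v = (\<lambda>w. u w + ereal (h w))"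
  have "0 \<le> v z"
  proof (rule minimum_principle[OF D(1,2) _ _ _ _ D(4)])
    show "v w \<noteq> -\<infinity>" if "w \<in> D" for w
      using m[of w] that D by (cases "u w") (auto simp: v_def)
    have lsc: "lower_semicontinuous_on \<Omega> u" using hyp by (simp add: hyperharmonic_on_def)
    show "lower_semicontinuous_on D v"
      unfolding v_def
      by (intro lower_semicontinuous_on_add_real lower_semicontinuous_on_subset[OF lsc] D h_contD)
    show "locally_supermean_on D v"
      unfolding locally_supermean_on_def
    proof
      fix w assume w: "w \<in> D"
      show "eventually (\<lambda>\<rho>. circle_mean v w \<rho> \<le> v w) (at_right 0)"
        using eventually_cball_subset[OF D(1) w] h_mv[OF subsetD[OF D(3) w], unfolded mean_value_at_def]
      proof eventually_elim
        case (elim \<rho>)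
        then have sub: "cball w \<rho> \<subseteq> \<Omega>" "sphere w \<rho> \<subseteq> D" using D sphere_cball by blast+
        have mem: "w + rcis \<rho> t \<in> sphere w \<rho>" for t using elim by (simp add: dist_norm)
        have "circle_mean v w \<rho> = circle_mean u w \<rho> + ereal (h w)"
          unfolding v_def
        proof (rule circle_mean_add_real)
          show "(\<lambda>t. u (w + rcis \<rho> t)) \<in> borel_measurable borel"
            by (rule measurable_circle[OF lsc \<Omega>(1)]) (use sub sphere_cball elim in blast)+
          show "ereal m \<le> u (w + rcis \<rho> t)" for t using mem[of t] sub D by (intro m) blast
          show "continuous_on (sphere w \<rho>) h" by (rule continuous_on_subset[OF h_contD sub(2)])
        qed (use elim in auto)
        also have "\<dots> \<le> v w"
          unfolding v_def using hyp elim sub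
          by (intro add_right_mono) (auto simp: hyperharmonic_on_def)
        finally show ?case .
      qed
    qed
    fix y assume "y \<in> frontier D"
    then have y: "y \<in> closure D" "y \<notin> D" using D by (auto simp: frontier_def interior_open)
    have "closure D \<subseteq> cball 0 s'" by (rule closure_minimal) (auto simp: D_def)
    then have ys: "norm y \<le> s'" using y by auto
    have notball: "y \<notin> ball (x k) (r k)" if "k < n" for k
    proof
      assume "y \<in> ball (x k) (r k)"
      moreover have "ball (x k) (r k) \<inter> D = {}"
        using ball_subset_cball[of "x k" "r k"] that unfolding D_def n by blast
      ultimately show False using y open_Int_closure_eq_empty[OF open_ball, of "x k" "r k" D] by blast
    qed
    have yx: "y \<noteq> x k" if "k < n" for k
      using notball[OF that] champagne_less(2)[OF ch, of k] by auto
    show "0 \<le> Liminf (at y within D) v"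
    proof (cases "norm y < s'")
      case False
      have "eventually (\<lambda>w. w \<in> - cball 0 s1) (at y)"
        using False s' by (intro eventually_at_in_open') auto
      then have "eventually (\<lambda>w. 0 \<le> v w) (at y within D)"
        unfolding eventually_at_filter
      proof eventually_elim
        case (elim w)
        show ?case
        proof (intro impI)
          assume "w \<noteq> y" "w \<in> D"
          then have "s < norm w" "w \<in> \<Omega>" using elim D by (auto simp: s1_def)
          then have "ereal (1 - \<epsilon>) \<le> u w" using s(2) by (simp add: less_imp_le)
          moreover have "- (1 - \<epsilon>) \<le> h w"
            using \<open>w \<in> \<Omega>\<close> \<Omega> notx by (intro h_ge) force+
          ultimately have "ereal (1 - \<epsilon>) + ereal (- (1 - \<epsilon>)) \<le> v w"
            unfolding v_def by (intro add_mono) auto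
          then show "0 \<le> v w" by (simp add: zero_ereal_def)
        qed
      qed
      then show ?thesis by (rule Liminf_bounded)
    next
      case True
      then have "y \<in> ball 0 s'" by simp
      then have "y \<notin> \<Omega>" using y(2) by (auto simp: D_def)
      then have "y \<in> (\<Union>k<n. cball (x k) (r k))" using n \<open>y \<in> ball 0 s'\<close> by blast
      then obtain k where k: "k < n" "y \<in> cball (x k) (r k)" by blast
      then have "norm (y - x k) = r k" using notball[OF k(1)] by (auto simp: dist_norm norm_minus_commute)
      then have "1 \<le> 1 / L k * green 1 (x k) y" using green[of y k] L[of k] by (simp add: field_simps)
      also have "\<dots> \<le> (\<Sum>k<n. 1 / L k * green 1 (x k) y)"
      proof (rule member_le_sum)
        fix j assume "j \<in> {..<n} - {k}"
        then show "0 \<le> 1 / L j * green 1 (x j) y"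
          using L[of j] yx ys s' champagne_less(1)[OF ch]
          by (intro mult_nonneg_nonneg green_nonneg) (auto simp: less_imp_le)
      qed (use k(1) in auto)
      finally have hy: "\<epsilon> \<le> h y" by (simp add: h_def)
      have "isCont h y" using ys s' yx by (intro h_cont) auto
      then have "(h \<longlongrightarrow> h y) (at y)" by (simp add: isCont_def)
      \<comment> \<open>The slack \<epsilon> is split: one half absorbs the variation of
        \<open>h\<close> near \<open>y\<close>, the other the possibly negative values of
        \<open>u\<close>, whose lower limit at \<open>y\<close> is only known to be at least
        0.\<close>
      then have "eventually (\<lambda>w. \<epsilon> / 2 < h w) (at y)"
        using hy \<epsilon> by (intro order_tendstoD(1)) auto
      then have ev1: "eventually (\<lambda>w. \<epsilon> / 2 < h w) (at y within D)"
        by (rule filter_leD[OF at_le[OF subset_UNIV]])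
      have "y \<in> closure \<Omega>" using y(1) closure_mono[OF D(3)] by blast
      then have "y \<in> frontier \<Omega>" using \<open>y \<notin> \<Omega>\<close> \<Omega> by (auto simp: frontier_def interior_open)
      have "(0::ereal) \<le> indicator (sphere 0 1) y" by (simp add: indicator_def)
      also have "\<dots> \<le> Liminf (at y within \<Omega>) u" by (rule bdu) fact
      finally have "eventually (\<lambda>w. ereal (- (\<epsilon> / 2)) < u w) (at y within \<Omega>)"
        using \<epsilon> by (auto simp: le_Liminf_iff)
      then have ev2: "eventually (\<lambda>w. ereal (- (\<epsilon> / 2)) < u w) (at y within D)"
        by (rule filter_leD[OF at_le[OF D(3)]])
      have "eventually (\<lambda>w. 0 \<le> v w) (at y within D)"
        using ev1 ev2
      proof eventually_elim
        case (elim w)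
        then have "ereal (- (\<epsilon> / 2)) + ereal (\<epsilon> / 2) \<le> v w"
          unfolding v_def by (intro add_mono) auto
        then show ?case by (simp add: zero_ereal_def)
      qed
      then show ?thesis by (rule Liminf_bounded)
    qed
  qed
  then have "0 \<le> u z + ereal (h z)" by (simp add: v_def)
  moreover have "h z \<le> W - (1 - \<epsilon>)" using W[of n] by (simp add: h_def divide_inverse mult.commute)
  ultimately show "ereal (1 - W) \<le> u z + ereal e" using \<epsilon>(3) by (cases "u z") auto
qed

section \<open>Geometric levels and counting\<close>

lemma geometric_level:
  fixes q t :: real
  assumes q: "0 < q" "q < 1" and t: "0 \<le> t" "t < 1"
  obtains n where "1 - q ^ n \<le> t" "t < 1 - q ^ Suc n"
proof -
  obtain m where m: "q ^ m < 1 - t" using real_arch_pow_inv[of "1 - t" q] q t by auto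
  define n where "n = (LEAST m. q ^ m < 1 - t)"
  have n: "q ^ n < 1 - t" unfolding n_def by (rule LeastI[of _ m]) (rule m)
  have "n \<noteq> 0" using n t by (intro notI) simp
  then obtain k where k: "n = Suc k" by (cases n) auto
  have "\<not> q ^ k < 1 - t" using not_less_Least[of k "\<lambda>m. q ^ m < 1 - t"] k by (simp add: n_def)
  then show thesis using n k by (intro that[of k]) auto
qed

lemma nn_integral_geometric_levels:
  fixes c :: "nat \<Rightarrow> ennreal"
  assumes q: "0 < q" "q < (1::real)"
  shows "(\<integral>\<^sup>+t. (\<Sum>n. c n * indicator {1 - q ^ n..<1 - q ^ Suc n} t) \<partial>lborel)
      = (\<Sum>n. c n * ennreal (q ^ n * (1 - q)))"
proof -
  have "(\<integral>\<^sup>+t. (\<Sum>n. c n * indicator {1 - q ^ n..<1 - q ^ Suc n} t) \<partial>lborel)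
      = (\<Sum>n. c n * emeasure lborel {1 - q ^ n..<1 - q ^ Suc n})"
    by (subst nn_integral_suminf) (auto simp: nn_integral_cmult_indicator)
  also have "\<dots> = (\<Sum>n. c n * ennreal (q ^ n * (1 - q)))"
  proof (rule arg_cong[of _ _ suminf], rule ext)
    fix n
    have "q ^ Suc n \<le> q ^ n" using q by (intro power_decreasing) auto
    then show "c n * emeasure lborel {1 - q ^ n..<1 - q ^ Suc n} = c n * ennreal (q ^ n * (1 - q))"
      by (simp add: algebra_simps)
  qed
  finally show ?thesis .
qed

lemma geometric_levels_disjoint:
  fixes q :: real
  assumes q: "0 < q" "q < 1"
  shows "disjoint_family (\<lambda>n. {1 - q ^ n..<1 - q ^ Suc n})"
proof -
  have "{1 - q ^ m..<1 - q ^ Suc m} \<inter> {1 - q ^ n..<1 - q ^ Suc n} = {}" if "m < n" for m n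
  proof -
    have "q ^ n \<le> q ^ Suc m" using that q by (intro power_decreasing) auto
    then show ?thesis by auto
  qed
  then show ?thesis
    unfolding disjoint_family_on_def by (metis Int_commute linorder_neqE_nat)
qed

lemma nn_integral_ge_geometric_levels:
  fixes f :: "real \<Rightarrow> ennreal" and c :: "nat \<Rightarrow> ennreal"
  assumes q: "0 < q" "q < (1::real)"
    and le: "\<And>n t. 1 - q ^ n \<le> t \<Longrightarrow> t < 1 - q ^ Suc n \<Longrightarrow> c n \<le> f t"
  shows "(\<Sum>n. c n * ennreal (q ^ n * (1 - q))) \<le> (\<integral>\<^sup>+t\<in>{0..<1}. f t \<partial>lborel)"
  unfolding nn_integral_geometric_levels[OF q, symmetric]
proof (rule nn_integral_mono)
  fix t
  show "(\<Sum>n. c n * indicator {1 - q ^ n..<1 - q ^ Suc n} t) \<le> f t * indicator {0..<1} t"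
  proof (cases "0 \<le> t \<and> t < 1")
    case True
    then obtain n where n: "1 - q ^ n \<le> t" "t < 1 - q ^ Suc n" using geometric_level[OF q] by metis
    have "(\<Sum>n. c n * indicator {1 - q ^ n..<1 - q ^ Suc n} t) = c n"
      by (rule suminf_cmult_indicator[OF geometric_levels_disjoint[OF q]]) (use n in auto)
    then show ?thesis using le[OF n] True by simp
  next
    case False
    have "t \<notin> {1 - q ^ n..<1 - q ^ Suc n}" for n
    proof -
      have "q ^ n \<le> 1" "0 < q ^ Suc n" using q by (auto simp: power_le_one)
      then show ?thesis using False by (auto simp del: power_Suc)
    qed
    then have "(\<Sum>n. c n * indicator {1 - q ^ n..<1 - q ^ Suc n} t) = (\<Sum>n. 0)"
      by (intro arg_cong[of _ _ suminf] ext) simp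
    then show ?thesis by simp
  qed
qed

lemma nn_integral_le_geometric_levels:
  fixes f :: "real \<Rightarrow> ennreal" and c :: "nat \<Rightarrow> ennreal"
  assumes q: "0 < q" "q < (1::real)"
    and le: "\<And>n t. 1 - q ^ n \<le> t \<Longrightarrow> t < 1 - q ^ Suc n \<Longrightarrow> f t \<le> c n"
  shows "(\<integral>\<^sup>+t\<in>{0..<1}. f t \<partial>lborel) \<le> (\<Sum>n. c n * ennreal (q ^ n * (1 - q)))"
  unfolding nn_integral_geometric_levels[OF q, symmetric]
proof (rule nn_integral_mono)
  fix t
  show "f t * indicator {0..<1} t \<le> (\<Sum>n. c n * indicator {1 - q ^ n..<1 - q ^ Suc n} t)"
  proof (cases "0 \<le> t \<and> t < 1")
    case True
    then obtain n where n: "1 - q ^ n \<le> t" "t < 1 - q ^ Suc n" using geometric_level[OF q] by metis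
    have "(\<Sum>n. c n * indicator {1 - q ^ n..<1 - q ^ Suc n} t) = c n"
      by (rule suminf_cmult_indicator[OF geometric_levels_disjoint[OF q]]) (use n in auto)
    then show ?thesis using le[OF n] True by simp
  qed auto
qed

section \<open>Covering an annulus by discs centred on its inner circle\<close>

lemma norm_cis_diff_le: "norm (cis \<alpha> - cis \<beta>) \<le> \<bar>\<alpha> - \<beta>\<bar>"
proof -
  have "cis \<alpha> - cis \<beta> = cis \<beta> * (cis (\<alpha> - \<beta>) - 1)"
    by (simp add: cis_mult algebra_simps)
  then have "norm (cis \<alpha> - cis \<beta>) = norm (exp (\<i> * of_real (\<alpha> - \<beta>)) - 1)"
    by (simp add: norm_mult cis_conv_exp)
  also have "\<dots> = 2 * \<bar>sin ((\<alpha> - \<beta>) / 2)\<bar>"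
    using dist_exp_i_1[of "\<alpha> - \<beta>"] by simp
  also have "\<dots> \<le> \<bar>\<alpha> - \<beta>\<bar>" using abs_sin_x_le_abs_x[of "(\<alpha> - \<beta>) / 2"] by simp
  finally show ?thesis .
qed

text \<open>A radial move of length less than \<delta> and an arc of length at most \<delta> lead to
  one of the \<open>J\<close> equally spaced points: the angles are at most \<delta> apart and the
  circle has radius at most 1.\<close>

lemma circle_covers_annulus:
  assumes s: "0 \<le> s" "s \<le> norm w" "norm w < s + \<delta>" "s \<le> 1" and J: "2 * pi \<le> \<delta> * real J" "0 < J"
  obtains j where "j < J" "norm (w - rcis s (2 * pi * real j / real J)) < 2 * \<delta>"
proof -
  define \<theta> where "\<theta> = Arg2pi w"
  have \<theta>: "0 \<le> \<theta>" "\<theta> < 2 * pi" "w = of_real (norm w) * cis \<theta>"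
    using Arg2pi[of w] by (auto simp: \<theta>_def cis_conv_exp is_Arg_def)
  define j where "j = nat \<lfloor>\<theta> * J / (2 * pi)\<rfloor>"
  have nonneg: "0 \<le> \<theta> * J / (2 * pi)" using \<theta> by simp
  then have j: "real j \<le> \<theta> * J / (2 * pi)" "\<theta> * J / (2 * pi) < real j + 1"
    by (auto simp: j_def)
  have "\<theta> * J / (2 * pi) < J" using \<theta> J by (simp add: divide_less_eq)
  then have jJ: "j < J" using j by linarith
  have "2 * pi * real j / J \<le> \<theta>" "\<theta> < 2 * pi * real j / J + 2 * pi / J"
    using j J by (auto simp: field_simps)
  moreover have "2 * pi / J \<le> \<delta>" using J by (simp add: divide_le_eq)
  ultimately have ang: "\<bar>\<theta> - 2 * pi * real j / J\<bar> \<le> \<delta>" by linarith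
  have "w - rcis s (2 * pi * real j / J) = of_real (norm w - s) * cis \<theta> + of_real s * (cis \<theta> - cis (2 * pi * real j / J))"
    by (subst \<theta>(3)) (simp add: rcis_def algebra_simps)
  then have "norm (w - rcis s (2 * pi * real j / J)) \<le> norm (of_real (norm w - s) * cis \<theta>) + norm (of_real s * (cis \<theta> - cis (2 * pi * real j / J)))"
    using norm_triangle_ineq by metis
  also have "\<dots> = (norm w - s) + s * norm (cis \<theta> - cis (2 * pi * real j / J))"
    using s by (simp add: norm_mult flip: of_real_diff)
  also have "\<dots> \<le> (norm w - s) + 1 * \<delta>"
    using s ang norm_cis_diff_le[of \<theta> "2 * pi * real j / J"]
    by (intro add_left_mono mult_mono) auto
  also have "\<dots> < 2 * \<delta>" using s by simp
  finally show thesis using jJ by (intro that)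
qed

lemma champagne_finite_centres:
  assumes ch: "champagne x r" and s: "s < 1"
  shows "finite {k. norm (x k) \<le> s}"
proof -
  obtain n where n: "\<And>k. k \<ge> n \<Longrightarrow> cball (x k) (r k) \<inter> cball 0 s = {}"
    using champagne_discs_escape[OF assms] by blast
  have "{k. norm (x k) \<le> s} \<subseteq> {..<n}"
  proof
    fix k assume "k \<in> {k. norm (x k) \<le> s}"
    then have "x k \<in> cball (x k) (r k) \<inter> cball 0 s" using champagne_less(2)[OF ch, of k] by simp
    then show "k \<in> {..<n}" using n[of k] by (cases "n \<le> k") auto
  qed
  then show ?thesis using finite_subset by blast
qed

text \<open>The annulus has width a d / 2, so discs of radius a d centred at roughly 4 pi / (a d)
  points of the inner circle cover it. These points have modulus 1 - d, hence the discs are exactly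
  those of \<open>centre_count\<close>, and the factor d offsets the number of points.\<close>

lemma card_centres_annulus:
  assumes ch: "champagne x r" and a: "0 < a" "a < 1" and b: "0 < b"
    and count: "\<And>z. z \<in> ball 0 1 \<Longrightarrow> real (centre_count x a z) \<le> b * M (norm z)"
    and d: "0 < d" "d \<le> 1" and M: "0 \<le> M (1 - d)"
  shows "d * real (card {k. 1 - d \<le> norm (x k) \<and> norm (x k) < 1 - (1 - a/2) * d})
      \<le> (4 * pi / a + 1) * b * M (1 - d)"
proof -
  define K where "K = {k. 1 - d \<le> norm (x k) \<and> norm (x k) < 1 - (1 - a/2) * d}"
  define J where "J = nat \<lceil>4 * pi / (a * d)\<rceil>"
  have pos: "0 < 4 * pi / (a * d)" using a d by simp
  have J: "4 * pi / (a * d) \<le> real J" "real J \<le> 4 * pi / (a * d) + 1" "0 < J"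
    using pos unfolding J_def by linarith+
  define \<zeta> where "\<zeta> = (\<lambda>j. rcis (1 - d) (2 * pi * real j / real J))"
  have n\<zeta>: "norm (\<zeta> j) = 1 - d" for j using d by (simp add: \<zeta>_def)
  \<comment> \<open>\<open>card\<close> is 0 on infinite sets, so finiteness has to precede the
    comparison of cardinalities.\<close>
  have fin: "finite (ball (\<zeta> j) (a * d) \<inter> range x)" for j
  proof -
    have ad: "a * d < d" using a d by simp
    have "ball (\<zeta> j) (a * d) \<inter> range x \<subseteq> x ` {k. norm (x k) \<le> 1 - d + a * d}"
    proof
      fix w assume "w \<in> ball (\<zeta> j) (a * d) \<inter> range x"
      then obtain k where k: "w = x k" "norm (\<zeta> j - w) < a * d" by (auto simp: dist_norm)
      then have "norm (x k) \<le> 1 - d + a * d"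
        using norm_triangle_sub[of w "\<zeta> j"] n\<zeta>[of j] by (simp add: norm_minus_commute)
      then show "w \<in> x ` {k. norm (x k) \<le> 1 - d + a * d}" using k by auto
    qed
    then show ?thesis
      by (rule finite_subset) (use ad in \<open>intro finite_imageI champagne_finite_centres[OF ch], simp\<close>)
  qed
  have cover: "x ` K \<subseteq> (\<Union>j<J. ball (\<zeta> j) (a * d) \<inter> range x)"
  proof
    fix w assume "w \<in> x ` K"
    then have w: "1 - d \<le> norm w" "norm w < (1 - d) + a * d / 2" "w \<in> range x"
      by (auto simp: K_def algebra_simps)
    have "2 * pi \<le> a * d / 2 * real J" using J(1) a d by (simp add: divide_le_eq mult.commute)
    then obtain j where "j < J" "norm (w - \<zeta> j) < 2 * (a * d / 2)"
      using circle_covers_annulus[of "1 - d" w "a * d / 2" J] w d J(3) by (auto simp: \<zeta>_def)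
    then show "w \<in> (\<Union>j<J. ball (\<zeta> j) (a * d) \<inter> range x)"
      using w by (auto simp: dist_norm norm_minus_commute)
  qed
  have "card K = card (x ` K)"
    using champagne_inj[OF ch] by (simp add: card_image inj_on_subset)
  also have "\<dots> \<le> card (\<Union>j<J. ball (\<zeta> j) (a * d) \<inter> range x)"
    by (rule card_mono[OF finite_UN_I cover]) (use fin in simp_all)
  also have "\<dots> \<le> (\<Sum>j<J. card (ball (\<zeta> j) (a * d) \<inter> range x))" by (rule card_UN_le) simp
  also have "\<dots> = (\<Sum>j<J. centre_count x a (\<zeta> j))" by (simp add: centre_count_def n\<zeta>)
  finally have "real (card K) \<le> (\<Sum>j<J. real (centre_count x a (\<zeta> j)))"
    by (metis of_nat_le_iff of_nat_sum)
  also have "\<dots> \<le> (\<Sum>j<J. b * M (1 - d))"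
    using count n\<zeta> d by (intro sum_mono) (metis diff_less_eq less_add_same_cancel1 mem_ball_0)
  also have "\<dots> = real J * (b * M (1 - d))" by simp
  finally have "d * real (card K) \<le> d * (real J * (b * M (1 - d)))" using d by (intro mult_left_mono) auto
  also have "\<dots> = (d * real J) * (b * M (1 - d))" by simp
  also have "\<dots> \<le> (4 * pi / a + 1) * (b * M (1 - d))"
  proof (intro mult_right_mono)
    have "d * real J \<le> d * (4 * pi / (a * d) + 1)" using J d by (intro mult_left_mono) auto
    also have "\<dots> = 4 * pi / a + d" using a d by (simp add: field_simps)
    finally show "d * real J \<le> 4 * pi / a + 1" using d by simp
  qed (use b M in auto)
  finally show ?thesis by (simp add: K_def mult.assoc)
qed

section \<open>Finite integral implies avoidable\<close>

lemma ln_inverse_pos: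
  fixes \<phi> :: "real \<Rightarrow> real"
  assumes "\<phi> \<in> {0..<1} \<rightarrow> {0<..<1}" "0 \<le> t" "t < 1"
  shows "0 < ln (1 / \<phi> t)"
proof -
  have "0 < \<phi> t" "\<phi> t < 1" using assms by (auto simp: Pi_iff)
  then show ?thesis by simp
qed

lemma ln_inverse_mono:
  fixes \<phi> :: "real \<Rightarrow> real"
  assumes "\<phi> \<in> {0..<1} \<rightarrow> {0<..<1}" "antimono_on {0..<1} \<phi>" "0 \<le> s" "s \<le> t" "t < 1"
  shows "ln (1 / \<phi> s) \<le> ln (1 / \<phi> t)"
proof -
  have "0 < \<phi> t" "0 < \<phi> s" using assms by (auto simp: Pi_iff)
  moreover have "\<phi> t \<le> \<phi> s" using monotone_onD[OF assms(2), of s t] assms by auto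
  ultimately show ?thesis by (simp add: ln_div)
qed

lemma summable_capacities:
  fixes \<phi> M :: "real \<Rightarrow> real"
  assumes \<phi>: "\<phi> \<in> {0..<1} \<rightarrow> {0<..<1}" "antimono_on {0..<1} \<phi>"
    and M: "M \<in> {0..<1} \<rightarrow> {1..}" "mono_on {0..<1} M"
    and c: "1 < c" "\<And>t. 0 < t \<Longrightarrow> t \<le> 1 \<Longrightarrow> M (1 - t/2) \<le> c * M (1 - t)"
    and ch: "champagne x r"
    and a: "0 < a" "a < 1" and b: "0 < b"
    and count: "\<And>z. z \<in> ball 0 1 \<Longrightarrow> real (centre_count x a z) \<le> b * M (norm z)"
    and fin: "(\<integral>\<^sup>+t\<in>{0..<1}. ennreal (M t / ((1 - t) * ln (1 / \<phi> t))) \<partial>lborel) \<noteq> \<infinity>"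
  shows "summable (\<lambda>k. (1 - norm (x k)) / ln (1 / \<phi> (norm (x k))))"
proof -
  define \<Lambda> where "\<Lambda> = (\<lambda>t. ln (1 / \<phi> t))"
  have \<Lambda>_pos: "0 < \<Lambda> t" if "0 \<le> t" "t < 1" for t
    unfolding \<Lambda>_def by (rule ln_inverse_pos[OF \<phi>(1) that])
  have \<Lambda>_mono: "\<Lambda> s \<le> \<Lambda> t" if "0 \<le> s" "s \<le> t" "t < 1" for s t
    unfolding \<Lambda>_def by (rule ln_inverse_mono[OF \<phi> that])
  have M1: "1 \<le> M t" if "0 \<le> t" "t < 1" for t using M(1) that by (auto simp: Pi_iff)
  have M_mono: "M s \<le> M t" if "0 \<le> s" "s \<le> t" "t < 1" for s t
    using mono_onD[OF M(2), of s t] that by auto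
  \<comment> \<open>This ratio makes each level an annulus of \<open>card_centres_annulus\<close>,
    and being at least 1/2 it lets a single doubling of \<open>M\<close> bridge two consecutive
    levels.\<close>
  define q where "q = 1 - a/2"
  have q: "0 < q" "q < 1" "1/2 \<le> q" using a by (auto simp: q_def)
  have lev: "0 \<le> 1 - q ^ n" "1 - q ^ n < 1" "1 - q ^ n \<le> 1 - q ^ Suc n" for n
    using q power_decreasing[of n "Suc n" q] by (auto simp: power_le_one)
  have lev_pos: "0 < \<Lambda> (1 - q ^ n)" "0 \<le> M (1 - q ^ n)" for n
    using \<Lambda>_pos[OF lev(1,2)] order_trans[OF zero_le_one M1[OF lev(1,2)]] by auto
  \<comment> \<open>A lower bound for the integral over level n: \<open>M\<close> at the inner end,
    the logarithm at the outer end.\<close>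
  define T where "T = (\<lambda>n. M (1 - q ^ n) * (1 - q) / \<Lambda> (1 - q ^ Suc n))"
  have T_nonneg: "0 \<le> T n" for n
    unfolding T_def using q by (intro divide_nonneg_pos mult_nonneg_nonneg lev_pos) auto
  have "(\<Sum>n. ennreal (M (1 - q ^ n) / (q ^ n * \<Lambda> (1 - q ^ Suc n))) * ennreal (q ^ n * (1 - q)))
      \<le> (\<integral>\<^sup>+t\<in>{0..<1}. ennreal (M t / ((1 - t) * \<Lambda> t)) \<partial>lborel)"
  proof (rule nn_integral_ge_geometric_levels[OF q(1,2)])
    fix n t assume t: "1 - q ^ n \<le> t" "t < 1 - q ^ Suc n"
    have t01: "0 \<le> t" "t < 1" using t lev(1)[of n] lev(2)[of "Suc n"] by linarith+
    show "ennreal (M (1 - q ^ n) / (q ^ n * \<Lambda> (1 - q ^ Suc n))) \<le> ennreal (M t / ((1 - t) * \<Lambda> t))"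
    proof (rule ennreal_leI, rule frac_le)
      show "0 \<le> M t" using M1[OF t01] by simp
      show "M (1 - q ^ n) \<le> M t" using M_mono[of "1 - q ^ n" t] t lev t01 by auto
      show "0 < (1 - t) * \<Lambda> t" using t01 \<Lambda>_pos by simp
      show "(1 - t) * \<Lambda> t \<le> q ^ n * \<Lambda> (1 - q ^ Suc n)"
        using t t01 \<Lambda>_mono[of t "1 - q ^ Suc n"] \<Lambda>_pos[of t] lev[of "Suc n"]
        by (intro mult_mono) auto
    qed
  qed
  also have "\<dots> < \<infinity>" using fin by (simp add: \<Lambda>_def less_top)
  finally have "(\<Sum>n. ennreal (T n)) < \<infinity>"
  proof (rule back_subst[of "\<lambda>s. s < \<infinity>"], intro arg_cong[of _ _ suminf] ext)
    fix n
    have "0 \<le> M (1 - q ^ n) / (q ^ n * \<Lambda> (1 - q ^ Suc n))"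
      using q by (intro divide_nonneg_pos mult_pos_pos lev_pos) auto
    then show "ennreal (M (1 - q ^ n) / (q ^ n * \<Lambda> (1 - q ^ Suc n))) * ennreal (q ^ n * (1 - q)) = ennreal (T n)"
      using q by (simp add: T_def ennreal_mult'[symmetric])
  qed
  then have sumT: "summable T"
    using T_nonneg by (intro summable_suminf_not_top) auto
  define C where "C = (4 * pi / a + 1) * b * c / (1 - q)"
  have C: "0 \<le> C" using a b c q by (simp add: C_def)
  \<comment> \<open>Shifted by one: the inner end of level n + 1 is the outer end of level n, so the
    logarithm agrees with the one in \<open>T n\<close>, and only \<open>M\<close> costs a doubling.
    The centres of level 0 are collected in the finite set \<open>P\<close>.\<close>
  define K where "K = (\<lambda>n. {k. 1 - q ^ Suc n \<le> norm (x k) \<and> norm (x k) < 1 - q ^ Suc (Suc n)})"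
  define f where "f = (\<lambda>k. (1 - norm (x k)) / \<Lambda> (norm (x k)))"
  have f_nonneg: "0 \<le> f k" for k
    unfolding f_def using champagne_less(1)[OF ch, of k] \<Lambda>_pos[of "norm (x k)"]
    by (intro divide_nonneg_pos) auto
  have finK: "finite (K n)" for n
    by (rule finite_subset[OF _ champagne_finite_centres[OF ch lev(2)[of "Suc (Suc n)"]]])
       (auto simp: K_def)
  have level_sum: "sum f (K n) \<le> C * T n" for n
  proof -
    let ?d = "q ^ Suc n"
    have d: "0 < ?d" "?d \<le> 1" using q by (auto simp: power_le_one simp del: power_Suc)
    have "f k \<le> ?d / \<Lambda> (1 - ?d)" if "k \<in> K n" for k
      unfolding f_def using that champagne_less(1)[OF ch, of k] d lev(1)[of "Suc n"]
      by (intro frac_le \<Lambda>_pos \<Lambda>_mono) (auto simp: K_def)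
    then have "sum f (K n) \<le> (\<Sum>k\<in>K n. ?d / \<Lambda> (1 - ?d))" by (rule sum_mono)
    also have "\<dots> = (?d * real (card (K n))) / \<Lambda> (1 - ?d)" by simp
    also have "\<dots> \<le> ((4 * pi / a + 1) * b * M (1 - ?d)) / \<Lambda> (1 - ?d)"
    proof (rule divide_right_mono)
      have "K n = {k. 1 - ?d \<le> norm (x k) \<and> norm (x k) < 1 - (1 - a/2) * ?d}"
        by (simp add: K_def q_def)
      moreover have "?d * real (card {k. 1 - ?d \<le> norm (x k) \<and> norm (x k) < 1 - (1 - a/2) * ?d})
          \<le> (4 * pi / a + 1) * b * M (1 - ?d)"
        by (rule card_centres_annulus[OF ch a b count d]) (use M1[OF lev(1,2), of "Suc n"] in auto)
      ultimately show "?d * real (card (K n)) \<le> (4 * pi / a + 1) * b * M (1 - ?d)" by simp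
    qed (use \<Lambda>_pos[OF lev(1,2), of "Suc n"] in auto)
    also have "\<dots> \<le> ((4 * pi / a + 1) * b * (c * M (1 - q ^ n))) / \<Lambda> (1 - ?d)"
    proof (intro divide_right_mono mult_left_mono)
      have "1 - ?d \<le> 1 - q ^ n / 2" using q by simp
      then have "M (1 - ?d) \<le> M (1 - q ^ n / 2)"
        using lev[of "Suc n"] q by (intro M_mono) auto
      also have "\<dots> \<le> c * M (1 - q ^ n)" using q by (intro c(2)) (auto simp: power_le_one)
      finally show "M (1 - ?d) \<le> c * M (1 - q ^ n)" .
    qed (use a b \<Lambda>_pos[OF lev(1,2), of "Suc n"] in auto)
    also have "\<dots> = C * T n" using q by (simp add: C_def T_def)
    finally show ?thesis .
  qed
  define P where "P = {k. norm (x k) \<le> 1 - q ^ 1}"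
  have finP: "finite P" unfolding P_def by (rule champagne_finite_centres[OF ch lev(2)])
  have in_K: "\<exists>n. k \<in> K n" if kP: "k \<notin> P" for k
  proof -
    obtain n where n: "1 - q ^ n \<le> norm (x k)" "norm (x k) < 1 - q ^ Suc n"
      using geometric_level[OF q(1,2), of "norm (x k)"] champagne_less(1)[OF ch, of k] by auto
    then obtain m where "n = Suc m" using kP by (cases n) (auto simp: P_def)
    then show ?thesis using n by (auto simp: K_def)
  qed
  have "summable f"
  proof (rule summableI_nonneg_bounded)
    fix N
    define I where "I = {..<N} - P"
    have "\<forall>k\<in>I. \<exists>n. k \<in> K n" using in_K by (auto simp: I_def)
    then obtain g where g: "\<And>k. k \<in> I \<Longrightarrow> k \<in> K (g k)" by metis
    define N' where "N' = Suc (Max (insert 0 (g ` I)))"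
    have "finite I" by (simp add: I_def)
    then have "I \<subseteq> (\<Union>n<N'. K n)" using g by (fastforce simp: N'_def less_Suc_eq_le)
    then have "sum f I \<le> sum f (\<Union>n<N'. K n)" using finK f_nonneg by (intro sum_mono2) auto
    also have "\<dots> \<le> (\<Sum>n<N'. sum f (K n))"
    proof -
      have "sum f (\<Union>n<N'. K n) \<le> (\<Sum>n<N'. sum f (K n))" for N'
      proof (induction N')
        case (Suc m)
        have "sum f (\<Union>n<Suc m. K n) = sum f ((\<Union>n<m. K n) \<union> K m)"
          by (simp add: lessThan_Suc Un_commute)
        also have "\<dots> \<le> sum f (\<Union>n<m. K n) + sum f (K m)"
          using f_nonneg finK by (subst sum_Un) (auto simp: sum_nonneg)
        finally show ?case using Suc by simp
      qed simp
      then show ?thesis .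
    qed
    also have "\<dots> \<le> (\<Sum>n<N'. C * T n)" by (intro sum_mono level_sum)
    also have "\<dots> = C * (\<Sum>n<N'. T n)" by (simp add: sum_distrib_left)
    also have "\<dots> \<le> C * suminf T"
      using C T_nonneg sumT by (intro mult_left_mono sum_le_suminf) auto
    finally have "sum f I \<le> C * suminf T" .
    moreover have "sum f {..<N} \<le> sum f (P \<union> I)"
      using finP f_nonneg \<open>finite I\<close> by (intro sum_mono2) (auto simp: I_def)
    moreover have "sum f (P \<union> I) = sum f P + sum f I"
      using finP \<open>finite I\<close> by (intro sum.union_disjoint) (auto simp: I_def)
    ultimately show "sum f {..<N} \<le> sum f P + C * suminf T" by simp
  qed (rule f_nonneg)
  then show ?thesis by (simp add: f_def \<Lambda>_def)
qed

lemma small_green_sum: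
  assumes ch: "champagne x r" and L: "\<And>k. 0 < L k"
    and sm: "summable (\<lambda>k. (1 - norm (x k)) / L k)"
  obtains z W where "norm (z :: complex) < 1" "\<And>k. z \<noteq> x k" "W < 1" "\<And>n. (\<Sum>k<n. green 1 (x k) z / L k) \<le> W"
proof -
  have n01: "0 < norm (x k)" "norm (x k) < 1" for k
    using champagne_less(1)[OF ch] champagne_centre_nonzero[OF ch] by auto
  define S where "S = (\<lambda>k. ln (1 / norm (x k)) / L k)"
  \<comment> \<open>For 1/2 < t < 1 one has ln (1 / t) \<le> 2 (1 - t), so \<open>S\<close> is
    eventually dominated by the given series.\<close>
  have "eventually (\<lambda>k. norm (x k) > 1/2) sequentially"
    using ch by (intro order_tendstoD(1)[where y = 1]) (auto simp: champagne_def)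
  then obtain N0 where N0: "\<And>k. k \<ge> N0 \<Longrightarrow> 1/2 < norm (x k)" by (auto simp: eventually_sequentially)
  have S_nonneg: "0 \<le> S k" for k using n01[of k] L[of k] by (simp add: S_def)
  have "summable S"
  proof (rule summable_comparison_test')
    show "summable (\<lambda>k. 2 * ((1 - norm (x k)) / L k))" using sm by (rule summable_mult)
    fix k assume "N0 \<le> k"
    then have h: "1/2 < norm (x k)" by (rule N0)
    have "ln (1 / norm (x k)) \<le> 1 / norm (x k) - 1" using n01[of k] by (intro ln_le_minus_one) auto
    also have "\<dots> = (1 - norm (x k)) / norm (x k)" using n01[of k] by (simp add: field_simps)
    also have "\<dots> \<le> (1 - norm (x k)) / (1/2)" using h n01[of k] by (intro divide_left_mono) auto
    finally have "S k \<le> 2 * (1 - norm (x k)) / L k"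
      unfolding S_def using L[of k] by (intro divide_right_mono) auto
    then show "norm (S k) \<le> 2 * ((1 - norm (x k)) / L k)" using S_nonneg[of k] by simp
  qed
  \<comment> \<open>The tail of the dominating series contributes less than 1/2 for every \<rho>.
    The radius \<open>\<rho>0\<close> then keeps the first \<open>N\<close> terms at no more than
    1/2; \<open>Q + 1\<close> in place of \<open>Q\<close> guards against
    \<open>Q = 0\<close>.\<close>
  then obtain N where N: "norm (\<Sum>i. S (i + N)) < 1/2"
    using suminf_exist_split[of "1/2" S] by auto
  define Q where "Q = (\<Sum>k<N. 1 / L k)"
  have Q: "0 \<le> Q" using L by (simp add: Q_def sum_nonneg less_imp_le)
  define \<rho>0 where "\<rho>0 = exp (- (1 / (2 * (Q + 1))))"
  have \<rho>0: "0 < \<rho>0" "\<rho>0 < 1" using Q by (auto simp: \<rho>0_def)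
  \<comment> \<open>The circle has to avoid every pole, and only countably many radii are
    excluded.\<close>
  have "uncountable ({\<rho>0<..<1} - range (\<lambda>k. norm (x k)))"
    using \<rho>0 by (intro uncountable_minus_countable) (auto simp: uncountable_open_interval)
  then obtain \<rho> where \<rho>: "\<rho>0 < \<rho>" "\<rho> < 1" "\<And>k. norm (x k) \<noteq> \<rho>"
    by (metis DiffE countable_empty equals0I greaterThanLessThan_iff rangeI)
  have \<rho>_pos: "0 < \<rho>" using \<rho> \<rho>0 by simp
  define T where "T = (\<lambda>k. ln (1 / max \<rho> (norm (x k))) / L k)"
  have T_nonneg: "0 \<le> T k" for k
    using n01[of k] \<rho> \<rho>_pos L[of k] by (simp add: T_def max_def)
  have T_le: "T k \<le> S k" for k
    unfolding T_def S_def using n01[of k] \<rho>_pos L[of k]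
    by (intro divide_right_mono) (auto simp: ln_div max_def)
  have sumT: "summable T"
    by (rule summable_comparison_test'[OF \<open>summable S\<close>, of 0]) (use T_nonneg T_le in auto)
  have "suminf T < 1"
  proof -
    have "(\<Sum>k<N. T k) \<le> (\<Sum>k<N. ln (1 / \<rho>) * (1 / L k))"
      unfolding T_def using n01 \<rho>_pos L
      by (intro sum_mono) (auto intro!: divide_right_mono simp: ln_div less_imp_le)
    also have "\<dots> = ln (1 / \<rho>) * Q" by (simp add: Q_def sum_distrib_left)
    also have "\<dots> \<le> 1 / (2 * (Q + 1)) * Q"
    proof (rule mult_right_mono)
      have "ln \<rho>0 \<le> ln \<rho>" using \<rho> \<rho>0 by (intro ln_mono) auto
      then show "ln (1 / \<rho>) \<le> 1 / (2 * (Q + 1))" using \<rho>_pos by (simp add: \<rho>0_def ln_div)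
    qed (rule Q)
    also have "\<dots> \<le> 1/2" using Q by (simp add: field_simps)
    finally have fin: "(\<Sum>k<N. T k) \<le> 1/2" .
    have "(\<Sum>k. T (k + N)) \<le> (\<Sum>k. S (k + N))"
      using \<open>summable S\<close> sumT T_le by (intro suminf_le) (auto simp: summable_iff_shift)
    then have "(\<Sum>k. T (k + N)) < 1/2" using N by (simp add: abs_less_iff)
    then show ?thesis using suminf_split_initial_segment[OF sumT, of N] fin by linarith
  qed
  define G where "G = (\<lambda>k t. green 1 (x k) (rcis \<rho> t) / L k)"
  have ne: "rcis \<rho> t \<noteq> x k" for t k using \<rho>(3)[of k] \<rho>_pos by (metis abs_of_pos complex_mod_rcis)
  have G_nonneg: "0 \<le> G k t" for k t
    unfolding G_def using ne n01 \<rho> \<rho>_pos L by (intro divide_nonneg_pos green_nonneg) auto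
  have [measurable]: "G k \<in> borel_measurable borel" for k
  proof -
    have "continuous_on (sphere 0 \<rho>) (green 1 (x k))"
    proof (intro continuous_at_imp_continuous_on ballI isCont_green)
      fix z :: complex assume "z \<in> sphere 0 \<rho>"
      then show "norm z \<le> 1" "z \<noteq> x k" using \<rho>(2) \<rho>(3)[of k] by auto
    qed (rule n01)
    then have "continuous_on UNIV (\<lambda>t. green 1 (x k) (0 + rcis \<rho> t))"
      by (rule continuous_on_circle) (use \<rho>_pos in auto)
    then have "continuous_on UNIV (G k)"
      unfolding G_def using L[of k] by (auto intro!: continuous_intros)
    then show ?thesis by (rule borel_measurable_continuous_onI)
  qed
  have int: "(\<integral>\<^sup>+t. ennreal (G k t) * indicator {0..2*pi} t \<partial>lborel) = ennreal (2 * pi * T k)" for k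
  proof (rule nn_integral_has_integral_lebesgue')
    have "((\<lambda>t. green 1 (x k) (rcis \<rho> t)) has_integral 2 * pi * ln (1 / max \<rho> (norm (x k)))) {0..2*pi}"
      using n01[of k] \<rho> \<rho>_pos champagne_centre_nonzero[OF ch]
      by (intro integral_green_circle) auto
    from has_integral_divide[OF this, of "L k"]
    show "(G k has_integral 2 * pi * T k) {0..2*pi}" by (simp add: G_def T_def)
  qed (rule G_nonneg)
  \<comment> \<open>The series is summed in \<open>ennreal\<close>, where termwise integration is
    free; a sum at least 1 at every angle would give integral at least 2 pi, against
    \<open>suminf T < 1\<close>.\<close>
  have "\<exists>t. (\<Sum>k. ennreal (G k t)) < 1"
  proof (rule ccontr)
    assume "\<not> (\<exists>t. (\<Sum>k. ennreal (G k t)) < 1)"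
    then have ge: "1 \<le> (\<Sum>k. ennreal (G k t))" for t by (simp add: not_less)
    have "ennreal (2 * pi) = (\<integral>\<^sup>+t. indicator {0..2*pi} t \<partial>lborel)" by simp
    also have "\<dots> \<le> (\<integral>\<^sup>+t. (\<Sum>k. ennreal (G k t) * indicator {0..2*pi} t) \<partial>lborel)"
    proof (rule nn_integral_mono)
      fix t
      show "indicator {0..2*pi} t \<le> (\<Sum>k. ennreal (G k t) * indicator {0..2*pi} t)"
        using ge[of t] by (cases "t \<in> {0..2*pi}") auto
    qed
    also have "\<dots> = (\<Sum>k. ennreal (2 * pi * T k))"
      by (subst nn_integral_suminf) (auto simp: int)
    also have "\<dots> = ennreal (2 * pi * suminf T)"
      using sumT T_nonneg by (simp add: suminf_ennreal2 summable_mult suminf_mult)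
    finally have "2 * pi \<le> 2 * pi * suminf T"
      using suminf_nonneg[OF sumT T_nonneg] by (subst (asm) ennreal_le_iff) auto
    then show False using \<open>suminf T < 1\<close> by simp
  qed
  then obtain t where t: "(\<Sum>k. ennreal (G k t)) < 1" by blast
  obtain W where W: "0 \<le> W" "(\<Sum>k. ennreal (G k t)) = ennreal W"
    using t by (cases "\<Sum>k. ennreal (G k t)" rule: ennreal_cases) auto
  show thesis
  proof (rule that[of "rcis \<rho> t" W])
    show "W < 1" using t W by (simp add: ennreal_less_one_iff)
    fix n
    have "ennreal (\<Sum>k<n. G k t) = (\<Sum>k<n. ennreal (G k t))"
      using G_nonneg by (simp add: sum_ennreal)
    also have "\<dots> \<le> (\<Sum>k. ennreal (G k t))" by (intro sum_le_suminf) auto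
    finally have "(\<Sum>k<n. G k t) \<le> W" using W by simp
    then show "(\<Sum>k<n. green 1 (x k) (rcis \<rho> t) / L k) \<le> W" by (simp add: G_def)
  qed (use ne \<rho> \<rho>_pos in auto)
qed

lemma not_unavoidable_if_summable:
  assumes ch: "champagne x r" and p: "\<And>k. 0 < p k" "\<And>k. p k < 1"
    and r: "\<And>k. r k = (1 - norm (x k)) * p k"
    and sm: "summable (\<lambda>k. (1 - norm (x k)) / ln (1 / p k))"
  shows "\<not> unavoidable (discs_union x r)"
proof
  assume un: "unavoidable (discs_union x r)"
  define L where "L k = ln (1 / p k)" for k
  have L: "0 < L k" for k using p by (simp add: L_def)
  obtain z W where z: "norm z < 1" "\<And>k. z \<noteq> x k" "W < 1"
    "\<And>n. (\<Sum>k<n. green 1 (x k) z / L k) \<le> W"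
    using small_green_sum[OF ch L sm[folded L_def]] by blast
  have nonneg: "0 \<le> green 1 (x k) z / L k" for k
    using L[of k] z champagne_less(1)[OF ch] by (intro divide_nonneg_pos green_nonneg) auto
  \<comment> \<open>On the k-th disc the k-th term alone is at least 1, so a point with Green sum
    below 1 lies in the region.\<close>
  have "z \<notin> cball (x k) (r k)" for k
  proof
    assume "z \<in> cball (x k) (r k)"
    then have "L k \<le> green 1 (x k) z"
      unfolding L_def using z r p champagne_less(1)[OF ch]
      by (intro green_lower_bound_disc) (auto simp: dist_norm norm_minus_commute)
    then have "1 \<le> green 1 (x k) z / L k" using L[of k] by simp
    also have "\<dots> \<le> (\<Sum>j<Suc k. green 1 (x j) z / L j)"
      by (rule member_le_sum) (use nonneg in auto)
    finally show False using z(3) z(4)[of "Suc k"] by linarith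
  qed
  then have z\<Omega>: "z \<in> ball 0 1 - discs_union x r" using z by (auto simp: discs_union_def)
  have green: "L k \<le> green 1 (x k) w" if "norm (w - x k) = r k" for k w
    unfolding L_def using that p r champagne_less[OF ch, of k]
    by (intro green_lower_bound_disc) auto
  have "ereal (1 - W) \<le> harmonic_measure (ball 0 1 - discs_union x r) z (sphere 0 1)"
    unfolding harmonic_measure_def upper_PWB_def
    by (intro INF_greatest upper_class_ge_green_sum[OF ch L green z\<Omega> z(4)])
  also have "\<dots> = 0" using un z\<Omega> by (simp add: unavoidable_def)
  finally show False using z(3) by simp
qed

section \<open>Uniform bound for the Green potential of one annulus\<close>

text \<open>A one-sided Laplacian without derivatives: for smooth functions the mean over a circle
  is h + \<rho>^2 / 4 times the Laplacian to second order, so \<open>c\<close> stands for a quarter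
  of an upper bound of it. Negative \<open>c\<close> is allowed, which lets one function compensate
  another.\<close>

definition mean_bound :: "(complex \<Rightarrow> real) \<Rightarrow> complex \<Rightarrow> real \<Rightarrow> bool" where
  "mean_bound h z c \<longleftrightarrow>
     eventually (\<lambda>\<rho>. integral {0..2*pi} (\<lambda>t. h (z + rcis \<rho> t)) \<le> 2 * pi * (h z + c * \<rho>\<^sup>2)) (at_right 0)"

lemma supermean_at_iff_mean_bound: "supermean_at h z \<longleftrightarrow> mean_bound h z 0"
  by (simp add: supermean_at_def mean_bound_def)

lemma mean_bound_mono: "mean_bound h z c \<Longrightarrow> c \<le> c' \<Longrightarrow> mean_bound h z c'"
  unfolding mean_bound_def
  by (elim eventually_mono order_trans) (auto intro!: mult_left_mono mult_right_mono)

lemma mean_bound_add: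
  assumes D: "open D" "z \<in> D" and cont: "continuous_on D f" "continuous_on D g"
    and mb: "mean_bound f z c" "mean_bound g z d"
  shows "mean_bound (\<lambda>w. f w + g w) z (c + d)"
  unfolding mean_bound_def
  using eventually_cball_subset[OF D] mb[unfolded mean_bound_def]
proof eventually_elim
  case (elim \<rho>)
  then have "integral {0..2*pi} (\<lambda>t. f (z + rcis \<rho> t) + g (z + rcis \<rho> t))
      = integral {0..2*pi} (\<lambda>t. f (z + rcis \<rho> t)) + integral {0..2*pi} (\<lambda>t. g (z + rcis \<rho> t))"
    by (intro Henstock_Kurzweil_Integration.integral_add integrable_on_circle[OF cont(1)] integrable_on_circle[OF cont(2)]) auto
  then show ?case using elim by (simp add: algebra_simps)
qed

lemma mean_bound_const: "mean_bound (\<lambda>_. a) z 0"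
  by (simp add: mean_bound_def)

lemma mean_bound_cmult:
  assumes "mean_bound f z c" "0 \<le> a"
  shows "mean_bound (\<lambda>w. a * f w) z (a * c)"
  using assms(1) unfolding mean_bound_def
proof eventually_elim
  case (elim \<rho>)
  from mult_left_mono[OF elim assms(2)] show ?case by (simp add: algebra_simps)
qed

lemma mean_bound_sum:
  assumes D: "open D" "z \<in> D" and f: "\<And>i. i \<in> I \<Longrightarrow> continuous_on D (f i)" "\<And>i. i \<in> I \<Longrightarrow> mean_bound (f i) z (c i)"
  shows "mean_bound (\<lambda>w. \<Sum>i\<in>I. f i w) z (\<Sum>i\<in>I. c i)"
  using f
proof (induction I rule: infinite_finite_induct)
  case (insert i I)
  then show ?case by (auto intro!: mean_bound_add[OF D] continuous_intros)
qed (auto simp: mean_bound_const)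

text \<open>A majorant that agrees at the point has the larger mean and the same centre value.
  Minima and piecewise functions are treated this way, without second derivatives along the
  seam.\<close>

lemma mean_bound_touching:
  assumes D: "open D" "z \<in> D" and cont: "continuous_on D f" "continuous_on D g"
    and le: "\<And>w. w \<in> D \<Longrightarrow> f w \<le> g w" and eq: "f z = g z" and g: "mean_bound g z c"
  shows "mean_bound f z c"
  unfolding mean_bound_def
  using eventually_cball_subset[OF D] g[unfolded mean_bound_def]
proof eventually_elim
  case (elim \<rho>)
  have "integral {0..2*pi} (\<lambda>t. f (z + rcis \<rho> t)) \<le> integral {0..2*pi} (\<lambda>t. g (z + rcis \<rho> t))"
  proof (intro integral_le integrable_on_circle[OF cont(1)] integrable_on_circle[OF cont(2)] le)
    fix t
    have "z + rcis \<rho> t \<in> cball z \<rho>" using elim by (simp add: dist_norm)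
    then show "z + rcis \<rho> t \<in> D" using elim by blast
  qed (use elim in auto)
  then show ?case using elim eq by simp
qed

lemma mean_value_at_imp_mean_bound: "mean_value_at h z \<Longrightarrow> mean_bound h z 0"
  using mean_value_at_imp_supermean_at supermean_at_iff_mean_bound by blast

section \<open>Model functions: squared norm, smoothed logarithm, collar\<close>

lemma has_integral_norm_square:
  assumes \<rho>: "0 < \<rho>"
  shows "((\<lambda>t. (norm (z + rcis \<rho> t - w))\<^sup>2) has_integral 2 * pi * ((norm (z - w))\<^sup>2 + \<rho>\<^sup>2)) {0..2*pi}"
proof -
  \<comment> \<open>The cross term is the real part of a holomorphic function vanishing at the
    centre, so its mean is 0.\<close>
  have eq: "(norm (z + rcis \<rho> t - w))\<^sup>2 = ((norm (z - w))\<^sup>2 + \<rho>\<^sup>2) + 2 * Re (cnj (z - w) * ((z + rcis \<rho> t) - z))" for t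
  proof -
    have "(\<rho> * cos t)\<^sup>2 + (\<rho> * sin t)\<^sup>2 = \<rho>\<^sup>2"
      by (simp add: power_mult_distrib flip: distrib_left)
    then show ?thesis unfolding cmod_power2 by (simp add: power2_eq_square algebra_simps)
  qed
  have "((\<lambda>t. Re (cnj (z - w) * ((z + rcis \<rho> t) - z))) has_integral 2 * pi * Re (cnj (z - w) * (z - z))) {0..2*pi}"
    by (rule mean_value_Re[where f = "\<lambda>v. cnj (z - w) * (v - z)"]) (use \<rho> in \<open>auto intro!: holomorphic_intros\<close>)
  then have "((\<lambda>t. 2 * Re (cnj (z - w) * ((z + rcis \<rho> t) - z))) has_integral 2 * 0) {0..2*pi}"
    by (intro has_integral_mult_right) simp
  from has_integral_add[OF has_integral_const_real[of "(norm (z - w))\<^sup>2 + \<rho>\<^sup>2" 0 "2*pi"] this]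
  show ?thesis unfolding eq by (simp add: algebra_simps)
qed

lemma mean_bound_norm_square: "mean_bound (\<lambda>v. c * (norm (v - w))\<^sup>2) z c"
  unfolding mean_bound_def using eventually_at_right_less[of "0::real"]
proof eventually_elim
  case (elim \<rho>)
  from integral_unique[OF has_integral_mult_right[OF has_integral_norm_square[OF elim, of z w], of c]]
  show ?case by (simp add: algebra_simps)
qed

text \<open>The logarithm, continued below \<open>\<rho>\<close> by its tangent parabola in \<open>s\<^sup>2\<close>:
  \<open>smooth_ln \<rho> (norm (z - w))\<close> is minus the potential of the unit mass spread uniformly over the disc
  of radius \<open>\<rho>\<close> about \<open>w\<close>.\<close>

definition smooth_ln :: "real \<Rightarrow> real \<Rightarrow> real" where
  "smooth_ln \<rho> s = (if s \<le> \<rho> then ln \<rho> + (s\<^sup>2 / \<rho>\<^sup>2 - 1) / 2 else ln s)"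

text \<open>This is ln u \<le> u - 1 at u = (s / \<rho>)^2. It places \<open>smooth_ln\<close>
  between the logarithm and the parabola on both of its branches.\<close>

lemma ln_le_parabola:
  fixes s \<rho> :: real
  assumes "0 < s" "0 < \<rho>"
  shows "ln s \<le> ln \<rho> + (s\<^sup>2 / \<rho>\<^sup>2 - 1) / 2"
proof -
  have "2 * ln (s / \<rho>) = ln ((s / \<rho>)\<^sup>2)" using assms by (simp add: ln_realpow)
  also have "\<dots> \<le> (s / \<rho>)\<^sup>2 - 1" using assms by (intro ln_le_minus_one) auto
  finally have "2 * (ln s - ln \<rho>) \<le> s\<^sup>2 / \<rho>\<^sup>2 - 1" using assms by (simp add: ln_div power_divide)
  moreover have "a \<le> b + e / 2" if "2 * (a - b) \<le> e" for a b e :: real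
    using that by (simp add: field_simps)
  ultimately show ?thesis by blast
qed

lemma smooth_ln_le_parabola:
  assumes "0 < \<rho>"
  shows "smooth_ln \<rho> s \<le> ln \<rho> + (s\<^sup>2 / \<rho>\<^sup>2 - 1) / 2"
  using ln_le_parabola[of s \<rho>] assms by (simp add: smooth_ln_def)

lemma ln_le_smooth_ln:
  assumes "0 < \<rho>" "0 < s"
  shows "ln s \<le> smooth_ln \<rho> s"
  using ln_le_parabola[of s \<rho>] assms by (simp add: smooth_ln_def)

lemma continuous_on_smooth_ln:
  assumes \<rho>: "0 < \<rho>"
  shows "continuous_on UNIV (smooth_ln \<rho>)"
  unfolding smooth_ln_def
proof (rule continuous_on_cases_le)
  show "continuous_on {t \<in> UNIV. \<rho> \<le> t} ln" using \<rho> by (intro continuous_on_ln continuous_on_id) auto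
qed (use \<rho> in \<open>auto intro!: continuous_intros\<close>)

lemma continuous_on_smooth_ln_norm:
  assumes "0 < \<rho>"
  shows "continuous_on S (\<lambda>v :: complex. smooth_ln \<rho> (norm (v - w)))"
  by (rule continuous_on_compose2[OF continuous_on_smooth_ln[OF assms]]) (auto intro!: continuous_intros)

text \<open>On the closed disc the function touches the parabola from below, and off it the function
  is a harmonic logarithm; 1 / (2 \<rho>^2) is a quarter of the Laplacian of the parabola.\<close>

lemma mean_bound_smooth_ln:
  assumes \<rho>: "0 < \<rho>"
  shows "mean_bound (\<lambda>v. smooth_ln \<rho> (norm (v - w))) z (if norm (z - w) \<le> \<rho> then 1 / (2 * \<rho>\<^sup>2) else 0)"
proof (cases "norm (z - w) \<le> \<rho>")
  case True
  have "mean_bound (\<lambda>v. smooth_ln \<rho> (norm (v - w))) z (0 + 1 / (2 * \<rho>\<^sup>2))"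
  proof (rule mean_bound_touching[of UNIV])
    show "mean_bound (\<lambda>v. (ln \<rho> - 1/2) + 1 / (2 * \<rho>\<^sup>2) * (norm (v - w))\<^sup>2) z (0 + 1 / (2 * \<rho>\<^sup>2))"
      by (intro mean_bound_add[of UNIV] mean_bound_const mean_bound_norm_square continuous_intros) auto
    show "smooth_ln \<rho> (norm (v - w)) \<le> (ln \<rho> - 1/2) + 1 / (2 * \<rho>\<^sup>2) * (norm (v - w))\<^sup>2" for v
      using smooth_ln_le_parabola[OF \<rho>, of "norm (v - w)"] by (simp add: field_simps)
    show "smooth_ln \<rho> (norm (z - w)) = (ln \<rho> - 1/2) + 1 / (2 * \<rho>\<^sup>2) * (norm (z - w))\<^sup>2"
      using True by (simp add: smooth_ln_def field_simps)
  qed (use \<rho> in \<open>auto intro!: continuous_intros continuous_on_smooth_ln_norm\<close>)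
  then show ?thesis using True by simp
next
  case False
  have "mean_bound (\<lambda>v. smooth_ln \<rho> (norm (v - w))) z 0"
  proof (rule mean_bound_touching[of "- cball w \<rho>"])
    have "mean_value_at (\<lambda>v. ln (norm (- w + 1 * v))) z"
      using False \<rho> by (intro mean_value_at_ln_affine) auto
    then show "mean_bound (\<lambda>v. ln (norm (v - w))) z 0"
      by (intro mean_value_at_imp_mean_bound) simp
    show "continuous_on (- cball w \<rho>) (\<lambda>v. ln (norm (v - w)))"
      using \<rho> by (intro continuous_intros) auto
    show "continuous_on (- cball w \<rho>) (\<lambda>v. smooth_ln \<rho> (norm (v - w)))"
      by (rule continuous_on_smooth_ln_norm[OF \<rho>])
  qed (use False in \<open>auto simp: dist_norm norm_minus_commute smooth_ln_def\<close>)
  then show ?thesis using False by simp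
qed

text \<open>A superharmonic function of size \<open>B\<^sup>2\<close> on the unit disc, vanishing on the unit circle, whose
  Laplacian is \<open>-4\<close> on the annulus \<open>1 - B < \<bar>z\<bar>\<^sup>2 < 1\<close>.\<close>

definition collar :: "real \<Rightarrow> real \<Rightarrow> real" where
  "collar B s = (if s \<le> 1 - B then B + (1 - B) * ln (1 - B) else 1 - s + (1 - B) * ln s)"

text \<open>All parts come from ln u \<le> u - 1. The size B^2 is the point: against a density of
  order B^-2 it leaves a bound independent of the annulus.\<close>

lemma collar_bounds:
  assumes B: "0 < B" "B < 1"
  shows "collar B s \<le> B + (1 - B) * ln (1 - B)" "collar B s \<le> B\<^sup>2" "s \<le> 1 \<Longrightarrow> 0 \<le> collar B s"
proof -
  have "ln (1 - B) \<le> (1 - B) - 1" using B by (intro ln_le_minus_one) auto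
  then have "(1 - B) * ln (1 - B) \<le> (1 - B) * (- B)" using B by (intro mult_left_mono) auto
  then have 1: "B + (1 - B) * ln (1 - B) \<le> B\<^sup>2" by (simp add: power2_eq_square algebra_simps)
  show 2: "collar B s \<le> B + (1 - B) * ln (1 - B)"
  proof (cases "s \<le> 1 - B")
    case False
    then have "ln (s / (1 - B)) \<le> s / (1 - B) - 1" using B by (intro ln_le_minus_one) auto
    then have "(1 - B) * ln (s / (1 - B)) \<le> (1 - B) * (s / (1 - B) - 1)"
      using B by (intro mult_left_mono) auto
    also have "\<dots> = s - (1 - B)" using B by (simp add: field_simps)
    finally show ?thesis using False B by (simp add: collar_def ln_div algebra_simps)
  qed (simp add: collar_def)
  show "collar B s \<le> B\<^sup>2" using 1 2 by linarith
  have key: "0 \<le> 1 - t + (1 - B) * ln t" if t: "1 - B \<le> t" "t \<le> 1" for t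
  proof -
    have "ln (1 / t) \<le> 1 / t - 1" using t B by (intro ln_le_minus_one) auto
    then have "- ln t \<le> (1 - t) / t" using t B by (simp add: ln_div field_simps)
    then have "(1 - B) * (- ln t) \<le> (1 - B) * ((1 - t) / t)" using B by (intro mult_left_mono) auto
    also have "\<dots> \<le> t * ((1 - t) / t)" using t B by (intro mult_right_mono) auto
    also have "\<dots> = 1 - t" using t B by simp
    finally show ?thesis by simp
  qed
  show "0 \<le> collar B s" if "s \<le> 1"
    using key[of s] key[of "1 - B"] that B by (auto simp: collar_def)
qed

lemma continuous_on_collar:
  assumes B: "0 < B" "B < 1"
  shows "continuous_on S (\<lambda>z :: complex. collar B ((norm z)\<^sup>2))"
proof -
  have "continuous_on UNIV (collar B)"
    unfolding collar_def
  proof (rule continuous_on_cases_le)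
    show "continuous_on {t \<in> UNIV. 1 - B \<le> t} (\<lambda>s. 1 - s + (1 - B) * ln s)"
      using B by (intro continuous_intros) auto
  qed (use B in \<open>auto intro!: continuous_intros\<close>)
  then show ?thesis
    by (rule continuous_on_compose2) (auto intro!: continuous_intros)
qed

text \<open>On the inner disc \<open>collar\<close> equals its maximum, a constant majorant; where
  |v|^2 > 1 - B it is 1 - |v|^2 plus a harmonic function, whence the -1.\<close>

lemma mean_bound_collar:
  assumes B: "0 < B" "B < 1"
  shows "mean_bound (\<lambda>z. collar B ((norm z)\<^sup>2)) z (if (norm z)\<^sup>2 \<le> 1 - B then 0 else - 1)"
proof (cases "(norm z)\<^sup>2 \<le> 1 - B")
  case True
  have "mean_bound (\<lambda>z. collar B ((norm z)\<^sup>2)) z 0"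
  proof (rule mean_bound_touching[of UNIV _ _ "\<lambda>_. B + (1 - B) * ln (1 - B)"])
    show "continuous_on UNIV (\<lambda>z :: complex. collar B ((norm z)\<^sup>2))" by (rule continuous_on_collar[OF B])
    show "collar B ((norm z)\<^sup>2) = B + (1 - B) * ln (1 - B)" using True by (simp add: collar_def)
  qed (auto simp: mean_bound_const intro: collar_bounds(1)[OF B])
  then show ?thesis using True by simp
next
  case False
  define D where "D = {z :: complex. 1 - B < (norm z)\<^sup>2}"
  have D: "open D" unfolding D_def by (intro open_Collect_less continuous_intros)
  have zD: "z \<in> D" using False by (simp add: D_def)
  have nz: "norm w \<noteq> 0" if "w \<in> D" for w using that B by (auto simp: D_def)
  have "mean_bound (\<lambda>z. collar B ((norm z)\<^sup>2)) z (0 + ((-1) + 2 * (1 - B) * 0))"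
  proof (rule mean_bound_touching[OF D zD])
    have "mean_value_at (\<lambda>v. ln (norm (0 + 1 * v))) z"
      using nz[OF zD] by (intro mean_value_at_ln_affine) auto
    then have "mean_bound (\<lambda>v. 2 * (1 - B) * ln (norm v)) z (2 * (1 - B) * 0)"
      using B by (intro mean_bound_cmult mean_value_at_imp_mean_bound) auto
    moreover have "continuous_on D (\<lambda>v. 2 * (1 - B) * ln (norm v))"
      using nz by (intro continuous_intros) auto
    ultimately show "mean_bound (\<lambda>v. 1 + ((-1) * (norm (v - 0))\<^sup>2 + 2 * (1 - B) * ln (norm v))) z (0 + ((-1) + 2 * (1 - B) * 0))"
      using nz by (intro mean_bound_add[OF D zD] mean_bound_const mean_bound_norm_square continuous_intros) auto
    show "continuous_on D (\<lambda>v. 1 + ((-1) * (norm (v - 0))\<^sup>2 + 2 * (1 - B) * ln (norm v)))"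
      using nz by (intro continuous_intros) auto
    have eq: "collar B ((norm v)\<^sup>2) = 1 + ((-1) * (norm (v - 0))\<^sup>2 + 2 * (1 - B) * ln (norm v))" if "v \<in> D" for v
      using nz[OF that] that B by (simp add: collar_def D_def ln_realpow)
    show "collar B ((norm v)\<^sup>2) \<le> 1 + ((-1) * (norm (v - 0))\<^sup>2 + 2 * (1 - B) * ln (norm v))" if "v \<in> D" for v
      using eq[OF that] by simp
    show "collar B ((norm z)\<^sup>2) = 1 + ((-1) * (norm (z - 0))\<^sup>2 + 2 * (1 - B) * ln (norm z))"
      by (rule eq[OF zD])
  qed (rule continuous_on_collar[OF B])
  then show ?thesis using False by simp
qed

text \<open>\<open>green R w\<close> with the pole smoothed out inside the disc of radius
  \<open>\<rho>\<close> about \<open>w\<close>; outside that disc the two agree.\<close>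

definition smooth_green :: "real \<Rightarrow> complex \<Rightarrow> real \<Rightarrow> complex \<Rightarrow> real" where
  "smooth_green R w \<rho> z = ln (norm (of_real (R\<^sup>2) - cnj w * z)) - ln R - smooth_ln \<rho> (norm (z - w))"

text \<open>The minimum principle on the disc of radius \<open>R\<close> shows that
  \<open>A * collar\<close> dominates the smoothed potential. On the boundary the potential is at
  most the Green sum, which vanishes, and the collar is nonnegative; inside, the disjoint discs have
  density constants at most \<open>A\<close>, balanced by the collar.\<close>

lemma smooth_green_sum_le:
  assumes I: "finite I" and R: "R \<le> 1" and B: "0 < B" "B < 1" and A: "0 \<le> A"
    and k: "\<And>k. k \<in> I \<Longrightarrow> norm (x k) < R" "\<And>k. k \<in> I \<Longrightarrow> 0 < \<rho> k" "\<And>k. k \<in> I \<Longrightarrow> 0 < L k"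
      "\<And>k. k \<in> I \<Longrightarrow> 1 - norm (x k) + \<rho> k \<le> B / 2"
      "\<And>k. k \<in> I \<Longrightarrow> 1 / (2 * (\<rho> k)\<^sup>2) / L k \<le> A"
    and disj: "\<And>j k. j \<in> I \<Longrightarrow> k \<in> I \<Longrightarrow> j \<noteq> k \<Longrightarrow> \<rho> j + \<rho> k < norm (x j - x k)"
    and z: "norm z < R"
  shows "(\<Sum>k\<in>I. smooth_green R (x k) (\<rho> k) z / L k) \<le> A * B\<^sup>2"
proof -
  have Rpos: "0 < R" using z norm_ge_zero le_less_trans by blast
  define F where "F = (\<lambda>v. A * collar B ((norm v)\<^sup>2) + (\<Sum>k\<in>I. 1 / L k *
      (smooth_ln (\<rho> k) (norm (v - x k)) + (ln R + (-1) * ln (norm (of_real (R\<^sup>2) - cnj (x k) * v))))))"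
  have F_eq: "F v = A * collar B ((norm v)\<^sup>2) - (\<Sum>k\<in>I. smooth_green R (x k) (\<rho> k) v / L k)" for v
    unfolding F_def smooth_green_def sum_negf[symmetric] diff_conv_add_uminus
    by (intro arg_cong2[of _ _ _ _ "(+)"] refl sum.cong) (simp add: divide_inverse algebra_simps)
  have cont1: "continuous_on (cball 0 R) (\<lambda>v. ln R + (-1) * ln (norm (of_real (R\<^sup>2) - cnj (x k) * v)))"
    if "k \<in> I" for k
    using green_numerator_nonzero[OF k(1)[OF that]] by (intro continuous_intros) auto
  have cont2: "continuous_on (cball 0 R) (\<lambda>v. smooth_ln (\<rho> k) (norm (v - x k)) + (ln R + (-1) * ln (norm (of_real (R\<^sup>2) - cnj (x k) * v))))"
    if "k \<in> I" for k
    by (intro continuous_on_add continuous_on_smooth_ln_norm k(2) cont1 that)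
  have cont3: "continuous_on (cball 0 R) (\<lambda>v. 1 / L k * (smooth_ln (\<rho> k) (norm (v - x k)) + (ln R + (-1) * ln (norm (of_real (R\<^sup>2) - cnj (x k) * v)))))"
    if "k \<in> I" for k
    by (intro continuous_on_mult continuous_on_const cont2 that)
  have cont_F: "continuous_on (cball 0 R) F"
    unfolding F_def
    by (intro continuous_on_add continuous_on_mult continuous_on_const continuous_on_collar[OF B] continuous_on_sum cont3)
  have sub: "ball 0 R \<subseteq> (cball 0 R :: complex set)" by (rule ball_subset_cball)
  have "0 \<le> F z"
  proof (rule minimum_principle_real[of "ball 0 R"])
    show "continuous_on (closure (ball 0 R)) F" using cont_F Rpos by simp
    show "0 \<le> F y" if "y \<in> frontier (ball 0 R)" for y
    proof -
      have y: "norm y = R" using that Rpos by (simp add: frontier_ball)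
      have "smooth_green R (x k) (\<rho> k) y / L k \<le> 0" if kI: "k \<in> I" for k
      proof -
        have yx: "y \<noteq> x k" using k(1)[OF kI] y by auto
        have "smooth_green R (x k) (\<rho> k) y \<le> green R (x k) y"
          unfolding smooth_green_def green_def using ln_le_smooth_ln[of "\<rho> k" "norm (y - x k)"] k(2)[OF kI] yx by simp
        also have "\<dots> = 0" using green_eq[OF k(1)[OF kI] _ yx] y by simp
        finally show ?thesis using k(3)[OF kI] by (simp add: divide_le_0_iff)
      qed
      then have "(\<Sum>k\<in>I. smooth_green R (x k) (\<rho> k) y / L k) \<le> 0" by (rule sum_nonpos)
      moreover have "0 \<le> collar B ((norm y)\<^sup>2)"
        using y R Rpos by (intro collar_bounds(3)[OF B]) (simp add: power_le_one)
      ultimately show ?thesis unfolding F_eq using mult_nonneg_nonneg[OF A] by fastforce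
    qed
    show "supermean_at F v" if v: "v \<in> ball 0 R" for v
    proof -
      define c where "c = (\<lambda>k. if norm (v - x k) \<le> \<rho> k then 1 / (2 * (\<rho> k)\<^sup>2) else 0)"
      have "mean_bound F v (A * (if (norm v)\<^sup>2 \<le> 1 - B then 0 else - 1) + (\<Sum>k\<in>I. 1 / L k * (c k + 0)))"
        unfolding F_def
      proof (rule mean_bound_add[OF open_ball v])
        show "continuous_on (ball 0 R) (\<lambda>v :: complex. A * collar B ((norm v)\<^sup>2))"
          by (intro continuous_on_mult continuous_on_const continuous_on_collar[OF B])
        show "continuous_on (ball 0 R) (\<lambda>v. \<Sum>k\<in>I. 1 / L k * (smooth_ln (\<rho> k) (norm (v - x k)) + (ln R + (-1) * ln (norm (of_real (R\<^sup>2) - cnj (x k) * v)))))"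
          by (intro continuous_on_sum continuous_on_subset[OF cont3 sub])
        show "mean_bound (\<lambda>v. A * collar B ((norm v)\<^sup>2)) v (A * (if (norm v)\<^sup>2 \<le> 1 - B then 0 else - 1))"
          by (intro mean_bound_cmult mean_bound_collar[OF B] A)
        show "mean_bound (\<lambda>v. \<Sum>k\<in>I. 1 / L k * (smooth_ln (\<rho> k) (norm (v - x k)) + (ln R + (-1) * ln (norm (of_real (R\<^sup>2) - cnj (x k) * v))))) v (\<Sum>k\<in>I. 1 / L k * (c k + 0))"
        proof (rule mean_bound_sum[OF open_ball v])
          fix k assume kI: "k \<in> I"
          show "continuous_on (ball 0 R) (\<lambda>v. 1 / L k * (smooth_ln (\<rho> k) (norm (v - x k)) + (ln R + (-1) * ln (norm (of_real (R\<^sup>2) - cnj (x k) * v)))))"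
            by (rule continuous_on_subset[OF cont3[OF kI] sub])
          have "mean_value_at (\<lambda>v. ln (norm (of_real (R\<^sup>2) + (- cnj (x k)) * v))) v"
            using green_numerator_nonzero[OF k(1)[OF kI], of v] v by (intro mean_value_at_ln_affine) auto
          then have mv: "mean_bound (\<lambda>v. ln R + (-1) * ln (norm (of_real (R\<^sup>2) - cnj (x k) * v))) v 0"
            by (intro mean_value_at_imp_mean_bound mean_value_at_add mean_value_at_const mean_value_at_cmult) simp
          have "mean_bound (\<lambda>v. smooth_ln (\<rho> k) (norm (v - x k)) + (ln R + (-1) * ln (norm (of_real (R\<^sup>2) - cnj (x k) * v)))) v (c k + 0)"
            unfolding c_def
            by (intro mean_bound_add[OF open_ball v] mean_bound_smooth_ln[OF k(2)[OF kI]] mv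
                continuous_on_smooth_ln_norm[OF k(2)[OF kI]] continuous_on_subset[OF cont1[OF kI] sub])
          then show "mean_bound (\<lambda>v. 1 / L k * (smooth_ln (\<rho> k) (norm (v - x k)) + (ln R + (-1) * ln (norm (of_real (R\<^sup>2) - cnj (x k) * v))))) v (1 / L k * (c k + 0))"
            using k(3)[OF kI] by (intro mean_bound_cmult) auto
        qed
      qed
      moreover have "A * (if (norm v)\<^sup>2 \<le> 1 - B then 0 else - 1) + (\<Sum>k\<in>I. 1 / L k * (c k + 0)) \<le> 0"
      \<comment> \<open>At most one smoothed disc contains \<open>v\<close>. It contributes at most
        \<open>A\<close>, and the collar contributes -\<open>A\<close> once \<open>v\<close> is
        known to lie in its annulus.\<close>
      proof (cases "\<exists>k\<in>I. norm (v - x k) \<le> \<rho> k")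
        case True
        then obtain k0 where k0: "k0 \<in> I" "norm (v - x k0) \<le> \<rho> k0" by blast
        have "c k = 0" if "k \<in> I - {k0}" for k
        proof -
          have "norm (x k - x k0) \<le> norm (v - x k) + norm (v - x k0)"
            using norm_triangle_ineq4[of "v - x k0" "v - x k"] by (simp add: algebra_simps)
          then have "\<not> norm (v - x k) \<le> \<rho> k" using disj[of k k0] that k0 by force
          then show ?thesis by (simp add: c_def)
        qed
        then have "(\<Sum>k\<in>I. 1 / L k * (c k + 0)) = 1 / L k0 * c k0"
          using I k0(1) by (simp add: sum.remove)
        also have "\<dots> \<le> A" using k(5)[OF k0(1)] k0 by (simp add: c_def mult.commute)
        finally have 1: "(\<Sum>k\<in>I. 1 / L k * (c k + 0)) \<le> A" .
        have "norm (x k0) \<le> norm v + norm (v - x k0)"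
          using norm_triangle_ineq4[of v "v - x k0"] by simp
        \<comment> \<open>This is where B / 2 in the hypothesis on the discs is used: the square of
          1 - B / 2 exceeds 1 - B.\<close>
        then have "1 - B / 2 \<le> norm v" using k(4)[OF k0(1)] k0(2) by linarith
        then have "(1 - B / 2)\<^sup>2 \<le> (norm v)\<^sup>2" using B by (intro power_mono) auto
        moreover have "1 - B < (1 - B / 2)\<^sup>2" using B by (simp add: power2_eq_square algebra_simps)
        ultimately have "\<not> (norm v)\<^sup>2 \<le> 1 - B" by simp
        then show ?thesis using 1 by simp
      next
        case False
        then have "(\<Sum>k\<in>I. 1 / L k * (c k + 0)) = 0" by (intro sum.neutral) (auto simp: c_def)
        then show ?thesis using A by simp
      qed
      ultimately show ?thesis unfolding supermean_at_iff_mean_bound by (rule mean_bound_mono)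
    qed
  qed (use z in auto)
  then have "(\<Sum>k\<in>I. smooth_green R (x k) (\<rho> k) z / L k) \<le> A * collar B ((norm z)\<^sup>2)"
    by (simp add: F_eq)
  also have "\<dots> \<le> A * B\<^sup>2" using A by (intro mult_left_mono collar_bounds(2)[OF B])
  finally show ?thesis .
qed

text \<open>A point lies in at most one of the discs of radius \<open>\<rho> k\<close>, so replacing the smoothed kernels
  by the Green functions adds at most one term.\<close>

lemma green_sum_le:
  assumes I: "finite I" and R: "R \<le> 1" and B: "0 < B" "B < 1" and A: "0 \<le> A"
    and k: "\<And>k. k \<in> I \<Longrightarrow> norm (x k) < R" "\<And>k. k \<in> I \<Longrightarrow> 0 < \<rho> k" "\<And>k. k \<in> I \<Longrightarrow> 0 < L k"
      "\<And>k. k \<in> I \<Longrightarrow> 1 - norm (x k) + \<rho> k \<le> B / 2"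
      "\<And>k. k \<in> I \<Longrightarrow> 1 / (2 * (\<rho> k)\<^sup>2) / L k \<le> A"
    and disj: "\<And>j k. j \<in> I \<Longrightarrow> k \<in> I \<Longrightarrow> j \<noteq> k \<Longrightarrow> \<rho> j + \<rho> k < norm (x j - x k)"
    and z: "norm z < R" "\<And>k. k \<in> I \<Longrightarrow> z \<noteq> x k"
    and far: "\<And>k. k \<in> I \<Longrightarrow> ln (\<rho> k) - ln (norm (z - x k)) \<le> L k"
  shows "(\<Sum>k\<in>I. green R (x k) z / L k) \<le> 1 + A * B\<^sup>2"
proof -
  have le: "green R (x k) z / L k \<le> smooth_green R (x k) (\<rho> k) z / L k + (if norm (z - x k) \<le> \<rho> k then 1 else 0)"
    if kI: "k \<in> I" for k
  proof (cases "norm (z - x k) \<le> \<rho> k")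
    case True
    \<comment> \<open>Inside its disc, smoothing loses at most ln (\<rho> k) - ln |z - x k|, which
      \<open>far\<close> bounds by \<open>L k\<close>; after division by \<open>L k\<close> the loss
      is at most 1.\<close>
    have "smooth_ln (\<rho> k) (norm (z - x k)) \<le> ln (\<rho> k)"
      using True k(2)[OF kI] power_mono[OF True, of 2] by (simp add: smooth_ln_def divide_le_eq)
    then have "green R (x k) z \<le> smooth_green R (x k) (\<rho> k) z + L k"
      using far[OF kI] by (simp add: green_def smooth_green_def)
    then show ?thesis using True k(3)[OF kI] by (simp add: field_simps)
  next
    case False
    then show ?thesis by (simp add: green_def smooth_green_def smooth_ln_def)
  qed
  have "(\<Sum>k\<in>I. if norm (z - x k) \<le> \<rho> k then 1 else 0::real) \<le> 1"
  proof (cases "\<exists>k\<in>I. norm (z - x k) \<le> \<rho> k")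
    case True
    then obtain k0 where k0: "k0 \<in> I" "norm (z - x k0) \<le> \<rho> k0" by blast
    have "\<not> norm (z - x k) \<le> \<rho> k" if "k \<in> I - {k0}" for k
    proof -
      have "norm (x k - x k0) \<le> norm (z - x k) + norm (z - x k0)"
        using norm_triangle_ineq4[of "z - x k0" "z - x k"] by (simp add: algebra_simps)
      then show ?thesis using disj[of k k0] that k0 by force
    qed
    then show ?thesis using I k0 by (simp add: sum.remove)
  next
    case False
    then have "(\<Sum>k\<in>I. if norm (z - x k) \<le> \<rho> k then 1 else 0::real) = 0" by (intro sum.neutral) auto
    then show ?thesis by simp
  qed
  moreover have "(\<Sum>k\<in>I. green R (x k) z / L k)
      \<le> (\<Sum>k\<in>I. smooth_green R (x k) (\<rho> k) z / L k) + (\<Sum>k\<in>I. if norm (z - x k) \<le> \<rho> k then 1 else 0)"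
    unfolding sum.distrib[symmetric] by (rule sum_mono) (rule le)
  moreover have "(\<Sum>k\<in>I. smooth_green R (x k) (\<rho> k) z / L k) \<le> A * B\<^sup>2"
    by (rule smooth_green_sum_le[OF I R B A k disj z(1)])
  ultimately show ?thesis by linarith
qed

section \<open>Barriers\<close>

lemma harmonic_measure_nonneg:
  assumes D: "open D" "bounded D" and z: "z \<in> D"
  shows "0 \<le> harmonic_measure D z A"
  unfolding harmonic_measure_def upper_PWB_def
proof (rule INF_greatest)
  fix u assume u: "u \<in> upper_class D (indicator A)"
  then have hyp: "hyperharmonic_on D u" by (simp add: upper_class_def)
  show "0 \<le> u z"
  proof (rule minimum_principle[OF D _ _ _ _ z])
    show "locally_supermean_on D u"
      unfolding locally_supermean_on_def
    proof
      fix w assume w: "w \<in> D"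
      show "eventually (\<lambda>\<rho>. circle_mean u w \<rho> \<le> u w) (at_right 0)"
        using eventually_cball_subset[OF D(1) w]
        by eventually_elim (use hyp in \<open>auto simp: hyperharmonic_on_def\<close>)
    qed
    fix y assume "y \<in> frontier D"
    then have "indicator A y \<le> Liminf (at y within D) u" using u by (simp add: upper_class_def)
    moreover have "(0::ereal) \<le> indicator A y" by (simp add: indicator_def)
    ultimately show "0 \<le> Liminf (at y within D) u" by (rule order_trans[rotated])
  qed (use hyp in \<open>auto simp: hyperharmonic_on_def\<close>)
qed

text \<open>Real-valued candidates for the upper class. The constant value 1 near the unit circle
  settles the boundary condition there and survives any change inside a smaller disc; on the edges
  of the discs nonnegativity is enough.\<close>

definition barrier :: "complex set \<Rightarrow> (complex \<Rightarrow> real) \<Rightarrow> bool" where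
  "barrier D U \<longleftrightarrow> continuous_on D U \<and> (\<forall>z\<in>D. 0 \<le> U z \<and> supermean_at U z) \<and>
     (\<exists>s<1. \<forall>z\<in>D. s < norm z \<longrightarrow> U z = 1)"

lemma harmonic_measure_le_barrier:
  assumes D: "open D" and U: "barrier D U" and z: "z \<in> D"
  shows "harmonic_measure D z (sphere 0 1) \<le> ereal (U z)"
  unfolding harmonic_measure_def upper_PWB_def
proof (rule INF_lower2[of "\<lambda>w. ereal (U w)"])
  have nonneg: "0 \<le> U w" if "w \<in> D" for w using U that by (auto simp: barrier_def)
  obtain s where s: "s < 1" "\<And>w. w \<in> D \<Longrightarrow> s < norm w \<Longrightarrow> U w = 1" using U by (auto simp: barrier_def)
  have "hyperharmonic_on D (\<lambda>w. ereal (U w))"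
    using U by (intro hyperharmonic_on_real D) (auto simp: barrier_def)
  moreover have "\<exists>m::real. \<forall>w\<in>D. ereal m \<le> ereal (U w)" using nonneg by (intro exI[of _ 0]) auto
  moreover have "indicator (sphere 0 1) y \<le> Liminf (at y within D) (\<lambda>w. ereal (U w))" for y
  proof (rule Liminf_bounded)
    show "eventually (\<lambda>w. indicator (sphere 0 1) y \<le> ereal (U w)) (at y within D)"
    proof (cases "y \<in> sphere 0 1")
      case True
      then have "eventually (\<lambda>w. w \<in> - cball 0 s) (at y)"
        using s(1) by (intro eventually_at_in_open') auto
      then show ?thesis unfolding eventually_at_filter
        by (rule eventually_mono) (use True s(2) in auto)
    next
      case False
      then show ?thesis using nonneg by (auto simp: eventually_at_filter)
    qed
  qed
  ultimately show "(\<lambda>w. ereal (U w)) \<in> upper_class D (indicator (sphere 0 1))"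
    by (auto simp: upper_class_def)
qed simp

text \<open>The inequality on |z| = R makes the pasted function continuous and equal to
  \<open>U\<close> there. At each point it touches from below either \<open>V\<close> or
  \<open>U\<close>, whichever is the smaller, and inherits its mean inequality.\<close>

lemma barrier_paste:
  assumes D: "open D" and U: "barrier D U" and R: "R < 1"
    and V: "continuous_on (D \<inter> cball 0 R) V" "\<And>z. z \<in> D \<Longrightarrow> norm z \<le> R \<Longrightarrow> 0 \<le> V z"
      "\<And>z. z \<in> D \<Longrightarrow> norm z < R \<Longrightarrow> supermean_at V z"
    and match: "\<And>z. z \<in> D \<Longrightarrow> norm z = R \<Longrightarrow> U z \<le> V z"
  shows "barrier D (\<lambda>z. if norm z \<le> R then min (U z) (V z) else U z)" (is "barrier D ?W")
proof -
  have contU: "continuous_on D U" using U by (simp add: barrier_def)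
  have contW: "continuous_on D ?W"
  proof (rule continuous_on_cases_le)
    show "continuous_on {t \<in> D. norm t \<le> R} (\<lambda>z. min (U z) (V z))"
      by (intro continuous_on_min continuous_on_subset[OF contU] continuous_on_subset[OF V(1)]) auto
    show "continuous_on {t \<in> D. R \<le> norm t} U" by (rule continuous_on_subset[OF contU]) auto
    show "continuous_on D norm" by (intro continuous_on_norm continuous_on_id)
    show "min (U t) (V t) = U t" if "t \<in> D" "norm t = R" for t using match[OF that] by simp
  qed
  have sm: "supermean_at ?W z" if z: "z \<in> D" for z
    unfolding supermean_at_iff_mean_bound
  proof (cases "norm z < R \<and> V z < U z")
    case True
    have o: "open (D \<inter> ball 0 R)" using D by auto
    show "mean_bound ?W z 0"
    proof (rule mean_bound_touching[OF o])
      show "z \<in> D \<inter> ball 0 R" using z True by auto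
      show "continuous_on (D \<inter> ball 0 R) ?W" by (rule continuous_on_subset[OF contW]) auto
      show "continuous_on (D \<inter> ball 0 R) V" by (rule continuous_on_subset[OF V(1)]) auto
      show "mean_bound V z 0" using V(3) z True by (simp add: supermean_at_iff_mean_bound[symmetric])
    qed (use True in auto)
  next
    case False
    show "mean_bound ?W z 0"
    proof (rule mean_bound_touching[OF D z contW contU])
      show "mean_bound U z 0" using U z by (simp add: barrier_def supermean_at_iff_mean_bound[symmetric])
      show "?W z = U z" using False match[OF z] by (cases "norm z = R") auto
    qed auto
  qed
  obtain s where s: "s < 1" "\<And>z. z \<in> D \<Longrightarrow> s < norm z \<Longrightarrow> U z = 1" using U by (auto simp: barrier_def)
  have "\<exists>s<1. \<forall>z\<in>D. s < norm z \<longrightarrow> ?W z = 1"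
    using s R by (intro exI[of _ "max s R"]) auto
  moreover have "0 \<le> ?W z" if "z \<in> D" for z using V(2)[OF that] U that by (auto simp: barrier_def)
  ultimately show ?thesis using contW sm by (auto simp: barrier_def)
qed

text \<open>A pole within a d of the circle of radius 1 - d has modulus below 1 - (1 - a) d, and the
  outer radius leaves room beyond it: R - |w| \<ge> a (1 - a) d and R - |z| = a (2 - a) d. Divided
  by (a d)^2 this gives a bound free of d.\<close>

lemma green_lower_bound_near:
  assumes a: "0 < a" "a < 1" and d: "0 < d" "d < 1" and z: "norm z = 1 - d"
    and w: "norm (z - w) < a * d" "z \<noteq> w"
  shows "ln (1 + (1 - a) * (2 - a)) / 2 \<le> green (1 - (1 - a)\<^sup>2 * d) w z"
proof -
  define R where "R = 1 - (1 - a)\<^sup>2 * d"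
  have aa: "(1 - a)\<^sup>2 < 1 - a" using a by (simp add: power2_eq_square)
  have nw: "norm w < 1 - (1 - a) * d"
    using norm_triangle_sub[of w z] w(1) z by (simp add: norm_minus_commute algebra_simps)
  have "(1 - a)\<^sup>2 * d < (1 - a) * d" using aa d by simp
  then have wR: "norm w < R" using nw by (simp add: R_def)
  have "(1 - a) * d < d" using a d by simp
  then have zR: "norm z < R" using z \<open>(1 - a)\<^sup>2 * d < (1 - a) * d\<close> by (simp add: R_def)
  have R: "0 < R" using wR norm_ge_zero le_less_trans by blast
  have "(1 - a) * (2 - a) \<le> (R\<^sup>2 - (norm z)\<^sup>2) * (R\<^sup>2 - (norm w)\<^sup>2) / (R\<^sup>2 * (norm (z - w))\<^sup>2)"
  proof -
    have 1: "a * (2 - a) * d * R \<le> R\<^sup>2 - (norm z)\<^sup>2"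
    proof -
      have "R\<^sup>2 - (norm z)\<^sup>2 = (R - norm z) * (R + norm z)" by (simp add: power2_eq_square algebra_simps)
      also have "R - norm z = a * (2 - a) * d" by (simp add: R_def z power2_eq_square algebra_simps)
      also have "a * (2 - a) * d * R \<le> a * (2 - a) * d * (R + norm z)" using a d by (intro mult_left_mono) auto
      finally show ?thesis .
    qed
    have 2: "a * (1 - a) * d * R \<le> R\<^sup>2 - (norm w)\<^sup>2"
    proof -
      have "a * (1 - a) * d \<le> R - norm w" using nw by (simp add: R_def power2_eq_square algebra_simps)
      then have "a * (1 - a) * d * R \<le> (R - norm w) * (R + norm w)"
        using a d R wR by (intro mult_mono) auto
      then show ?thesis by (simp add: power2_eq_square algebra_simps)
    qed
    have "(norm (z - w))\<^sup>2 \<le> (a * d)\<^sup>2" using w by (intro power_mono) auto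
    then have 3: "R\<^sup>2 * (norm (z - w))\<^sup>2 \<le> R\<^sup>2 * (a * d)\<^sup>2" by (intro mult_left_mono) auto
    have "(1 - a) * (2 - a) * (R\<^sup>2 * (norm (z - w))\<^sup>2) \<le> (1 - a) * (2 - a) * (R\<^sup>2 * (a * d)\<^sup>2)"
      using a by (intro mult_left_mono[OF 3]) auto
    also have "\<dots> = (a * (2 - a) * d * R) * (a * (1 - a) * d * R)"
      by (simp add: power2_eq_square algebra_simps)
    also have "\<dots> \<le> (R\<^sup>2 - (norm z)\<^sup>2) * (R\<^sup>2 - (norm w)\<^sup>2)"
      using 1 2 a d R zR by (intro mult_mono) auto
    finally show ?thesis using R w(2) by (simp add: pos_le_divide_eq)
  qed
  then have "ln (1 + (1 - a) * (2 - a)) \<le> ln (1 + (R\<^sup>2 - (norm z)\<^sup>2) * (R\<^sup>2 - (norm w)\<^sup>2) / (R\<^sup>2 * (norm (z - w))\<^sup>2))"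
    using a by (intro ln_mono) (auto intro!: add_pos_nonneg)
  then show ?thesis
    using green_eq[OF wR _ w(2)] zR by (simp add: R_def)
qed

lemma doubling_power:
  assumes c: "1 < c" "\<And>t. 0 < t \<Longrightarrow> t \<le> 1 \<Longrightarrow> M (1 - t/2) \<le> c * M (1 - t)"
    and t: "0 < t" "t \<le> (1::real)"
  shows "M (1 - t / 2 ^ j) \<le> c ^ j * (M (1 - t) :: real)"
proof (induction j)
  case (Suc j)
  have "M (1 - t / 2 ^ Suc j) = M (1 - (t / 2 ^ j) / 2)" by (simp add: mult.commute)
  also have "\<dots> \<le> c * M (1 - t / 2 ^ j)"
    using t by (intro c(2)) (auto simp: divide_le_eq intro: order_trans[OF t(2) one_le_power])
  also have "\<dots> \<le> c * (c ^ j * M (1 - t))" using Suc c(1) by (intro mult_left_mono) auto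
  finally show ?case by simp
qed simp

text \<open>An upper bound for the integral over a level takes \<open>M\<close> at the outer and the
  logarithm at the inner end, the opposite of the series. Aligning the logarithms leaves
  \<open>M\<close> two levels apart, which a fixed number of doublings covers.\<close>

lemma not_summable_levels:
  fixes \<phi> M :: "real \<Rightarrow> real"
  assumes \<phi>: "\<phi> \<in> {0..<1} \<rightarrow> {0<..<1}" "antimono_on {0..<1} \<phi>"
    and M: "M \<in> {0..<1} \<rightarrow> {1..}" "mono_on {0..<1} M"
    and c: "1 < c" "\<And>t. 0 < t \<Longrightarrow> t \<le> 1 \<Longrightarrow> M (1 - t/2) \<le> c * M (1 - t)"
    and q: "0 < q" "q < 1"
    and inf: "(\<integral>\<^sup>+t\<in>{0..<1}. ennreal (M t / ((1 - t) * ln (1 / \<phi> t))) \<partial>lborel) = \<infinity>"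
  shows "\<not> summable (\<lambda>n. M (1 - q ^ n) / ln (1 / \<phi> (1 - q ^ Suc n)))"
proof
  define \<Lambda> where "\<Lambda> = (\<lambda>t. ln (1 / \<phi> t))"
  assume "summable (\<lambda>n. M (1 - q ^ n) / ln (1 / \<phi> (1 - q ^ Suc n)))"
  then have sm: "summable (\<lambda>n. M (1 - q ^ n) / \<Lambda> (1 - q ^ Suc n))" by (simp add: \<Lambda>_def)
  have \<Lambda>_pos: "0 < \<Lambda> t" if "0 \<le> t" "t < 1" for t
    unfolding \<Lambda>_def by (rule ln_inverse_pos[OF \<phi>(1) that])
  have \<Lambda>_mono: "\<Lambda> s \<le> \<Lambda> t" if "0 \<le> s" "s \<le> t" "t < 1" for s t
    unfolding \<Lambda>_def by (rule ln_inverse_mono[OF \<phi> that])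
  have M1: "1 \<le> M t" if "0 \<le> t" "t < 1" for t using M(1) that by (auto simp: Pi_iff)
  have M_mono: "M s \<le> M t" if "0 \<le> s" "s \<le> t" "t < 1" for s t
    using mono_onD[OF M(2), of s t] that by auto
  have lev: "0 \<le> 1 - q ^ n" "1 - q ^ n < 1" "1 - q ^ n \<le> 1 - q ^ Suc n" for n
    using q power_decreasing[of n "Suc n" q] by (auto simp: power_le_one)
  have lev_pos: "0 < \<Lambda> (1 - q ^ n)" "0 \<le> M (1 - q ^ n)" for n
    using \<Lambda>_pos[OF lev(1,2)] order_trans[OF zero_le_one M1[OF lev(1,2)]] by auto
  \<comment> \<open>Here \<open>q\<close> may be below 1/2, so several halvings are needed to get
    from q^n below q^(n+2).\<close>
  obtain j where j: "(1/2) ^ j < q ^ 2" using real_arch_pow_inv[of "q ^ 2" "1/2"] q by auto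
  have M_shift: "M (1 - q ^ Suc (Suc n)) \<le> c ^ j * M (1 - q ^ n)" for n
  proof -
    have "q ^ n * (1/2) ^ j \<le> q ^ n * q ^ 2" using j q by (intro mult_left_mono) auto
    then have "1 - q ^ Suc (Suc n) \<le> 1 - q ^ n / 2 ^ j"
      by (simp add: power2_eq_square power_one_over field_simps)
    moreover have "0 < q ^ n / 2 ^ j" using q by simp
    ultimately have "M (1 - q ^ Suc (Suc n)) \<le> M (1 - q ^ n / 2 ^ j)"
      using lev(1)[of "Suc (Suc n)"] by (intro M_mono) auto
    also have "\<dots> \<le> c ^ j * M (1 - q ^ n)"
      using q by (intro doubling_power[OF c]) (auto simp: power_le_one)
    finally show ?thesis .
  qed
  define T where "T = (\<lambda>n. M (1 - q ^ Suc n) / \<Lambda> (1 - q ^ n))"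
  have T_nonneg: "0 \<le> T n" for n unfolding T_def by (intro divide_nonneg_pos lev_pos)
  have "summable (\<lambda>n. T (Suc n))"
  proof (rule summable_comparison_test')
    show "summable (\<lambda>n. c ^ j * (M (1 - q ^ n) / \<Lambda> (1 - q ^ Suc n)))" using sm by (rule summable_mult)
    fix n :: nat assume "0 \<le> n"
    have "T (Suc n) \<le> c ^ j * M (1 - q ^ n) / \<Lambda> (1 - q ^ Suc n)"
      unfolding T_def by (intro divide_right_mono M_shift less_imp_le lev_pos)
    then show "norm (T (Suc n)) \<le> c ^ j * (M (1 - q ^ n) / \<Lambda> (1 - q ^ Suc n))" using T_nonneg[of "Suc n"] by simp
  qed
  then have "summable T" by (subst (asm) summable_Suc_iff)
  then have sT: "summable (\<lambda>n. (1 - q) / q * T n)" by (rule summable_mult)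
  have "(\<integral>\<^sup>+t\<in>{0..<1}. ennreal (M t / ((1 - t) * \<Lambda> t)) \<partial>lborel)
      \<le> (\<Sum>n. ennreal (M (1 - q ^ Suc n) / (q ^ Suc n * \<Lambda> (1 - q ^ n))) * ennreal (q ^ n * (1 - q)))"
  proof (rule nn_integral_le_geometric_levels[OF q])
    fix n t assume t: "1 - q ^ n \<le> t" "t < 1 - q ^ Suc n"
    have t01: "0 \<le> t" "t < 1" using t lev(1)[of n] lev(2)[of "Suc n"] by linarith+
    show "ennreal (M t / ((1 - t) * \<Lambda> t)) \<le> ennreal (M (1 - q ^ Suc n) / (q ^ Suc n * \<Lambda> (1 - q ^ n)))"
    proof (rule ennreal_leI, rule frac_le)
      show "0 \<le> M (1 - q ^ Suc n)" by (rule lev_pos)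
      show "M t \<le> M (1 - q ^ Suc n)" using M_mono[of t "1 - q ^ Suc n"] t lev(2)[of "Suc n"] t01 by auto
      show "0 < q ^ Suc n * \<Lambda> (1 - q ^ n)" using q by (intro mult_pos_pos lev_pos) auto
      show "q ^ Suc n * \<Lambda> (1 - q ^ n) \<le> (1 - t) * \<Lambda> t"
        using t t01 \<Lambda>_mono[of "1 - q ^ n" t] lev_pos(1)[of n] lev(1)[of n]
        by (intro mult_mono) auto
    qed
  qed
  also have "\<dots> = (\<Sum>n. ennreal ((1 - q) / q * T n))"
  proof (intro arg_cong[of _ _ suminf] ext)
    fix n
    have "0 \<le> M (1 - q ^ Suc n) / (q ^ Suc n * \<Lambda> (1 - q ^ n))"
      using q by (intro divide_nonneg_pos mult_pos_pos lev_pos) auto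
    then have "ennreal (M (1 - q ^ Suc n) / (q ^ Suc n * \<Lambda> (1 - q ^ n))) * ennreal (q ^ n * (1 - q))
        = ennreal (M (1 - q ^ Suc n) / (q ^ Suc n * \<Lambda> (1 - q ^ n)) * (q ^ n * (1 - q)))"
      by (rule ennreal_mult'[symmetric])
    also have "M (1 - q ^ Suc n) / (q ^ Suc n * \<Lambda> (1 - q ^ n)) * (q ^ n * (1 - q)) = (1 - q) / q * T n"
      using q by (simp add: T_def)
    finally show "ennreal (M (1 - q ^ Suc n) / (q ^ Suc n * \<Lambda> (1 - q ^ n))) * ennreal (q ^ n * (1 - q)) = ennreal ((1 - q) / q * T n)" .
  qed
  also have "\<dots> = ennreal (\<Sum>n. (1 - q) / q * T n)"
    using q T_nonneg by (intro suminf_ennreal2 sT mult_nonneg_nonneg) auto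
  finally show False using inf by (simp add: \<Lambda>_def top_unique)
qed

section \<open>Divergent integral implies unavoidable\<close>

text \<open>One step of the descent from the circle of radius \<open>1 - (1 - a)\<^sup>2 d\<close> to the circle of radius
  \<open>1 - d\<close>: the barrier is cut by \<open>m (1 - V / C)\<close>, where \<open>V\<close> is the Green potential in the larger disc
  of the masses \<open>1 / L k\<close> at the centres near the smaller circle.\<close>

lemma barrier_step:
  fixes L \<rho> :: "nat \<Rightarrow> real"
  assumes ch: "champagne x r" and a: "0 < a" "a < 1" and d: "0 < d" "6 * d < 1" and C: "0 < C" and m: "0 \<le> m"
    and A: "0 \<le> A" "1 + A * (6 * d)\<^sup>2 \<le> C"
    and L: "\<And>k. 0 < L k" and \<rho>: "\<And>k. 0 < \<rho> k" "\<And>k. \<rho> k \<le> (1 - norm (x k)) / 2"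
      "\<And>j k. j \<noteq> k \<Longrightarrow> \<rho> j + \<rho> k < norm (x j - x k)"
      "\<And>k. ln (\<rho> k) - ln (r k) \<le> L k"
      "\<And>k. norm (x k) < 1 - (1 - a) * d \<Longrightarrow> 1 / (2 * (\<rho> k)\<^sup>2) / L k \<le> A"
    and L_le: "\<And>k. norm (x k) < 1 - (1 - a) * d \<Longrightarrow> L k \<le> \<Lambda>"
    and \<Lambda>: "0 < \<Lambda>"
    and count: "\<And>z. norm z = 1 - d \<Longrightarrow> \<mu> \<le> real (centre_count x a z)"
    and U: "barrier (ball 0 1 - discs_union x r) U"
      "\<And>z. z \<in> ball 0 1 - discs_union x r \<Longrightarrow> norm z = 1 - (1 - a)\<^sup>2 * d \<Longrightarrow> U z \<le> m"
  obtains U' where "barrier (ball 0 1 - discs_union x r) U'"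
    "\<And>z. z \<in> ball 0 1 - discs_union x r \<Longrightarrow> norm z = 1 - d \<Longrightarrow>
      U' z \<le> m * exp (- (ln (1 + (1 - a) * (2 - a)) / 2 * \<mu> / \<Lambda> / C))"
proof -
  define \<Omega> where "\<Omega> = ball 0 1 - discs_union x r"
  define R where "R = 1 - (1 - a)\<^sup>2 * d"
  \<comment> \<open>All centres that can lie within a d of a point of modulus 1 - d. The upper bound
    keeps them inside the disc of radius \<open>R\<close>.\<close>
  define I where "I = {k. 1 - (1 + a) * d < norm (x k) \<and> norm (x k) < 1 - (1 - a) * d}"
  have aa: "(1 - a)\<^sup>2 < 1 - a" "(1 - a)\<^sup>2 > 0" using a by (auto simp: power2_eq_square)
  have d1: "d < 1" using d by simp
  have RI: "1 - (1 - a) * d < R" using aa d by (simp add: R_def)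
  have R: "R < 1" "1 - d < R" using aa a d by (auto simp: R_def)
  have R0: "0 < R" using R d1 by linarith
  have fin: "finite I"
    by (rule finite_subset[OF _ champagne_finite_centres[OF ch, of "1 - (1 - a) * d"]])
       (use a d in \<open>auto simp: I_def\<close>)
  have xR: "norm (x k) < R" if "k \<in> I" for k using that RI by (simp add: I_def)
  have notx: "z \<noteq> x k" "r k \<le> norm (z - x k)" if "z \<in> \<Omega>" for z k
  proof -
    have "z \<notin> cball (x k) (r k)" using that by (auto simp: \<Omega>_def discs_union_def)
    then show "r k \<le> norm (z - x k)" by (simp add: dist_norm norm_minus_commute)
    then show "z \<noteq> x k" using champagne_less(2)[OF ch, of k] by auto
  qed
  define V where "V = (\<lambda>z. \<Sum>k\<in>I. 1 / L k * green R (x k) z)"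
  have V_nonneg_term: "0 \<le> 1 / L k * green R (x k) z" if "z \<in> \<Omega>" "norm z \<le> R" "k \<in> I" for z k
    using L[of k] notx(1)[OF that(1)] that xR by (intro mult_nonneg_nonneg green_nonneg) (auto simp: less_imp_le)
  have V_le: "V z \<le> C" if z: "z \<in> \<Omega>" "norm z < R" for z
  proof -
    have "(\<Sum>k\<in>I. green R (x k) z / L k) \<le> 1 + A * (6 * d)\<^sup>2"
    \<comment> \<open>The 6: a centre in \<open>I\<close> has 1 - |x k| < 2 d, and \<rho> k is at
      most half of that, so the sum is at most 3 d, half the collar parameter.\<close>
    proof (rule green_sum_le[of I R "6 * d" A x \<rho> L])
      show "1 - norm (x k) + \<rho> k \<le> 6 * d / 2" if "k \<in> I" for k
      proof -
        have "1 - norm (x k) < (1 + a) * d" using that by (simp add: I_def)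
        also have "\<dots> \<le> 2 * d" using a d by (intro mult_right_mono) auto
        finally show ?thesis using \<rho>(2)[of k] by simp
      qed
      show "1 / (2 * (\<rho> k)\<^sup>2) / L k \<le> A" if "k \<in> I" for k using \<rho>(5) that by (simp add: I_def)
      show "ln (\<rho> k) - ln (norm (z - x k)) \<le> L k" for k
      proof -
        have "ln (r k) \<le> ln (norm (z - x k))"
          using notx(2)[OF z(1)] champagne_less(2)[OF ch, of k] by (intro ln_mono) auto
        then show ?thesis using \<rho>(4)[of k] by linarith
      qed
    qed (use fin R d A L \<rho> z xR notx(1) in auto)
    then show ?thesis using A by (simp add: V_def)
  qed
  have V0: "V z = 0" if "z \<in> \<Omega>" "norm z = R" for z
    unfolding V_def using green_eq[OF xR _ notx(1)[OF that(1)]] that by (intro sum.neutral) auto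
  have V_lower: "ln (1 + (1 - a) * (2 - a)) / 2 * \<mu> / \<Lambda> \<le> V z" if z: "z \<in> \<Omega>" "norm z = 1 - d" for z
  proof -
    define g where "g = ln (1 + (1 - a) * (2 - a)) / 2"
    have g: "0 \<le> g" using a by (simp add: g_def)
    define K where "K = {k. x k \<in> ball z (a * d)}"
    have KI: "K \<subseteq> I"
    proof
      fix k assume "k \<in> K"
      then have k: "norm (z - x k) < a * d" by (simp add: K_def dist_norm)
      show "k \<in> I"
        using norm_triangle_sub[of z "x k"] norm_triangle_sub[of "x k" z] k z
        by (simp add: I_def norm_minus_commute algebra_simps)
    qed
    have finK: "finite K" using KI fin by (rule finite_subset)
    have "ball z (a * (1 - norm z)) \<inter> range x = x ` K" using z by (auto simp: K_def)
    then have "centre_count x a z = card K"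
      using champagne_inj[OF ch] by (simp add: centre_count_def card_image inj_on_subset)
    then have "\<mu> \<le> real (card K)" using count[OF z(2)] by simp
    then have "g * \<mu> / \<Lambda> \<le> g * real (card K) / \<Lambda>"
      using g \<Lambda> by (intro divide_right_mono mult_left_mono) auto
    also have "\<dots> = (\<Sum>k\<in>K. 1 / \<Lambda> * g)" by simp
    also have "\<dots> \<le> (\<Sum>k\<in>K. 1 / L k * green R (x k) z)"
    proof (rule sum_mono)
      fix k assume k: "k \<in> K"
      have "L k \<le> \<Lambda>" using k KI by (intro L_le) (auto simp: I_def)
      then have "1 / \<Lambda> \<le> 1 / L k" using L[of k] by (intro divide_left_mono) (auto simp: \<Lambda>)
      moreover have "g \<le> green R (x k) z"
        unfolding g_def R_def using k z notx(1)[OF z(1)] d1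
        by (intro green_lower_bound_near a d(1)) (auto simp: K_def dist_norm)
      ultimately show "1 / \<Lambda> * g \<le> 1 / L k * green R (x k) z"
        using g L[of k] by (intro mult_mono) (auto simp: less_imp_le)
    qed
    also have "\<dots> \<le> V z"
      unfolding V_def using fin KI z R by (intro sum_mono2 V_nonneg_term) auto
    finally show ?thesis by (simp add: g_def)
  qed
  define W where "W = (\<lambda>z. m + (- (m / C)) * V z)"
  have W_eq: "W z = m * (1 - V z / C)" for z by (simp add: W_def algebra_simps)
  have bar: "barrier \<Omega> (\<lambda>z. if norm z \<le> R then min (U z) (W z) else U z)"
  proof (rule barrier_paste)
    show "open \<Omega>" unfolding \<Omega>_def by (rule open_champagne_region[OF ch])
    show "barrier \<Omega> U" using U(1) by (simp add: \<Omega>_def)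
    show "continuous_on (\<Omega> \<inter> cball 0 R) W"
      unfolding W_def V_def
      using xR notx(1)
      by (intro continuous_at_imp_continuous_on ballI continuous_add continuous_mult continuous_const
          continuous_sum isCont_green) auto
    show "0 \<le> W z" if "z \<in> \<Omega>" "norm z \<le> R" for z
    proof -
      have "V z \<le> C" using V_le[OF that(1)] V0[OF that(1)] that(2) C by (cases "norm z = R") auto
      then show ?thesis unfolding W_eq using m C by (intro mult_nonneg_nonneg) (auto simp: divide_le_eq)
    qed
    show "supermean_at W z" if "z \<in> \<Omega>" "norm z < R" for z
      unfolding W_def V_def using that xR notx(1)
      by (intro mean_value_at_imp_supermean_at mean_value_at_add mean_value_at_const mean_value_at_cmult
          mean_value_at_sum mean_value_at_green) auto
    show "U z \<le> W z" if "z \<in> \<Omega>" "norm z = R" for z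
      using U(2)[of z] that V0[OF that] by (simp add: W_eq \<Omega>_def R_def)
  qed (rule R)
  show thesis
  proof (rule that[of "\<lambda>z. if norm z \<le> R then min (U z) (W z) else U z"])
    fix z assume z: "z \<in> ball 0 1 - discs_union x r" "norm z = 1 - d"
    have "ln (1 + (1 - a) * (2 - a)) / 2 * \<mu> / \<Lambda> / C \<le> V z / C"
      using V_lower[of z] z C by (intro divide_right_mono) (auto simp: \<Omega>_def)
    then have "1 - V z / C \<le> 1 + (- (ln (1 + (1 - a) * (2 - a)) / 2 * \<mu> / \<Lambda> / C))" by simp
    also have "\<dots> \<le> exp (- (ln (1 + (1 - a) * (2 - a)) / 2 * \<mu> / \<Lambda> / C))" by (rule exp_ge_add_one_self)
    finally have "W z \<le> m * exp (- (ln (1 + (1 - a) * (2 - a)) / 2 * \<mu> / \<Lambda> / C))"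
      unfolding W_eq by (rule mult_left_mono) (rule m)
    then show "(if norm z \<le> R then min (U z) (W z) else U z) \<le> m * exp (- (ln (1 + (1 - a) * (2 - a)) / 2 * \<mu> / \<Lambda> / C))"
      using z R by auto
  qed (use bar in \<open>simp add: \<Omega>_def\<close>)
qed

lemma barrier_one: "barrier D (\<lambda>_. 1)"
  by (auto simp: barrier_def supermean_at_const intro!: exI[of _ 0])

lemma unavoidable_if_divergent:
  fixes \<phi> M :: "real \<Rightarrow> real"
  assumes \<phi>: "\<phi> \<in> {0..<1} \<rightarrow> {0<..<1}" "antimono_on {0..<1} \<phi>"
    and M: "M \<in> {0..<1} \<rightarrow> {1..}" "mono_on {0..<1} M"
    and c: "1 < c" "\<And>t. 0 < t \<Longrightarrow> t \<le> 1 \<Longrightarrow> M (1 - t/2) \<le> c * M (1 - t)"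
    and ch: "champagne x r" and r: "\<And>k. r k = (1 - norm (x k)) * \<phi> (norm (x k))"
    and a: "0 < a" "a < 1" and b: "0 < b"
    and count: "\<And>z. z \<in> ball 0 1 \<Longrightarrow> b * M (norm z) \<le> real (centre_count x a z)"
    and \<eta>: "0 < \<eta>" "\<And>j k. j \<noteq> k \<Longrightarrow> \<eta> * (1 - norm (x k)) \<le> norm (x k - x j) * sqrt (ln (1 / \<phi> (norm (x k))))"
    and inf: "(\<integral>\<^sup>+t\<in>{0..<1}. ennreal (M t / ((1 - t) * ln (1 / \<phi> t))) \<partial>lborel) = \<infinity>"
  shows "unavoidable (discs_union x r)"
proof -
  define \<Lambda> where "\<Lambda> t = ln (1 / \<phi> t)" for t
  have \<phi>01: "0 < \<phi> t" "\<phi> t < 1" if "0 \<le> t" "t < 1" for t using \<phi>(1) that by (auto simp: Pi_iff)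
  have \<Lambda>_pos: "0 < \<Lambda> t" if "0 \<le> t" "t < 1" for t
    unfolding \<Lambda>_def by (rule ln_inverse_pos[OF \<phi>(1) that])
  have \<Lambda>_mono: "\<Lambda> s \<le> \<Lambda> t" if "0 \<le> s" "s \<le> t" "t < 1" for s t
    unfolding \<Lambda>_def by (rule ln_inverse_mono[OF \<phi> that])
  have nx: "0 \<le> norm (x k)" "norm (x k) < 1" for k using champagne_less(1)[OF ch] by auto
  define \<Omega> where "\<Omega> = ball 0 1 - discs_union x r"
  have \<Omega>: "open \<Omega>" "bounded \<Omega>"
    using open_champagne_region[OF ch] bounded_subset[OF bounded_ball, of \<Omega> 0 1] by (auto simp: \<Omega>_def)
  define L where "L k = \<Lambda> (norm (x k))" for k
  have L: "0 < L k" for k unfolding L_def by (rule \<Lambda>_pos[OF nx])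
  have L0: "0 < \<Lambda> 0" "\<Lambda> 0 \<le> L k" for k using \<Lambda>_pos[of 0] \<Lambda>_mono[of 0 "norm (x k)"] nx by (auto simp: L_def)
  \<comment> \<open>The first bound makes each \<rho> k at most a third of the distance to any other
    centre, so the discs are disjoint; the second, with L k \<ge> \<Lambda> 0, makes it at most half
    of 1 - |x k|.\<close>
  define \<delta> where "\<delta> = min (\<eta> / 3) (sqrt (\<Lambda> 0) / 2)"
  have \<delta>: "0 < \<delta>" "\<delta> \<le> \<eta> / 3" "\<delta> \<le> sqrt (\<Lambda> 0) / 2" using \<eta>(1) L0 by (auto simp: \<delta>_def)
  define \<rho> where "\<rho> k = \<delta> * (1 - norm (x k)) / sqrt (L k)" for k
  have \<rho>_pos: "0 < \<rho> k" for k using \<delta> nx[of k] L[of k] by (simp add: \<rho>_def)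
  have \<delta>L: "\<delta> / sqrt (L k) \<le> 1 / 2" for k
  proof -
    have "\<delta> \<le> sqrt (L k) / 2" using \<delta>(3) real_sqrt_le_mono[OF L0(2)[of k]] by linarith
    then show ?thesis using L[of k] by (simp add: divide_le_eq)
  qed
  have \<rho>_le: "\<rho> k \<le> (1 - norm (x k)) / 2" for k
    using mult_right_mono[OF \<delta>L[of k], of "1 - norm (x k)"] nx[of k] by (simp add: \<rho>_def)
  have \<rho>_third: "3 * \<rho> k \<le> norm (x k - x j)" if "j \<noteq> k" for j k
  proof -
    have "3 * \<delta> * (1 - norm (x k)) \<le> \<eta> * (1 - norm (x k))"
      using \<delta>(2) nx[of k] by (intro mult_right_mono) auto
    also have "\<dots> \<le> norm (x k - x j) * sqrt (L k)" using \<eta>(2)[OF that] by (simp add: L_def \<Lambda>_def)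
    finally show ?thesis using L[of k] by (simp add: \<rho>_def divide_le_eq)
  qed
  have \<rho>_disj: "\<rho> j + \<rho> k < norm (x j - x k)" if "j \<noteq> k" for j k
    using \<rho>_third[OF that] \<rho>_third[of k j] that \<rho>_pos[of j] \<rho>_pos[of k] by (simp add: norm_minus_commute)
  have \<rho>_r: "ln (\<rho> k) - ln (r k) \<le> L k" for k
  proof -
    have p: "0 < \<phi> (norm (x k))" using \<phi>01[OF nx] by blast
    have "ln (\<rho> k) \<le> ln (1 - norm (x k))"
      using \<rho>_le[of k] \<rho>_pos[of k] nx[of k] by (intro ln_mono) auto
    moreover have "ln (r k) = ln (1 - norm (x k)) - L k"
      using p nx[of k] by (simp add: r L_def \<Lambda>_def ln_mult ln_div)
    ultimately show ?thesis by linarith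
  qed
  \<comment> \<open>The ratio of the distances to the unit circle before and after one step of the
    descent.\<close>
  define q where "q = (1 - a)\<^sup>2"
  have q: "0 < q" "q < 1" using a by (auto simp: q_def power_less_one_iff)
  \<comment> \<open>This is 1 + A (6 d)^2 with density bound A = 1 / (2 \<delta>^2 ((1 - a) d)^2);
    the powers of d cancel, so one constant serves all levels.\<close>
  define C where "C = 1 + 18 / (\<delta>\<^sup>2 * (1 - a)\<^sup>2)"
  have C: "0 < C" by (simp add: C_def add_pos_nonneg)
  define \<gamma> where "\<gamma> = ln (1 + (1 - a) * (2 - a)) / 2"
  have \<gamma>: "0 < \<gamma>" using mult_pos_pos[of "1 - a" "2 - a"] a by (simp add: \<gamma>_def del: mult_pos_pos)
  define p where "p n = \<gamma> * (b * M (1 - q ^ n)) / \<Lambda> (1 - q ^ Suc n) / C" for n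
  have lev: "0 \<le> 1 - q ^ n" "1 - q ^ n < 1" for n using q by (auto simp: power_le_one)
  have p_nonneg: "0 \<le> p n" for n
  proof -
    have "1 \<le> M (1 - q ^ n)" using M(1) lev[of n] by (auto simp: Pi_iff)
    then show ?thesis unfolding p_def using \<gamma> b C \<Lambda>_pos[OF lev, of "Suc n"]
      by (intro divide_nonneg_pos mult_nonneg_nonneg) auto
  qed
  have not_summable: "\<not> summable p"
  proof
    assume "summable p"
    then have "summable (\<lambda>n. C / (\<gamma> * b) * p n)" by (rule summable_mult)
    moreover have "C / (\<gamma> * b) * p n = M (1 - q ^ n) / ln (1 / \<phi> (1 - q ^ Suc n))" for n
      using C \<gamma> b by (simp add: p_def \<Lambda>_def)
    ultimately have "summable (\<lambda>n. M (1 - q ^ n) / ln (1 / \<phi> (1 - q ^ Suc n)))" by (simp only:)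
    then show False using not_summable_levels[OF \<phi> M c q inf] by blast
  qed
  \<comment> \<open>The condition on n keeps the collar parameter 6 d below 1. Restricting to late
    levels is harmless, since tails of a divergent series diverge.\<close>
  have step: "\<exists>U'. barrier \<Omega> U' \<and> (\<forall>z\<in>\<Omega>. norm z = 1 - q ^ n \<longrightarrow> U' z \<le> m * exp (- p n))"
    if n: "6 * q ^ n < 1" and m: "0 \<le> m"
      and U: "barrier \<Omega> U" "\<And>z. z \<in> \<Omega> \<Longrightarrow> norm z = 1 - q ^ Suc n \<Longrightarrow> U z \<le> m" for n m U
  proof -
    define d where "d = q ^ n"
    have d: "0 < d" "6 * d < 1" using q n by (auto simp: d_def)
    have qd: "q ^ Suc n = (1 - a)\<^sup>2 * d" by (simp add: d_def q_def)
    have aa: "(1 - a)\<^sup>2 * d \<le> (1 - a) * d" using a d by (simp add: power2_eq_square)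
    have ad: "0 < (1 - a) * d" using a d by simp
    obtain U' where U': "barrier (ball 0 1 - discs_union x r) U'"
      "\<And>z. z \<in> ball 0 1 - discs_union x r \<Longrightarrow> norm z = 1 - d \<Longrightarrow>
        U' z \<le> m * exp (- (ln (1 + (1 - a) * (2 - a)) / 2 * (b * M (1 - d)) / \<Lambda> (1 - (1 - a)\<^sup>2 * d) / C))"
    proof (rule barrier_step[OF ch a d C m])
      show "0 \<le> 1 / (2 * \<delta>\<^sup>2 * ((1 - a) * d)\<^sup>2)" by simp
      show "1 + 1 / (2 * \<delta>\<^sup>2 * ((1 - a) * d)\<^sup>2) * (6 * d)\<^sup>2 \<le> C"
        using d a \<delta> by (simp add: C_def power_mult_distrib)
      show "0 < L k" for k by (rule L)
      show "0 < \<rho> k" for k by (rule \<rho>_pos)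
      show "\<rho> k \<le> (1 - norm (x k)) / 2" for k by (rule \<rho>_le)
      show "\<rho> j + \<rho> k < norm (x j - x k)" if "j \<noteq> k" for j k by (rule \<rho>_disj[OF that])
      show "ln (\<rho> k) - ln (r k) \<le> L k" for k by (rule \<rho>_r)
      show "1 / (2 * (\<rho> k)\<^sup>2) / L k \<le> 1 / (2 * \<delta>\<^sup>2 * ((1 - a) * d)\<^sup>2)"
        if "norm (x k) < 1 - (1 - a) * d" for k
      proof -
        have "1 / (2 * (\<rho> k)\<^sup>2) / L k = 1 / (2 * \<delta>\<^sup>2 * (1 - norm (x k))\<^sup>2)"
          using L[of k] by (simp add: \<rho>_def power_mult_distrib power_divide)
        also have "\<dots> \<le> 1 / (2 * \<delta>\<^sup>2 * ((1 - a) * d)\<^sup>2)"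
        proof (intro divide_left_mono mult_left_mono power_mono)
          show "0 < 2 * \<delta>\<^sup>2 * (1 - norm (x k))\<^sup>2 * (2 * \<delta>\<^sup>2 * ((1 - a) * d)\<^sup>2)"
            using \<delta>(1) a d nx(2)[of k] by (intro mult_pos_pos zero_less_power) auto
        qed (use that ad in auto)
        finally show ?thesis .
      qed
      show "L k \<le> \<Lambda> (1 - (1 - a)\<^sup>2 * d)" if "norm (x k) < 1 - (1 - a) * d" for k
        unfolding L_def using that aa nx[of k] lev[of "Suc n"] qd by (intro \<Lambda>_mono) auto
      show "0 < \<Lambda> (1 - (1 - a)\<^sup>2 * d)" using \<Lambda>_pos[OF lev, of "Suc n"] qd by simp
      show "b * M (1 - d) \<le> real (centre_count x a z)" if "norm z = 1 - d" for z
        using count[of z] that d by simp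
      show "barrier (ball 0 1 - discs_union x r) U" using U(1) by (simp add: \<Omega>_def)
      show "U z \<le> m" if "z \<in> ball 0 1 - discs_union x r" "norm z = 1 - (1 - a)\<^sup>2 * d" for z
        using that unfolding \<Omega>_def[symmetric] qd[symmetric] by (rule U(2))
    next
      fix U'
      assume "barrier (ball 0 1 - discs_union x r) U'"
        "\<And>z. z \<in> ball 0 1 - discs_union x r \<Longrightarrow> norm z = 1 - d \<Longrightarrow>
          U' z \<le> m * exp (- (ln (1 + (1 - a) * (2 - a)) / 2 * (b * M (1 - d)) / \<Lambda> (1 - (1 - a)\<^sup>2 * d) / C))"
      then show thesis by (rule that)
    qed
    have "\<gamma> * (b * M (1 - d)) / \<Lambda> (1 - (1 - a)\<^sup>2 * d) / C = p n"
      unfolding p_def qd by (simp add: d_def)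
    then show ?thesis using U' by (intro exI[of _ U']) (auto simp: \<Omega>_def \<gamma>_def d_def)
  qed
  \<comment> \<open>The descent starts from the constant 1 at level n + j and moves inwards, so the
    induction on j must allow n to vary.\<close>
  have levels: "\<exists>U. barrier \<Omega> U \<and> (\<forall>z\<in>\<Omega>. norm z = 1 - q ^ n \<longrightarrow> U z \<le> exp (- (\<Sum>i=n..<n+j. p i)))"
    if "6 * q ^ n < 1" for n j
    using that
  proof (induction j arbitrary: n)
    case 0
    show ?case by (intro exI[of _ "\<lambda>_. 1"]) (simp add: barrier_one)
  next
    case (Suc j)
    have "q ^ Suc n \<le> q ^ n" using q by (intro power_decreasing) auto
    then have "6 * q ^ Suc n < 1" using Suc.prems by linarith
    from Suc.IH[OF this] obtain U where U: "barrier \<Omega> U"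
      "\<And>z. z \<in> \<Omega> \<Longrightarrow> norm z = 1 - q ^ Suc n \<Longrightarrow> U z \<le> exp (- (\<Sum>i=Suc n..<Suc n+j. p i))" by blast
    have "(\<Sum>i=n..<n + Suc j. p i) = p n + (\<Sum>i=Suc n..<Suc n+j. p i)"
      by (simp add: sum.atLeast_Suc_lessThan)
    then show ?case
      using step[OF Suc.prems exp_ge_zero U] by (simp add: exp_add[symmetric] add.commute)
  qed
  have small: "harmonic_measure \<Omega> z (sphere 0 1) \<le> ereal e" if z: "z \<in> \<Omega>" and e: "0 < e" for z e
  proof -
    have z1: "norm z < 1" using z by (simp add: \<Omega>_def)
    have "(\<lambda>n. q ^ n) \<longlonglongrightarrow> 0" using q by (intro LIMSEQ_power_zero) auto
    moreover have "0 < min (1/6) (1 - norm z)" using z1 by simp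
    ultimately have "eventually (\<lambda>n. q ^ n < min (1/6) (1 - norm z)) sequentially"
      by (rule order_tendstoD(2))
    then obtain n where "q ^ n < min (1/6) (1 - norm z)" unfolding eventually_sequentially by blast
    then have n: "6 * q ^ n < 1" "norm z \<le> 1 - q ^ n" by auto
    have "\<exists>j. - ln e < (\<Sum>i=n..<n+j. p i)"
    proof (rule ccontr)
      assume "\<not> (\<exists>j. - ln e < (\<Sum>i=n..<n+j. p i))"
      then have le: "(\<Sum>i=n..<n+j. p i) \<le> - ln e" for j by (simp add: not_less)
      have "summable (\<lambda>i. p (i + n))"
      proof (rule summableI_nonneg_bounded)
        show "(\<Sum>i<j. p (i + n)) \<le> - ln e" for j
          using le[of j] sum.shift_bounds_nat_ivl[of p 0 n j] by (simp add: atLeast0LessThan add.commute)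
      qed (rule p_nonneg)
      then show False using not_summable by (simp add: summable_iff_shift)
    qed
    then obtain j where j: "- ln e < (\<Sum>i=n..<n+j. p i)" by blast
    define m where "m = exp (- (\<Sum>i=n..<n+j. p i))"
    have "m < exp (ln e)" using j by (simp add: m_def)
    then have m: "0 \<le> m" "m \<le> e" using e by (auto simp: m_def)
    obtain U where U: "barrier \<Omega> U" "\<And>w. w \<in> \<Omega> \<Longrightarrow> norm w = 1 - q ^ n \<Longrightarrow> U w \<le> m"
      using levels[OF n(1), of j] by (auto simp: m_def)
    \<comment> \<open>A last cut by the constant \<open>m\<close> carries the bound from the circle
      to the whole disc inside it, and so to \<open>z\<close>.\<close>
    have "barrier \<Omega> (\<lambda>w. if norm w \<le> 1 - q ^ n then min (U w) m else U w)"
      using lev m U by (intro barrier_paste[OF \<Omega>(1)]) (auto simp: supermean_at_const)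
    from harmonic_measure_le_barrier[OF \<Omega>(1) this z]
    have "harmonic_measure \<Omega> z (sphere 0 1) \<le> ereal (min (U z) m)" using n by simp
    also have "\<dots> \<le> ereal e" using m(2) by (simp add: min.coboundedI2)
    finally show ?thesis .
  qed
  show ?thesis
    unfolding unavoidable_def \<Omega>_def[symmetric]
  proof
    fix z assume z: "z \<in> \<Omega>"
    have "harmonic_measure \<Omega> z (sphere 0 1) \<le> 0"
      by (rule ereal_le_epsilon2) (use small[OF z] in simp)
    then show "harmonic_measure \<Omega> z (sphere 0 1) = 0"
      using harmonic_measure_nonneg[OF \<Omega> z] by (rule antisym)
  qed
qed

theorem theorem1p2:
  fixes \<phi> M :: "real \<Rightarrow> real" and x :: "nat \<Rightarrow> complex" and r :: "nat \<Rightarrow> real"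
  assumes "\<phi> \<in> {0..<1} \<rightarrow> {0<..<1}" and "antimono_on {0..<1} \<phi>"
    and "M \<in> {0..<1} \<rightarrow> {1..}" and "mono_on {0..<1} M"
    and "\<exists>c>1. \<forall>t. 0 < t \<and> t \<le> 1 \<longrightarrow> M (1 - t/2) \<le> c * M (1 - t)"
    and "champagne x r"
    and "\<And>k. r k = (1 - norm (x k)) * \<phi> (norm (x k))"
  shows "(unavoidable (discs_union x r) \<and>
          (\<exists>a b. 0 < a \<and> a < 1 \<and> 0 < b \<and>
             (\<forall>z\<in>ball 0 1. real (centre_count x a z) \<le> b * M (norm z)))
          \<longrightarrow> (\<integral>\<^sup>+t\<in>{0..<1}. ennreal (M t / ((1 - t) * ln (1 / \<phi> t))) \<partial>lborel) = \<infinity>)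
       \<and> ((\<integral>\<^sup>+t\<in>{0..<1}. ennreal (M t / ((1 - t) * ln (1 / \<phi> t))) \<partial>lborel) = \<infinity> \<and>
          (INF (j, k) \<in> {(j, k). j \<noteq> k}.
             norm (x k - x j) * (ln (1 / \<phi> (norm (x k)))) powr (1/2) / (1 - norm (x k))) > 0 \<and>
          (\<exists>a b. 0 < a \<and> a < 1 \<and> 0 < b \<and>
             (\<forall>z\<in>ball 0 1. real (centre_count x a z) \<ge> b * M (norm z)))
          \<longrightarrow> unavoidable (discs_union x r))"
proof (intro conjI impI; elim conjE exE)
  obtain c where c: "1 < c" "\<And>t. 0 < t \<Longrightarrow> t \<le> 1 \<Longrightarrow> M (1 - t/2) \<le> c * M (1 - t)"
    using assms(5) by blast
  have nx: "norm (x k) < 1" for k using champagne_less(1)[OF assms(6)] .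
  have p: "0 < \<phi> (norm (x k))" "\<phi> (norm (x k)) < 1" for k
    using assms(1) nx by (auto simp: Pi_iff)
  {
    fix a b assume un: "unavoidable (discs_union x r)" and ab: "0 < a" "a < 1" "0 < b"
      and count: "\<forall>z\<in>ball 0 1. real (centre_count x a z) \<le> b * M (norm z)"
    show "(\<integral>\<^sup>+t\<in>{0..<1}. ennreal (M t / ((1 - t) * ln (1 / \<phi> t))) \<partial>lborel) = \<infinity>"
    proof (rule ccontr)
      assume "(\<integral>\<^sup>+t\<in>{0..<1}. ennreal (M t / ((1 - t) * ln (1 / \<phi> t))) \<partial>lborel) \<noteq> \<infinity>"
      then have "summable (\<lambda>k. (1 - norm (x k)) / ln (1 / \<phi> (norm (x k))))"
        using count by (intro summable_capacities[OF assms(1-4) c assms(6) ab]) auto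
      from not_unavoidable_if_summable[OF assms(6) p assms(7) this] un show False by blast
    qed
  next
    fix a b
    assume inf: "(\<integral>\<^sup>+t\<in>{0..<1}. ennreal (M t / ((1 - t) * ln (1 / \<phi> t))) \<partial>lborel) = \<infinity>"
      and sep: "(INF (j, k) \<in> {(j, k). j \<noteq> k}.
        norm (x k - x j) * (ln (1 / \<phi> (norm (x k)))) powr (1/2) / (1 - norm (x k))) > 0"
      and ab: "0 < a" "a < 1" "0 < b"
      and count: "\<forall>z\<in>ball 0 1. b * M (norm z) \<le> real (centre_count x a z)"
    define f where "f = (\<lambda>(j, k). norm (x k - x j) * (ln (1 / \<phi> (norm (x k)))) powr (1/2) / (1 - norm (x k)))"
    define \<eta> where "\<eta> = (INF jk \<in> {(j, k). j \<noteq> k}. f jk)"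
    have \<eta>: "0 < \<eta>" using sep by (simp add: \<eta>_def f_def)
    have "0 \<le> f jk" for jk
      using nx by (auto simp: f_def less_imp_le split: prod.split intro!: divide_nonneg_nonneg)
    \<comment> \<open>The infimum is taken in the reals, where it is a lower bound only for families
      bounded below.\<close>
    then have "bdd_below (f ` {(j, k). j \<noteq> k})" by (auto intro!: bdd_belowI[of _ 0])
    then have le: "\<eta> \<le> f (j, k)" if "j \<noteq> k" for j k
      unfolding \<eta>_def using that by (intro cINF_lower) auto
    have "\<eta> * (1 - norm (x k)) \<le> norm (x k - x j) * sqrt (ln (1 / \<phi> (norm (x k))))" if "j \<noteq> k" for j k
    proof -
      have "0 \<le> ln (1 / \<phi> (norm (x k)))" using p[of k] by simp
      then show ?thesis using le[OF that] nx[of k] by (simp add: f_def powr_half_sqrt pos_le_divide_eq)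
    qed
    then show "unavoidable (discs_union x r)"
      using count by (intro unavoidable_if_divergent[OF assms(1-4) c assms(6,7) ab _ \<eta> _ inf]) auto
  }
qed

end
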